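(* Let $(\mathsf{A},\Delta)$ be a compact quantum group whose Haar state $h$ is faithful on $\mathsf{A}$, with dense Hopf $*$-algebra $\mathcal{A}$. Let $\phi\in\mathcal{A}'$ be a GNS-symmetric generating functional with Schürmann triple $((\pi,H_\pi),\eta,\phi)$, let $L_\phi=(\mathrm{id}\otimes\phi)\circ\Delta:\mathcal{A}\to\mathcal{A}$, and let $(H_\phi,D(H_\phi))$ be its closed extension on $L^2(\mathsf{A},h)$, characterized by $H_\phi(a\xi_h)=-L_\phi(a)\xi_h$ on its core $\mathcal{A}\xi_h$. On $\mathcal{H}_\phi:=(L^2(\mathsf{A},h)\otimes H_\pi)\oplus L^2(\mathsf{A},h)$ consider the representation $\pi_L:=\rho_L\oplus\lambda_L$ and the self-adjoint operator $D=\begin{pmatrix}0&d\\ d^*&0\end{pmatrix}$. If the spectrum of $(H_\phi,D(H_\phi))$ is discrete, then $(\mathcal{A},D,(\pi_L,\mathcal{H}_\phi))$ is a (possibly kernel-degenerate) spectral triple in the sense that - $[D,\pi_L(a)]$ is a bounded operator for all $a\in\mathcal{A}$; - $D$ has discrete spectrum on the orthogonal complement of its kernel.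
   Context: $\mathcal{A}\subseteq\mathsf{A}$ is the dense Hopf $*$-algebra spanned by coefficients of finite-dimensional unitary corepresentations, with counit $\varepsilon$ and antipode $S$. $h$ is the Haar state, $L^2(\mathsf{A},h)$ its GNS space with cyclic vector $\xi_h$. Sweedler notation $\Delta(a)=a_{(1)}\otimes a_{(2)}$ is used. A generating functional of a Lévy process is a hermitian linear functional $\phi$ on $\mathcal{A}$ with $\phi(1)=0$ and $\phi(a^*a)\ge0$ for $a\in\ker\varepsilon$; it is GNS-symmetric if $\phi\circ S=\phi$. Its associated Schürmann triple $((\pi,H_\pi),\eta,\phi)$ (unique up to unitary equivalence) consists of a unital $*$-representation $\pi:\mathcal{A}\to B(H_\pi)$ on a Hilbert space, a linear map $\eta:\mathcal{A}\to H_\pi$ with dense image satisfying $\eta(ab)=\pi(a)\eta(b)+\eta(a)\varepsilon(b)$, and $\phi$ with $\phi(ab)=\langle\eta(a^* ),\eta(b)\rangle$ for $a,b\in\ker\varepsilon$. $\lambda_L(a)(b\xi_h)=ab\xi_h$ and $\rho_L(a)(b\xi_h\otimes v)=a_{(1)}b\xi_h\otimes\pi(a_{(2)})v$, for $a,b\in\mathcal{A}$, $v\in H_\pi$ (bounded operators). $d$ is the closure of the (closable) operator $\mathcal{A}\xi_h\ni a\xi_h\mapsto a_{(1)}\xi_h\otimes\eta(a_{(2)})\in L^2(\mathsf{A},h)\otimes H_\pi$, and $D$ has domain $D(d^* )\oplus D(d)$. Discrete spectrum means that the spectrum consists of isolated eigenvalues of finite multiplicity. *)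

theory Defs
  imports "HOL-Analysis.Analysis"
begin

section \<open>Complex Hilbert spaces and C*-algebras\<close>

class scaleC =
  fixes scaleC :: "complex \<Rightarrow> 'a \<Rightarrow> 'a"  (infixr \<open>*\<^sub>C\<close> 75)

class complex_vector = real_vector + scaleC +
  assumes scaleC_add_right: "a *\<^sub>C (x + y) = a *\<^sub>C x + a *\<^sub>C y"
    and scaleC_add_left: "(a + b) *\<^sub>C x = a *\<^sub>C x + b *\<^sub>C x"
    and scaleC_scaleC: "a *\<^sub>C b *\<^sub>C x = (a * b) *\<^sub>C x"
    and scaleR_scaleC: "r *\<^sub>R x = complex_of_real r *\<^sub>C x"

lemma scaleC_one: "1 *\<^sub>C x = (x::'a::complex_vector)"
  using scaleR_scaleC[of 1 x] by simp

global_interpretation complex_vector: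
  vector_space "scaleC :: complex \<Rightarrow> 'a \<Rightarrow> 'a::complex_vector"
  by unfold_locales
    (simp_all add: scaleC_add_right scaleC_add_left scaleC_scaleC scaleC_one)

class complex_normed_vector = real_normed_vector + complex_vector +
  assumes norm_scaleC: "norm (a *\<^sub>C x) = cmod a * norm x"

text \<open>Inner products are linear in the second argument.\<close>

class complex_hilbert = complex_normed_vector + complete_space +
  fixes cinner :: "'a \<Rightarrow> 'a \<Rightarrow> complex"
  assumes cinner_add_right: "cinner x (y + z) = cinner x y + cinner x z"
    and cinner_scaleC_right: "cinner x (a *\<^sub>C y) = a * cinner x y"
    and cinner_cnj: "cinner y x = cnj (cinner x y)"
    and cinner_self: "cinner x x = complex_of_real ((norm x)\<^sup>2)"

class cstar_algebra = complex_normed_vector + real_normed_algebra_1 + banach +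
  fixes star :: "'a \<Rightarrow> 'a"
  assumes scaleC_mult_left: "(c *\<^sub>C x) * y = c *\<^sub>C (x * y)"
    and scaleC_mult_right: "x * (c *\<^sub>C y) = c *\<^sub>C (x * y)"
    and star_star: "star (star x) = x"
    and star_add: "star (x + y) = star x + star y"
    and star_scaleC: "star (c *\<^sub>C x) = cnj c *\<^sub>C star x"
    and star_mult: "star (x * y) = star y * star x"
    and norm_star_mult: "norm (star x * x) = (norm x)\<^sup>2"

instantiation complex :: complex_normed_vector
begin
definition scaleC_complex_def: "scaleC (c::complex) (x::complex) = c * x"
instance
  by standard
    (simp_all add: scaleC_complex_def algebra_simps norm_mult scaleR_conv_of_real)
end

text \<open>The product type carries the Hilbert space structure of the orthogonal direct sum.\<close>

instantiation prod :: (complex_vector, complex_vector) complex_vector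
begin
definition scaleC_prod_def: "scaleC c p = (c *\<^sub>C fst p, c *\<^sub>C snd p)"
instance
  by standard
    (simp_all add: scaleC_prod_def scaleR_prod_def prod_eq_iff
      scaleC_add_right scaleC_add_left scaleC_scaleC scaleR_scaleC)
end

instance prod :: (complex_normed_vector, complex_normed_vector) complex_normed_vector
proof
  fix c :: complex and p :: "'a \<times> 'b"
  have "sqrt ((cmod c * norm (fst p))\<^sup>2 + (cmod c * norm (snd p))\<^sup>2)
      = sqrt ((cmod c)\<^sup>2 * ((norm (fst p))\<^sup>2 + (norm (snd p))\<^sup>2))"
    by (simp add: power_mult_distrib distrib_left)
  then show "norm (c *\<^sub>C p) = cmod c * norm p"
    by (simp add: scaleC_prod_def norm_prod_def norm_scaleC real_sqrt_mult)
qed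

instantiation prod :: (complex_hilbert, complex_hilbert) complex_hilbert
begin
definition cinner_prod_def:
  "cinner p q = cinner (fst p) (fst q) + cinner (snd p) (snd q)"
instance
proof
  fix p q r :: "'a \<times> 'b" and c :: complex
  show "cinner p (q + r) = cinner p q + cinner p r"
    by (simp add: cinner_prod_def cinner_add_right)
  show "cinner p (c *\<^sub>C q) = c * cinner p q"
    by (simp add: cinner_prod_def scaleC_prod_def cinner_scaleC_right distrib_left)
  show "cinner q p = cnj (cinner p q)"
    using cinner_cnj[of "fst q" "fst p"] cinner_cnj[of "snd q" "snd p"]
    by (simp add: cinner_prod_def)
  show "cinner p p = complex_of_real ((norm p)\<^sup>2)"
    by (simp add: cinner_prod_def cinner_self norm_prod_def)
qed
end

section \<open>Linear maps, homomorphisms, representations\<close>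

definition clinear_on ::
  "'a::complex_vector set \<Rightarrow> ('a \<Rightarrow> 'b::complex_vector) \<Rightarrow> bool" where
  "clinear_on V f \<longleftrightarrow>
     (\<forall>x\<in>V. \<forall>y\<in>V. f (x + y) = f x + f y) \<and> (\<forall>c. \<forall>x\<in>V. f (c *\<^sub>C x) = c *\<^sub>C f x)"

definition bounded_clinear ::
  "('a::complex_normed_vector \<Rightarrow> 'b::complex_normed_vector) \<Rightarrow> bool" where
  "bounded_clinear f \<longleftrightarrow> clinear_on UNIV f \<and> bounded_linear f"

definition cbilinear ::
  "('a::complex_vector \<Rightarrow> 'b::complex_vector \<Rightarrow> 'c::complex_vector) \<Rightarrow> bool" where
  "cbilinear f \<longleftrightarrow> (\<forall>x. clinear_on UNIV (f x)) \<and> (\<forall>y. clinear_on UNIV (\<lambda>x. f x y))"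

definition unital_star_hom :: "('a::cstar_algebra \<Rightarrow> 'b::cstar_algebra) \<Rightarrow> bool" where
  "unital_star_hom f \<longleftrightarrow>
     clinear_on UNIV f \<and> f 1 = 1 \<and> (\<forall>x y. f (x * y) = f x * f y) \<and>
     (\<forall>x. f (star x) = star (f x))"

text \<open>Unital *-representation by bounded operators of a unital *-subalgebra \<open>A\<close>.\<close>

definition star_representation ::
  "'a::cstar_algebra set \<Rightarrow> ('a \<Rightarrow> 'h::complex_hilbert \<Rightarrow> 'h) \<Rightarrow> bool" where
  "star_representation A \<pi> \<longleftrightarrow>
     (\<forall>a\<in>A. bounded_clinear (\<pi> a)) \<and>
     (\<forall>v. clinear_on A (\<lambda>a. \<pi> a v)) \<and>
     (\<forall>v. \<pi> 1 v = v) \<and>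
     (\<forall>a\<in>A. \<forall>b\<in>A. \<forall>v. \<pi> (a * b) v = \<pi> a (\<pi> b v)) \<and>
     (\<forall>a\<in>A. \<forall>v w. cinner v (\<pi> (star a) w) = cinner (\<pi> a v) w)"

section \<open>Tensor products\<close>

text \<open>Tensor products are specified up to canonical isomorphism, by a bilinear map into a
  Hilbert space (resp. C*-algebra).\<close>

definition hilbert_tensor ::
  "('k::complex_hilbert \<Rightarrow> 'h::complex_hilbert \<Rightarrow> 't::complex_hilbert) \<Rightarrow> bool" where
  "hilbert_tensor tens \<longleftrightarrow>
     cbilinear tens \<and>
     (\<forall>x y v w. cinner (tens x v) (tens y w) = cinner x y * cinner v w) \<and>
     closure (complex_vector.span {tens x v | x v. True}) = UNIV"

definition cstar_norm_on :: "'a::cstar_algebra set \<Rightarrow> ('a \<Rightarrow> real) \<Rightarrow> bool" where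
  "cstar_norm_on A p \<longleftrightarrow>
     (\<forall>x\<in>A. p x \<ge> 0 \<and> (p x = 0 \<longleftrightarrow> x = 0)) \<and>
     (\<forall>x\<in>A. \<forall>y\<in>A. p (x + y) \<le> p x + p y \<and> p (x * y) \<le> p x * p y) \<and>
     (\<forall>c. \<forall>x\<in>A. p (c *\<^sub>C x) = cmod c * p x) \<and>
     (\<forall>x\<in>A. p (star x * x) = (p x)\<^sup>2)"

text \<open>The minimal (spatial) tensor product: the algebraic tensor product is embedded as a dense
  *-subalgebra (the clause on independent sets says that the canonical linear map from the
  algebraic tensor product is injective), and the norm is the least C*-norm on it.\<close>

definition min_tensor ::
  "('a::cstar_algebra \<Rightarrow> 'b::cstar_algebra \<Rightarrow> 'c::cstar_algebra) \<Rightarrow> bool" where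
  "min_tensor tens \<longleftrightarrow>
     cbilinear tens \<and>
     tens 1 1 = 1 \<and>
     (\<forall>x y z w. tens x y * tens z w = tens (x * z) (y * w)) \<and>
     (\<forall>x y. star (tens x y) = tens (star x) (star y)) \<and>
     (\<forall>B f. finite B \<and> complex_vector.independent B \<and> (\<Sum>b\<in>B. tens (f b) b) = 0
        \<longrightarrow> (\<forall>b\<in>B. f b = 0)) \<and>
     closure (complex_vector.span {tens x y | x y. True}) = UNIV \<and>
     (\<forall>p. cstar_norm_on (complex_vector.span {tens x y | x y. True}) p
        \<longrightarrow> (\<forall>t\<in>complex_vector.span {tens x y | x y. True}. norm t \<le> p t))"

text \<open>\<open>E\<close> is the continuous linear extension of \<open>x \<otimes> y \<mapsto> \<beta> x y\<close> to the completed
  tensor product; e.g. \<open>E = h \<otimes> id\<close> for \<open>\<beta> x y = h x *\<^sub>C y\<close>.\<close>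

definition tensor_extension ::
  "('a \<Rightarrow> 'b \<Rightarrow> 'c::cstar_algebra) \<Rightarrow> ('a \<Rightarrow> 'b \<Rightarrow> 'd::cstar_algebra) \<Rightarrow> ('c \<Rightarrow> 'd) \<Rightarrow> bool" where
  "tensor_extension tens \<beta> E \<longleftrightarrow> bounded_clinear E \<and> (\<forall>x y. E (tens x y) = \<beta> x y)"

section \<open>Compact quantum groups\<close>

text \<open>\<open>tens\<close> realises \<open>A \<otimes> A\<close>, while \<open>tensL\<close> and \<open>tensR\<close> realise
  \<open>(A \<otimes> A) \<otimes> A\<close> and \<open>A \<otimes> (A \<otimes> A)\<close>, identified with one and the same algebra.\<close>

locale compact_quantum_group =
  fixes tens :: "'a::cstar_algebra \<Rightarrow> 'a \<Rightarrow> 'b::cstar_algebra"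
    and tensL :: "'b \<Rightarrow> 'a \<Rightarrow> 'c::cstar_algebra"
    and tensR :: "'a \<Rightarrow> 'b \<Rightarrow> 'c"
    and \<Delta> :: "'a \<Rightarrow> 'b"
  assumes min_tensor: "min_tensor tens"
    and min_tensorL: "min_tensor tensL"
    and min_tensorR: "min_tensor tensR"
    and tens_assoc: "tensL (tens x y) z = tensR x (tens y z)"
    and comult_hom: "unital_star_hom \<Delta>"
    and coassoc: "\<exists>F G. tensor_extension tens (\<lambda>x y. tensL (\<Delta> x) y) F \<and>
      tensor_extension tens (\<lambda>x y. tensR x (\<Delta> y)) G \<and> F \<circ> \<Delta> = G \<circ> \<Delta>"
    and cancel_left: "closure (complex_vector.span {tens a 1 * \<Delta> b | a b. True}) = UNIV"
    and cancel_right: "closure (complex_vector.span {tens 1 a * \<Delta> b | a b. True}) = UNIV"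

definition haar_state ::
  "('a::cstar_algebra \<Rightarrow> 'a \<Rightarrow> 'b::cstar_algebra) \<Rightarrow> ('a \<Rightarrow> 'b) \<Rightarrow> ('a \<Rightarrow> complex) \<Rightarrow> bool" where
  "haar_state tens \<Delta> h \<longleftrightarrow>
     clinear_on UNIV h \<and> h 1 = 1 \<and> (\<forall>a. h (star a * a) \<in> \<real>\<^sub>\<ge>\<^sub>0) \<and>
     (\<exists>E. tensor_extension tens (\<lambda>x y. h x *\<^sub>C y) E \<and> (\<forall>a. E (\<Delta> a) = h a *\<^sub>C 1)) \<and>
     (\<exists>E. tensor_extension tens (\<lambda>x y. h y *\<^sub>C x) E \<and> (\<forall>a. E (\<Delta> a) = h a *\<^sub>C 1))"

definition faithful :: "('a::cstar_algebra \<Rightarrow> complex) \<Rightarrow> bool" where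
  "faithful h \<longleftrightarrow> (\<forall>a. h (star a * a) = 0 \<longrightarrow> a = 0)"

text \<open>The GNS triple \<open>(L\<^sup>2(A,h), \<Lambda>, \<xi>)\<close>; it is unique up to unitary equivalence.\<close>

definition gns_triple ::
  "('a::cstar_algebra \<Rightarrow> complex) \<Rightarrow> ('a \<Rightarrow> 'l::complex_hilbert \<Rightarrow> 'l) \<Rightarrow> 'l \<Rightarrow> bool" where
  "gns_triple h \<Lambda> \<xi> \<longleftrightarrow>
     star_representation UNIV \<Lambda> \<and> closure {\<Lambda> a \<xi> | a. True} = UNIV \<and>
     (\<forall>a. cinner \<xi> (\<Lambda> a \<xi>) = h a)"

definition unitary_corepresentation ::
  "('a::cstar_algebra \<Rightarrow> 'a \<Rightarrow> 'b::cstar_algebra) \<Rightarrow> ('a \<Rightarrow> 'b) \<Rightarrow> nat \<Rightarrow> (nat \<Rightarrow> nat \<Rightarrow> 'a) \<Rightarrow> bool"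
  where
  "unitary_corepresentation tens \<Delta> n u \<longleftrightarrow>
     (\<forall>i<n. \<forall>j<n.
        \<Delta> (u i j) = (\<Sum>k<n. tens (u i k) (u k j)) \<and>
        (\<Sum>k<n. star (u k i) * u k j) = (if i = j then 1 else 0) \<and>
        (\<Sum>k<n. u i k * star (u j k)) = (if i = j then 1 else 0))"

definition coefficient_algebra ::
  "('a::cstar_algebra \<Rightarrow> 'a \<Rightarrow> 'b::cstar_algebra) \<Rightarrow> ('a \<Rightarrow> 'b) \<Rightarrow> 'a set" where
  "coefficient_algebra tens \<Delta> = complex_vector.span
     {u i j | n u i j. unitary_corepresentation tens \<Delta> n u \<and> i < n \<and> j < n}"

text \<open>\<open>sweedler tens \<Delta> A \<beta> a\<close> is \<open>\<beta> a\<^sub>1 a\<^sub>2\<close> in summed Sweedler notation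
  \<open>\<Delta> a = a\<^sub>1 \<otimes> a\<^sub>2\<close>, for \<open>\<beta>\<close> bilinear on \<open>A\<close> and \<open>\<Delta> a\<close> in the algebraic tensor
  square of \<open>A\<close>; by bilinearity the value does not depend on the decomposition of \<open>\<Delta> a\<close>.\<close>

definition sweedler ::
  "('a \<Rightarrow> 'a \<Rightarrow> 'b::comm_monoid_add) \<Rightarrow> ('a \<Rightarrow> 'b) \<Rightarrow> 'a set \<Rightarrow>
   ('a \<Rightarrow> 'a \<Rightarrow> 'v::comm_monoid_add) \<Rightarrow> 'a \<Rightarrow> 'v" where
  "sweedler tens \<Delta> A \<beta> a =
     (THE v. \<exists>(n::nat) x y. (\<forall>i<n. x i \<in> A \<and> y i \<in> A) \<and>
        \<Delta> a = (\<Sum>i<n. tens (x i) (y i)) \<and> v = (\<Sum>i<n. \<beta> (x i) (y i)))"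

definition hopf_star_algebra ::
  "('a::cstar_algebra \<Rightarrow> 'a \<Rightarrow> 'b::cstar_algebra) \<Rightarrow> ('a \<Rightarrow> 'b) \<Rightarrow> 'a set \<Rightarrow>
   ('a \<Rightarrow> complex) \<Rightarrow> ('a \<Rightarrow> 'a) \<Rightarrow> bool" where
  "hopf_star_algebra tens \<Delta> A \<epsilon> S \<longleftrightarrow>
     complex_vector.subspace A \<and> 1 \<in> A \<and> (\<forall>a\<in>A. star a \<in> A) \<and> (\<forall>a\<in>A. \<forall>b\<in>A. a * b \<in> A) \<and>
     (\<forall>a\<in>A. \<Delta> a \<in> complex_vector.span {tens x y | x y. x \<in> A \<and> y \<in> A}) \<and>
     clinear_on A \<epsilon> \<and> \<epsilon> 1 = 1 \<and>
     (\<forall>a\<in>A. \<forall>b\<in>A. \<epsilon> (a * b) = \<epsilon> a * \<epsilon> b) \<and> (\<forall>a\<in>A. \<epsilon> (star a) = cnj (\<epsilon> a)) \<and>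
     (\<forall>a\<in>A. sweedler tens \<Delta> A (\<lambda>x y. \<epsilon> x *\<^sub>C y) a = a \<and>
             sweedler tens \<Delta> A (\<lambda>x y. \<epsilon> y *\<^sub>C x) a = a) \<and>
     clinear_on A S \<and> S ` A \<subseteq> A \<and>
     (\<forall>a\<in>A. sweedler tens \<Delta> A (\<lambda>x y. S x * y) a = \<epsilon> a *\<^sub>C 1 \<and>
             sweedler tens \<Delta> A (\<lambda>x y. x * S y) a = \<epsilon> a *\<^sub>C 1)"

section \<open>Generating functionals and Schuermann triples\<close>

definition generating_functional ::
  "'a::cstar_algebra set \<Rightarrow> ('a \<Rightarrow> complex) \<Rightarrow> ('a \<Rightarrow> complex) \<Rightarrow> bool" where
  "generating_functional A \<epsilon> \<phi> \<longleftrightarrow>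
     clinear_on A \<phi> \<and> (\<forall>a\<in>A. \<phi> (star a) = cnj (\<phi> a)) \<and> \<phi> 1 = 0 \<and>
     (\<forall>a\<in>A. \<epsilon> a = 0 \<longrightarrow> \<phi> (star a * a) \<in> \<real>\<^sub>\<ge>\<^sub>0)"

definition gns_symmetric ::
  "'a::cstar_algebra set \<Rightarrow> ('a \<Rightarrow> 'a) \<Rightarrow> ('a \<Rightarrow> complex) \<Rightarrow> bool" where
  "gns_symmetric A S \<phi> \<longleftrightarrow> (\<forall>a\<in>A. \<phi> (S a) = \<phi> a)"

definition schuermann_triple ::
  "'a::cstar_algebra set \<Rightarrow> ('a \<Rightarrow> complex) \<Rightarrow> ('a \<Rightarrow> 'h::complex_hilbert \<Rightarrow> 'h) \<Rightarrow>
   ('a \<Rightarrow> 'h) \<Rightarrow> ('a \<Rightarrow> complex) \<Rightarrow> bool" where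
  "schuermann_triple A \<epsilon> \<pi> \<eta> \<phi> \<longleftrightarrow>
     star_representation A \<pi> \<and>
     clinear_on A \<eta> \<and> closure (\<eta> ` A) = UNIV \<and>
     (\<forall>a\<in>A. \<forall>b\<in>A. \<eta> (a * b) = \<pi> a (\<eta> b) + \<epsilon> b *\<^sub>C \<eta> a) \<and>
     (\<forall>a\<in>A. \<forall>b\<in>A. \<epsilon> a = 0 \<and> \<epsilon> b = 0 \<longrightarrow> \<phi> (a * b) = cinner (\<eta> (star a)) (\<eta> b))"

section \<open>Unbounded operators\<close>

text \<open>An operator is represented by its graph: \<open>(x, y) \<in> T\<close> means that \<open>x\<close> lies in the domain
  \<open>Domain T\<close> and \<open>T x = y\<close>. The operator closure is the topological \<open>closure\<close> of the graph.\<close>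

definition op_adjoint ::
  "('x::complex_hilbert \<times> 'y::complex_hilbert) set \<Rightarrow> ('y \<times> 'x) set" where
  "op_adjoint T = {(y, z). \<forall>(x, w)\<in>T. cinner y w = cinner z x}"

definition self_adjoint :: "('x::complex_hilbert \<times> 'x) set \<Rightarrow> bool" where
  "self_adjoint T \<longleftrightarrow> closure (Domain T) = UNIV \<and> single_valued T \<and> op_adjoint T = T"

definition op_kernel :: "('x \<times> 'y::zero) set \<Rightarrow> 'x set" where
  "op_kernel T = {x. (x, 0) \<in> T}"

definition orth_complement :: "'x::complex_hilbert set \<Rightarrow> 'x set" where
  "orth_complement K = {y. \<forall>x\<in>K. cinner x y = 0}"

text \<open>Spectrum of an operator \<open>T\<close> in the Hilbert space \<open>K\<close>, a closed subspace of the ambient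
  type: \<open>\<mu>\<close> is in the resolvent set iff the inverse of \<open>T - \<mu>\<close> is (the graph of) a bounded operator
  \<open>R\<close> defined on all of \<open>K\<close>.\<close>

definition resolvent_set_on ::
  "'x::complex_hilbert set \<Rightarrow> ('x \<times> 'x) set \<Rightarrow> complex set" where
  "resolvent_set_on K T = {\<mu>. \<exists>R C.
     {(y - \<mu> *\<^sub>C x, x) | x y. (x, y) \<in> T} = {(z, R z) | z. z \<in> K} \<and>
     (\<forall>z\<in>K. norm (R z) \<le> C * norm z)}"

definition spectrum_on :: "'x::complex_hilbert set \<Rightarrow> ('x \<times> 'x) set \<Rightarrow> complex set" where
  "spectrum_on K T = - resolvent_set_on K T"

definition discrete_spectrum_on :: "'x::complex_hilbert set \<Rightarrow> ('x \<times> 'x) set \<Rightarrow> bool" where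
  "discrete_spectrum_on K T \<longleftrightarrow>
     (\<forall>\<mu>\<in>spectrum_on K T.
        \<mu> isolated_in spectrum_on K T \<and>
        (\<exists>x. x \<noteq> 0 \<and> (x, \<mu> *\<^sub>C x) \<in> T) \<and>
        (\<exists>B. finite B \<and> {x. (x, \<mu> *\<^sub>C x) \<in> T} = complex_vector.span B))"

text \<open>\<open>T\<close> preserves the domain of \<open>D\<close>, and \<open>D T - T D\<close> agrees on that domain with a bounded
  everywhere defined operator \<open>C\<close>.\<close>

definition bounded_commutator ::
  "('x::complex_hilbert \<times> 'x) set \<Rightarrow> ('x \<Rightarrow> 'x) \<Rightarrow> bool" where
  "bounded_commutator D T \<longleftrightarrow>
     (\<exists>C. bounded_clinear C \<and> (\<forall>(x, y)\<in>D. (T x, T y + C x) \<in> D))"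

definition kernel_degenerate_spectral_triple ::
  "'a::cstar_algebra set \<Rightarrow> ('x::complex_hilbert \<times> 'x) set \<Rightarrow> ('a \<Rightarrow> 'x \<Rightarrow> 'x) \<Rightarrow> bool" where
  "kernel_degenerate_spectral_triple A D \<pi> \<longleftrightarrow>
     star_representation A \<pi> \<and>
     self_adjoint D \<and>
     (\<forall>a\<in>A. bounded_commutator D (\<pi> a)) \<and>
     (let K = orth_complement (op_kernel D) in discrete_spectrum_on K (D \<inter> K \<times> K))"

section \<open>The Dirac operator of a Levy process\<close>

text \<open>In the following \<open>a \<xi>\<^sub>h\<close> is written \<open>\<Lambda> a \<xi>\<close> with the GNS representation \<open>\<Lambda>\<close>, and
  \<open>htens\<close> is the tensor product \<open>L\<^sup>2(A,h) \<otimes> H\<^sub>\<pi>\<close>.\<close>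

definition L_op ::
  "('a::cstar_algebra \<Rightarrow> 'a \<Rightarrow> 'b::cstar_algebra) \<Rightarrow> ('a \<Rightarrow> 'b) \<Rightarrow> 'a set \<Rightarrow>
   ('a \<Rightarrow> complex) \<Rightarrow> 'a \<Rightarrow> 'a" where
  "L_op tens \<Delta> A \<phi> = sweedler tens \<Delta> A (\<lambda>x y. \<phi> y *\<^sub>C x)"

definition H_op ::
  "('a::cstar_algebra \<Rightarrow> 'a \<Rightarrow> 'b::cstar_algebra) \<Rightarrow> ('a \<Rightarrow> 'b) \<Rightarrow> 'a set \<Rightarrow>
   ('a \<Rightarrow> complex) \<Rightarrow> ('a \<Rightarrow> 'l::complex_hilbert \<Rightarrow> 'l) \<Rightarrow> 'l \<Rightarrow> ('l \<times> 'l) set" where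
  "H_op tens \<Delta> A \<phi> \<Lambda> \<xi> = closure {(\<Lambda> a \<xi>, - \<Lambda> (L_op tens \<Delta> A \<phi> a) \<xi>) | a. a \<in> A}"

definition d_op ::
  "('a::cstar_algebra \<Rightarrow> 'a \<Rightarrow> 'b::cstar_algebra) \<Rightarrow> ('a \<Rightarrow> 'b) \<Rightarrow> 'a set \<Rightarrow>
   ('l::complex_hilbert \<Rightarrow> 'h::complex_hilbert \<Rightarrow> 't::complex_hilbert) \<Rightarrow>
   ('a \<Rightarrow> 'h) \<Rightarrow> ('a \<Rightarrow> 'l \<Rightarrow> 'l) \<Rightarrow> 'l \<Rightarrow> ('l \<times> 't) set" where
  "d_op tens \<Delta> A htens \<eta> \<Lambda> \<xi> =
     closure {(\<Lambda> a \<xi>, sweedler tens \<Delta> A (\<lambda>x y. htens (\<Lambda> x \<xi>) (\<eta> y)) a) | a. a \<in> A}"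

text \<open>The operator with matrix \<open>0, d; d\<^sup>*, 0\<close> and domain \<open>D(d\<^sup>*) \<oplus> D(d)\<close>.\<close>

definition dirac_op ::
  "('l::complex_hilbert \<times> 't::complex_hilbert) set \<Rightarrow> (('t \<times> 'l) \<times> ('t \<times> 'l)) set" where
  "dirac_op d = {((v, w), (v', w')). (w, v') \<in> d \<and> (v, w') \<in> op_adjoint d}"

definition rho_L ::
  "('a::cstar_algebra \<Rightarrow> 'a \<Rightarrow> 'b::cstar_algebra) \<Rightarrow> ('a \<Rightarrow> 'b) \<Rightarrow> 'a set \<Rightarrow>
   ('l::complex_hilbert \<Rightarrow> 'h::complex_hilbert \<Rightarrow> 't::complex_hilbert) \<Rightarrow>
   ('a \<Rightarrow> 'h \<Rightarrow> 'h) \<Rightarrow> ('a \<Rightarrow> 'l \<Rightarrow> 'l) \<Rightarrow> 'l \<Rightarrow> 'a \<Rightarrow> 't \<Rightarrow> 't" where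
  "rho_L tens \<Delta> A htens \<pi> \<Lambda> \<xi> a =
     (THE T. bounded_clinear T \<and>
        (\<forall>b\<in>A. \<forall>v. T (htens (\<Lambda> b \<xi>) v) =
           sweedler tens \<Delta> A (\<lambda>x y. htens (\<Lambda> (x * b) \<xi>) (\<pi> y v)) a))"

text \<open>\<open>\<lambda>\<^sub>L\<close> is the restriction of \<open>\<Lambda>\<close> to \<open>A\<close>, since \<open>\<Lambda> a (\<Lambda> b \<xi>) = \<Lambda> (a * b) \<xi>\<close>.\<close>

definition pi_L ::
  "('a::cstar_algebra \<Rightarrow> 'a \<Rightarrow> 'b::cstar_algebra) \<Rightarrow> ('a \<Rightarrow> 'b) \<Rightarrow> 'a set \<Rightarrow>
   ('l::complex_hilbert \<Rightarrow> 'h::complex_hilbert \<Rightarrow> 't::complex_hilbert) \<Rightarrow>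
   ('a \<Rightarrow> 'h \<Rightarrow> 'h) \<Rightarrow> ('a \<Rightarrow> 'l \<Rightarrow> 'l) \<Rightarrow> 'l \<Rightarrow> 'a \<Rightarrow> 't \<times> 'l \<Rightarrow> 't \<times> 'l" where
  "pi_L tens \<Delta> A htens \<pi> \<Lambda> \<xi> a = map_prod (rho_L tens \<Delta> A htens \<pi> \<Lambda> \<xi> a) (\<Lambda> a)"

end

theory Submission
  imports Defs "HOL-Computational_Algebra.Fundamental_Theorem_Algebra"
begin

text \<open>GNS-symmetry and the invariance of \<open>h\<close> give \<open>\<langle>d a, d b\<rangle> = - 2 h(a\<^sup>* L b)\<close> on the coefficient
  algebra, so \<open>d\<close> is closable and formally \<open>d\<^sup>* d = 2 H\<close>. As \<open>L\<close> leaves the span of each row of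
  coefficients invariant and is symmetric, \<open>A \<xi>\<^sub>h\<close> is spanned by eigenvectors \<open>y\<close> of \<open>H\<close>. If
  \<open>H y = (s\<^sup>2/2) y\<close> with \<open>s \<noteq> 0\<close>, then \<open>(s\<^sup>-\<^sup>1 d y, y)\<close> is an eigenvector of \<open>D\<close> for \<open>s\<close>, and these vectors
  are total in the orthogonal complement of the kernel. Hence the spectrum of \<open>D\<close> there is
  contained in the closure of these \<open>s\<close>, and discreteness is inherited from \<open>H\<close> through
  \<open>s \<mapsto> s\<^sup>2/2\<close>. The cocycle identity yields \<open>d \<lambda>\<^sub>L(a) = \<rho>\<^sub>L(a) d + M\<^sub>a\<close> with
  \<open>M\<^sub>a v = a\<^sub>1 v \<otimes> \<eta>(a\<^sub>2)\<close> bounded, so the commutator with \<open>\<pi>\<^sub>L(a)\<close> has off-diagonal entries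
  \<open>M\<^sub>a\<close> and \<open>- M\<^sub>b\<^sup>*\<close>, where \<open>b = a\<^sup>*\<close>.\<close>

text \<open>No spectral theorem is invoked. A total family of eigenvectors replaces it: for a closed
  symmetric operator with such a family, any \<mu> at positive distance from the corresponding
  eigenvalues has a bounded resolvent, built termwise on finite sums of eigenvectors and extended by
  completeness. The obstacle is that the form identity and the eigenvectors live on the core only,
  whereas \<open>H\<close> and \<open>D\<close> come from closures whose domains are not described.
  A general eigenvector of \<open>D\<close> is therefore compared with the eigenvectors of the core
  by inner products. Isolation of the spectral points of \<open>H\<close> turns a limit of
  eigenvalues into an eigenvalue, and finite multiplicity passes to \<open>D\<close> because an
  eigenvector for s \<noteq> 0 is determined by its second component. Neither the counit nor the
  antipode comes with a formula on matrix coefficients: both are computed there by cancelling a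
  unitary matrix. Continuity of the Haar state, which the density of the core rests on, is derived
  from positivity.\<close>

lemma bounded_bilinear_scaleC:
  "bounded_bilinear (scaleC :: complex \<Rightarrow> 'a \<Rightarrow> 'a::complex_normed_vector)"
proof
  fix a b :: complex and x y :: 'a and r :: real
  show "(a + b) *\<^sub>C x = a *\<^sub>C x + b *\<^sub>C x" by (rule scaleC_add_left)
  show "a *\<^sub>C (x + y) = a *\<^sub>C x + a *\<^sub>C y" by (rule scaleC_add_right)
  show "(r *\<^sub>R a) *\<^sub>C x = r *\<^sub>R (a *\<^sub>C x)"
    by (simp add: scaleR_scaleC[of _ "a *\<^sub>C x"] scaleC_scaleC scaleR_conv_of_real)
  show "a *\<^sub>C (r *\<^sub>R x) = r *\<^sub>R (a *\<^sub>C x)"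
    by (simp add: scaleR_scaleC[of _ "a *\<^sub>C x"] scaleR_scaleC[of _ x] scaleC_scaleC mult.commute)
  show "\<exists>K. \<forall>a (x::'a). norm (a *\<^sub>C x) \<le> norm a * norm x * K"
    by (rule exI[of _ 1]) (simp add: norm_scaleC)
qed

interpretation scaleC: bounded_bilinear "scaleC :: complex \<Rightarrow> 'a \<Rightarrow> 'a::complex_normed_vector"
  by (rule bounded_bilinear_scaleC)

lemmas tendsto_scaleC[tendsto_intros] = scaleC.tendsto
lemmas continuous_on_scaleC[continuous_intros] = scaleC.continuous_on

lemma scaleC_minus_one: "(- 1) *\<^sub>C x = - (x::'a::complex_vector)"
  using complex_vector.scale_minus_left[of 1 x] by (simp add: scaleC_one)

lemma scaleR_in_csubspace:
  "complex_vector.subspace V \<Longrightarrow> x \<in> V \<Longrightarrow> r *\<^sub>R x \<in> V"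
  by (simp add: scaleR_scaleC complex_vector.subspace_scale)

section \<open>Identities and inequalities for the inner product\<close>

lemma cinner_add_left: "cinner (x + y) z = cinner x z + cinner y z"
  by (subst (1 2 3) cinner_cnj) (simp add: cinner_add_right)

lemma cinner_scaleC_left: "cinner (a *\<^sub>C x) y = cnj a * cinner x y"
  by (subst (1 2) cinner_cnj) (simp add: cinner_scaleC_right)

lemma cinner_zero_right [simp]: "cinner x 0 = 0"
  using cinner_scaleC_right[of x 0 0] by simp

lemma cinner_zero_left [simp]: "cinner 0 x = 0"
  using cinner_scaleC_left[of 0 0 x] by simp

lemma cinner_minus_right: "cinner x (- y) = - cinner x y"
  using cinner_scaleC_right[of x "- 1" y] by (simp add: scaleC_minus_one)

lemma cinner_minus_left: "cinner (- x) y = - cinner x y"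
  using cinner_scaleC_left[of "- 1" x y] by (simp add: scaleC_minus_one)

lemma cinner_diff_right: "cinner x (y - z) = cinner x y - cinner x z"
  using cinner_add_right[of x y "- z"] by (simp add: cinner_minus_right)

lemma cinner_diff_left: "cinner (x - y) z = cinner x z - cinner y z"
  using cinner_add_left[of x "- y" z] by (simp add: cinner_minus_left)

lemma cinner_sum_right: "cinner x (\<Sum>i\<in>I. f i) = (\<Sum>i\<in>I. cinner x (f i))"
  by (induction I rule: infinite_finite_induct) (simp_all add: cinner_add_right)

lemma cinner_sum_left: "cinner (\<Sum>i\<in>I. f i) x = (\<Sum>i\<in>I. cinner (f i) x)"
  by (induction I rule: infinite_finite_induct) (simp_all add: cinner_add_left)

lemma cinner_eq_zero_iff [simp]: "cinner x x = 0 \<longleftrightarrow> x = 0"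
  by (simp add: cinner_self)

lemma cinner_eq_zero_commute: "cinner x y = 0 \<longleftrightarrow> cinner y x = 0"
  by (subst cinner_cnj) simp

lemma norm_add_square:
  "(norm (x + y :: 'a::complex_hilbert))\<^sup>2 = (norm x)\<^sup>2 + (norm y)\<^sup>2 + 2 * Re (cinner x y)"
proof -
  have "Re (cinner y x) = Re (cinner x y)" by (subst cinner_cnj) simp
  moreover have "Re (cinner (x + y) (x + y)) =
      Re (cinner x x) + Re (cinner y y) + Re (cinner x y) + Re (cinner y x)"
    by (simp add: cinner_add_left cinner_add_right)
  ultimately show ?thesis by (simp add: cinner_self)
qed

lemma norm_diff_square:
  "(norm (x - y :: 'a::complex_hilbert))\<^sup>2 = (norm x)\<^sup>2 + (norm y)\<^sup>2 - 2 * Re (cinner x y)"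
  using norm_add_square[of x "- y"] by (simp add: cinner_minus_right)

lemma norm_sum_orthogonal:
  fixes f :: "'i \<Rightarrow> 'a::complex_hilbert"
  assumes "finite I" "\<And>i j. i \<in> I \<Longrightarrow> j \<in> I \<Longrightarrow> i \<noteq> j \<Longrightarrow> cinner (f i) (f j) = 0"
  shows "(norm (\<Sum>i\<in>I. f i))\<^sup>2 = (\<Sum>i\<in>I. (norm (f i))\<^sup>2)"
  using assms
proof (induction I rule: finite_induct)
  case (insert i I)
  have "cinner (f i) (\<Sum>i\<in>I. f i) = 0"
    using insert by (simp add: cinner_sum_right, intro sum.neutral) auto
  then show ?case using insert by (simp add: norm_add_square)
qed simp

lemma Cauchy_Schwarz_cinner: "cmod (cinner x y) \<le> norm x * norm (y::'a::complex_hilbert)"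
proof (cases "x = 0")
  case False
  \<comment> \<open>\<open>c *\<^sub>C x\<close> is the orthogonal projection of \<open>y\<close>
    onto the line of \<open>x\<close>; Pythagoras then gives the inequality.\<close>
  define c where "c = cinner x y / complex_of_real ((norm x)\<^sup>2)"
  have *: "cinner x (c *\<^sub>C x) = cinner x y"
    using False by (simp add: cinner_scaleC_right cinner_self c_def)
  have "(norm y)\<^sup>2 = (norm (c *\<^sub>C x + (y - c *\<^sub>C x)))\<^sup>2" by simp
  also have "\<dots> = (norm (c *\<^sub>C x))\<^sup>2 + (norm (y - c *\<^sub>C x))\<^sup>2"
    using * by (subst norm_add_square) (simp add: cinner_diff_right cinner_scaleC_left)
  finally have "(norm (c *\<^sub>C x))\<^sup>2 \<le> (norm y)\<^sup>2" by simp
  then have "norm (c *\<^sub>C x) \<le> norm y" by (simp add: power2_le_iff_abs_le)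
  moreover have "norm (c *\<^sub>C x) * norm x = cmod (cinner x y)"
    using False by (simp add: norm_scaleC c_def norm_divide power2_eq_square norm_mult field_simps)
  ultimately show ?thesis by (metis mult.commute mult_right_mono norm_ge_zero)
qed simp

text \<open>This supplies the limit and continuity rules on which all later closure arguments
  rest.\<close>

lemma bounded_bilinear_cinner:
  "bounded_bilinear (cinner :: 'a \<Rightarrow> 'a::complex_hilbert \<Rightarrow> complex)"
proof
  fix x y z :: 'a and r :: real
  show "cinner (r *\<^sub>R x) y = r *\<^sub>R cinner x y"
    by (simp add: scaleR_scaleC[of _ x] cinner_scaleC_left scaleR_conv_of_real)
  show "cinner x (r *\<^sub>R y) = r *\<^sub>R cinner x y"
    by (simp add: scaleR_scaleC[of _ y] cinner_scaleC_right scaleR_conv_of_real)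
  show "\<exists>K. \<forall>x y :: 'a. norm (cinner x y) \<le> norm x * norm y * K"
    by (rule exI[of _ 1]) (simp add: Cauchy_Schwarz_cinner)
qed (simp_all add: cinner_add_left cinner_add_right)

interpretation cinner: bounded_bilinear "cinner :: 'a \<Rightarrow> 'a::complex_hilbert \<Rightarrow> complex"
  by (rule bounded_bilinear_cinner)

lemmas tendsto_cinner[tendsto_intros] = cinner.tendsto
lemmas continuous_on_cinner[continuous_intros] = cinner.continuous_on

lemma closure_csubspace:
  fixes V :: "'a::complex_normed_vector set"
  assumes "complex_vector.subspace V"
  shows "complex_vector.subspace (closure V)"
  unfolding complex_vector.subspace_def
proof (intro conjI ballI allI)
  show "0 \<in> closure V"
    using assms closure_subset complex_vector.subspace_0 by blast
next
  fix x y assume "x \<in> closure V" "y \<in> closure V"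
  then obtain f g where "\<forall>n. f n \<in> V" "f \<longlonglongrightarrow> x" "\<forall>n. g n \<in> V" "g \<longlonglongrightarrow> y"
    by (auto simp: closure_sequential)
  then show "x + y \<in> closure V"
    unfolding closure_sequential
    by (intro exI[of _ "\<lambda>n. f n + g n"])
      (auto intro!: tendsto_intros complex_vector.subspace_add[OF assms])
next
  fix c x assume "x \<in> closure V"
  then obtain f where "\<forall>n. f n \<in> V" "f \<longlonglongrightarrow> x"
    by (auto simp: closure_sequential)
  then show "c *\<^sub>C x \<in> closure V"
    unfolding closure_sequential
    by (intro exI[of _ "\<lambda>n. c *\<^sub>C f n"])
      (auto intro!: tendsto_intros complex_vector.subspace_scale[OF assms])
qed

subsection \<open>Orthogonal projection\<close>

text \<open>A minimising sequence for the distance from \<open>x\<close> to \<open>M\<close> is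
  Cauchy by the parallelogram law, and the residue at its limit is orthogonal to
  \<open>M\<close>.\<close>

theorem orthogonal_decomposition:
  fixes M :: "'a::complex_hilbert set"
  assumes M: "complex_vector.subspace M" and cl: "closed M"
  obtains m p where "m \<in> M" "p \<in> orth_complement M" "x = m + p"
proof -
  define D where "D = (\<lambda>m. (norm (x - m))\<^sup>2) ` M"
  define d where "d = Inf D"
  have D: "D \<noteq> {}" "bdd_below D"
    using complex_vector.subspace_0[OF M] by (auto simp: D_def intro!: bdd_belowI[of _ 0])
  have lb: "d \<le> (norm (x - m))\<^sup>2" if "m \<in> M" for m
    unfolding d_def using that D by (intro cInf_lower) (auto simp: D_def)
  have "\<exists>m\<in>M. (norm (x - m))\<^sup>2 < d + inverse (real (Suc n))" for n
    using cInf_lessD[OF D(1), of "d + inverse (real (Suc n))"] by (auto simp: d_def D_def)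
  then obtain f where f: "\<And>n. f n \<in> M" "\<And>n. (norm (x - f n))\<^sup>2 < d + inverse (real (Suc n))"
    by metis
  \<comment> \<open>Parallelogram law for \<open>x - f m\<close> and \<open>x - f n\<close>: the
    midpoint lies in \<open>M\<close>, so its squared distance to \<open>x\<close> is at least
    \<open>d\<close>.\<close>
  have par: "(norm (f m - f n))\<^sup>2 \<le> 2 * inverse (real (Suc m)) + 2 * inverse (real (Suc n))" for m n
  proof -
    let ?c = "(1/2::real) *\<^sub>R (f m + f n)"
    have "?c \<in> M"
      using f M by (intro scaleR_in_csubspace complex_vector.subspace_add) auto
    then have "d \<le> (norm (x - ?c))\<^sup>2" by (rule lb)
    moreover have "x - f m + (x - f n) = 2 *\<^sub>R (x - ?c)"
      by (simp add: algebra_simps scaleR_2)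
    then have "(norm (x - f m + (x - f n)))\<^sup>2 = 4 * (norm (x - ?c))\<^sup>2"
      by (simp add: power_mult_distrib)
    moreover have "(norm (f m - f n))\<^sup>2 = (norm (x - f n - (x - f m)))\<^sup>2" by simp
    then have "(norm (f m - f n))\<^sup>2 + (norm (x - f m + (x - f n)))\<^sup>2 =
        2 * (norm (x - f m))\<^sup>2 + 2 * (norm (x - f n))\<^sup>2"
      by (simp only: norm_diff_square[of "x - f n"] norm_add_square add.commute)
        (subst cinner_cnj, simp)
    ultimately show ?thesis using f(2)[of m] f(2)[of n] by argo
  qed
  have "Cauchy f"
  proof (rule metric_CauchyI)
    fix e :: real assume e: "e > 0"
    then obtain N where N: "inverse (real (Suc N)) < e\<^sup>2 / 4"
      using reals_Archimedean[of "e\<^sup>2 / 4"] by auto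
    have "dist (f m) (f n) < e" if "m \<ge> N" "n \<ge> N" for m n
    proof -
      have "inverse (real (Suc m)) \<le> inverse (real (Suc N))" "inverse (real (Suc n)) \<le> inverse (real (Suc N))"
        using that by (auto intro!: le_imp_inverse_le)
      then have "(norm (f m - f n))\<^sup>2 < e\<^sup>2" using par[of m n] N by linarith
      then show ?thesis using e by (simp add: dist_norm power_less_imp_less_base)
    qed
    then show "\<exists>N. \<forall>m\<ge>N. \<forall>n\<ge>N. dist (f m) (f n) < e" by blast
  qed
  then obtain m where lim: "f \<longlonglongrightarrow> m" using convergent_eq_Cauchy by blast
  have mM: "m \<in> M" using cl lim f(1) closed_sequentially by blast
  have "(\<lambda>n. (norm (x - f n))\<^sup>2) \<longlonglongrightarrow> (norm (x - m))\<^sup>2"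
    by (intro tendsto_intros lim)
  moreover have "(\<lambda>n. d + inverse (real (Suc n))) \<longlonglongrightarrow> d + 0"
    by (intro tendsto_intros LIMSEQ_inverse_real_of_nat)
  ultimately have min: "(norm (x - m))\<^sup>2 \<le> d"
    using f(2) by (intro LIMSEQ_le[of _ _ _ "d"]) (auto intro: less_imp_le)
  have "cinner y (x - m) = 0" if y: "y \<in> M" for y
  proof (cases "y = 0")
    case False
    \<comment> \<open>Moving \<open>m\<close> by the projection of the residue onto \<open>y\<close>
      would shorten the distance unless that projection is zero.\<close>
    define c where "c = cinner y (x - m) / complex_of_real ((norm y)\<^sup>2)"
    have *: "cinner y (c *\<^sub>C y) = cinner y (x - m)"
      using False by (simp add: cinner_scaleC_right cinner_self c_def)
    let ?p = "x - (m + c *\<^sub>C y)"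
    have "m + c *\<^sub>C y \<in> M"
      using mM y M by (intro complex_vector.subspace_add complex_vector.subspace_scale)
    then have "d \<le> (norm ?p)\<^sup>2" by (rule lb)
    moreover have "(norm (x - m))\<^sup>2 = (norm (c *\<^sub>C y + ?p))\<^sup>2" by simp
    moreover have "(norm (c *\<^sub>C y + ?p))\<^sup>2 = (norm (c *\<^sub>C y))\<^sup>2 + (norm ?p)\<^sup>2"
    proof (subst norm_add_square)
      have "cinner y ?p = cinner y (x - m) - cinner y (c *\<^sub>C y)"
        by (simp add: cinner_diff_right cinner_add_right)
      then show "(norm (c *\<^sub>C y))\<^sup>2 + (norm ?p)\<^sup>2 + 2 * Re (cinner (c *\<^sub>C y) ?p) =
          (norm (c *\<^sub>C y))\<^sup>2 + (norm ?p)\<^sup>2"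
        using * by (simp add: cinner_scaleC_left)
    qed
    ultimately have "(norm (c *\<^sub>C y))\<^sup>2 \<le> 0" using min by linarith
    then have "c *\<^sub>C y = 0" by simp
    then show ?thesis using * by (metis cinner_zero_right)
  qed simp
  then show ?thesis
    using that[of m "x - m"] mM by (simp add: orth_complement_def)
qed

lemma orth_complement_csubspace: "complex_vector.subspace (orth_complement M)"
  by (auto simp: complex_vector.subspace_def orth_complement_def cinner_add_right cinner_scaleC_right)

lemma closed_orth_complement: "closed (orth_complement (M::'a::complex_hilbert set))"
proof -
  have "closed (\<Inter>x\<in>M. {y. cinner x y = 0})"
    by (intro closed_INT ballI closed_Collect_eq continuous_intros)
  moreover have "orth_complement M = (\<Inter>x\<in>M. {y. cinner x y = 0})"
    by (auto simp: orth_complement_def)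
  ultimately show ?thesis by simp
qed

lemma orth_complement_closure_span:
  "orth_complement (closure (complex_vector.span M)) = orth_complement (M::'a::complex_hilbert set)"
proof
  show "orth_complement (closure (complex_vector.span M)) \<subseteq> orth_complement M"
    unfolding orth_complement_def using complex_vector.span_superset closure_subset by blast
  show "orth_complement M \<subseteq> orth_complement (closure (complex_vector.span M))"
  proof
    fix y assume y: "y \<in> orth_complement M"
    have sub: "M \<subseteq> orth_complement {y}"
      using y by (auto simp: orth_complement_def cinner_eq_zero_commute)
    have "closure (complex_vector.span M) \<subseteq> orth_complement {y}"
      by (intro closure_minimal complex_vector.span_minimal closed_orth_complement
          orth_complement_csubspace sub)
    then show "y \<in> orth_complement (closure (complex_vector.span M))"
      by (auto simp: orth_complement_def cinner_eq_zero_commute)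
  qed
qed

text \<open>The component of \<open>x\<close> orthogonal to the closed span stays in
  \<open>K\<close>, as both \<open>x\<close> and the span do, so the hypothesis kills it.\<close>

lemma total_iff_orth:
  assumes "complex_vector.subspace K" "closed K" "M \<subseteq> K"
    and "\<And>y::'a::complex_hilbert. y \<in> K \<Longrightarrow> y \<in> orth_complement M \<Longrightarrow> y = 0"
  shows "closure (complex_vector.span M) = K"
proof
  show sub: "closure (complex_vector.span M) \<subseteq> K"
    using assms by (intro closure_minimal complex_vector.span_minimal)
  show "K \<subseteq> closure (complex_vector.span M)"
  proof
    fix x assume x: "x \<in> K"
    obtain m p where mp: "m \<in> closure (complex_vector.span M)"
        "p \<in> orth_complement (closure (complex_vector.span M))" "x = m + p"
      by (rule orthogonal_decomposition[of "closure (complex_vector.span M)" x])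
        (auto intro: closure_csubspace)
    have "p = x - m" using mp by simp
    then have "p \<in> K" using x mp sub assms(1) complex_vector.subspace_diff by blast
    then have "p = 0" using mp(2) assms(4) orth_complement_closure_span by blast
    then show "x \<in> closure (complex_vector.span M)" using mp by simp
  qed
qed

lemma dense_orth_zero:
  assumes "closure M = UNIV" "\<And>x. x \<in> M \<Longrightarrow> cinner x y = 0"
  shows "y = (0::'a::complex_hilbert)"
proof -
  have "M \<subseteq> orth_complement {y}"
    using assms by (auto simp: orth_complement_def cinner_eq_zero_commute)
  then have "closure M \<subseteq> orth_complement {y}" by (intro closure_minimal closed_orth_complement)
  then have "y \<in> orth_complement {y}" using assms by auto
  then show ?thesis by (simp add: orth_complement_def)
qed

lemma dense_if_orth_zero:
  assumes "complex_vector.subspace M" "\<And>y::'a::complex_hilbert. y \<in> orth_complement M \<Longrightarrow> y = 0"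
  shows "closure M = UNIV"
  using total_iff_orth[of UNIV M] assms by (metis complex_vector.span_eq_iff closed_UNIV
      complex_vector.subspace_UNIV subset_UNIV)

subsection \<open>Bounded operators and their adjoints\<close>

lemma bounded_clinear_bounded_linear: "bounded_clinear f \<Longrightarrow> bounded_linear f"
  by (simp add: bounded_clinear_def)

lemma bounded_clinear_add: "bounded_clinear f \<Longrightarrow> f (x + y) = f x + f y"
  by (simp add: bounded_clinear_def clinear_on_def)

lemma bounded_clinear_scaleC: "bounded_clinear f \<Longrightarrow> f (c *\<^sub>C x) = c *\<^sub>C f x"
  by (simp add: bounded_clinear_def clinear_on_def)

lemma bounded_clinear_zero: "bounded_clinear f \<Longrightarrow> f 0 = 0"
  using bounded_clinear_scaleC[of f 0 0] by simp

lemma bounded_clinearI: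
  assumes "\<And>x y. f (x + y) = f x + f y" "\<And>c x. f (c *\<^sub>C x) = c *\<^sub>C f x" "\<And>x. norm (f x) \<le> C * norm x"
  shows "bounded_clinear f"
  unfolding bounded_clinear_def clinear_on_def
  using assms
  by (auto intro!: bounded_linear_intro[where K = C] simp: scaleR_scaleC mult.commute)

lemma bounded_clinear_sum:
  assumes "\<And>i. i \<in> I \<Longrightarrow> bounded_clinear (f i)"
  shows "bounded_clinear (\<lambda>x. \<Sum>i\<in>I. f i x)"
proof -
  have "bounded_linear (\<lambda>x. \<Sum>i\<in>I. f i x)"
    using assms by (intro bounded_linear_sum bounded_clinear_bounded_linear)
  moreover have "(\<Sum>i\<in>I. f i (x + y)) = (\<Sum>i\<in>I. f i x) + (\<Sum>i\<in>I. f i y)"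
    "(\<Sum>i\<in>I. f i (c *\<^sub>C x)) = c *\<^sub>C (\<Sum>i\<in>I. f i x)" for c x y
    using assms by (simp_all add: sum.distrib complex_vector.scale_sum_right
        bounded_clinear_add bounded_clinear_scaleC)
  ultimately show ?thesis
    unfolding bounded_clinear_def clinear_on_def by blast
qed

lemma bounded_clinear_compose:
  assumes "bounded_clinear f" "bounded_clinear g"
  shows "bounded_clinear (\<lambda>x. f (g x))"
  using assms bounded_linear_compose[of f g] by (auto simp: bounded_clinear_def clinear_on_def)

lemma bounded_clinear_eq_on_total:
  assumes f: "bounded_clinear f" and g: "bounded_clinear g"
    and total: "closure (complex_vector.span M) = UNIV" and eq: "\<And>x. x \<in> M \<Longrightarrow> f x = g x"
  shows "f = g"
proof -
  have "closed {x. f x = g x}"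
    using f g by (intro closed_Collect_eq linear_continuous_on bounded_clinear_bounded_linear)
  moreover have "complex_vector.subspace {x. f x = g x}"
    using bounded_clinear_add[OF f] bounded_clinear_scaleC[OF f] bounded_clinear_add[OF g]
      bounded_clinear_scaleC[OF g] bounded_clinear_zero[OF f] bounded_clinear_zero[OF g]
    by (auto simp: complex_vector.subspace_def)
  ultimately have "closure (complex_vector.span M) \<subseteq> {x. f x = g x}"
    using eq by (intro closure_minimal complex_vector.span_minimal) auto
  then show ?thesis using total by auto
qed

text \<open>The kernel of \<open>f\<close> has codimension at most one, so a vector \<open>p\<close>
  orthogonal to it, suitably scaled, represents \<open>f\<close>.\<close>

theorem Riesz_representation:
  fixes f :: "'a::complex_hilbert \<Rightarrow> complex"
  assumes f: "bounded_clinear f"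
  obtains u where "\<And>x. f x = cinner u x"
proof -
  define M where "M = {x. f x = 0}"
  note lin = bounded_clinear_add[OF f] bounded_clinear_scaleC[OF f]
  have f0: "f 0 = 0" using lin(2)[of 0 0] by (simp add: scaleC_complex_def)
  have M: "complex_vector.subspace M"
    by (auto simp: M_def complex_vector.subspace_def lin f0 scaleC_complex_def)
  have cl: "closed M" unfolding M_def
    by (intro closed_Collect_eq continuous_on_const
        linear_continuous_on[OF bounded_clinear_bounded_linear[OF f]])
  show ?thesis
  proof (cases "M = UNIV")
    case True
    then show ?thesis using that[of 0] by (auto simp: M_def)
  next
    case False
    then obtain z where z: "f z \<noteq> 0" by (auto simp: M_def)
    obtain m p where mp: "m \<in> M" "p \<in> orth_complement M" "z = m + p"
      using orthogonal_decomposition[OF M cl] .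
    have fp: "f p \<noteq> 0" using z mp by (simp add: lin M_def)
    then have p0: "p \<noteq> 0" using f0 by auto
    have "f x = cinner ((cnj (f p) / complex_of_real ((norm p)\<^sup>2)) *\<^sub>C p) x" for x
    proof -
      have "f (x - (f x / f p) *\<^sub>C p) = f x + f ((- (f x / f p)) *\<^sub>C p)"
        using lin(1)[of x "(- (f x / f p)) *\<^sub>C p"] by simp
      also have "\<dots> = 0" using fp by (simp only: lin scaleC_complex_def) simp
      finally have "cinner (x - (f x / f p) *\<^sub>C p) p = 0"
        using mp by (simp add: M_def orth_complement_def)
      then have "cinner p (x - (f x / f p) *\<^sub>C p) = 0" by (simp add: cinner_eq_zero_commute)
      then have "cinner p x = f x / f p * complex_of_real ((norm p)\<^sup>2)"
        by (simp add: cinner_diff_right cinner_scaleC_right cinner_self)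
      then show ?thesis using fp p0 by (simp add: cinner_scaleC_left)
    qed
    then show ?thesis using that by blast
  qed
qed

text \<open>Riesz gives \<open>N y\<close> pointwise; linearity follows from uniqueness, and the
  bound from testing the defining identity at \<open>x = N y\<close>.\<close>

theorem bounded_adjoint:
  fixes T :: "'a::complex_hilbert \<Rightarrow> 'b::complex_hilbert"
  assumes T: "bounded_clinear T"
  obtains N where "bounded_clinear N" "\<And>x y. cinner y (T x) = cinner (N y) x"
proof -
  obtain C where C0: "C \<ge> 0" and C: "\<And>x. norm (T x) \<le> norm x * C"
    using bounded_linear.nonneg_bounded[OF bounded_clinear_bounded_linear[OF T]] by blast
  have "\<exists>u. \<forall>x. cinner y (T x) = cinner u x" for y
  proof -
    have "bounded_clinear (\<lambda>x. cinner y (T x))"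
    proof (rule bounded_clinearI[where C = "norm y * C"])
      fix x
      show "norm (cinner y (T x)) \<le> norm y * C * norm x"
        using Cauchy_Schwarz_cinner[of y "T x"] mult_left_mono[OF C[of x], of "norm y"]
        by (simp add: mult_ac)
    qed (simp_all add: bounded_clinear_add[OF T] bounded_clinear_scaleC[OF T] cinner_add_right
        cinner_scaleC_right scaleC_complex_def)
    then show ?thesis by (metis Riesz_representation)
  qed
  then obtain N where N: "\<And>x y. cinner y (T x) = cinner (N y) x" by metis
  have eqI: "u = v" if "\<And>x. cinner u x = cinner v x" for u v :: 'a
    using that[of "u - v"] by (metis cinner_diff_left cinner_eq_zero_iff diff_self eq_iff_diff_eq_0)
  have "bounded_clinear N"
  proof (rule bounded_clinearI[where C = C])
    show "N (x + y) = N x + N y" for x y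
      by (rule eqI) (simp add: cinner_add_left flip: N)
    show "N (c *\<^sub>C x) = c *\<^sub>C N x" for c x
      by (rule eqI) (simp add: cinner_scaleC_left flip: N)
    show "norm (N y) \<le> C * norm y" for y
    proof (cases "N y = 0")
      case True
      then show ?thesis using C0 by simp
    next
      case False
      have "(norm (N y))\<^sup>2 = cmod (cinner (N y) (N y))" by (simp add: cinner_self norm_power)
      also have "\<dots> = cmod (cinner y (T (N y)))" by (simp add: N)
      also have "\<dots> \<le> norm y * (norm (N y) * C)"
        using Cauchy_Schwarz_cinner mult_left_mono[OF C[of "N y"], of "norm y"]
        by (metis norm_ge_zero order_trans)
      finally have "norm (N y) * norm (N y) \<le> norm (N y) * (C * norm y)"
        by (simp add: power2_eq_square mult_ac)
      then show ?thesis using False by simp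
    qed
  qed
  then show ?thesis using that N by blast
qed

text \<open>The norm bound passes to the closure of the graph, makes it single-valued, and with
  completeness makes its domain everything. Starting from a graph makes well-definedness on a span
  part of the norm estimate.\<close>

lemma bounded_graph_extension:
  fixes R :: "('a::complex_normed_vector \<times> 'b::{complex_normed_vector, complete_space}) set"
  assumes R: "complex_vector.subspace R" and dense: "closure (Domain R) = UNIV"
    and bd: "\<And>x y. (x, y) \<in> R \<Longrightarrow> norm y \<le> C * norm x"
  obtains T where "bounded_clinear T" "\<And>x y. (x, y) \<in> R \<Longrightarrow> T x = y"
proof -
  let ?G = "closure R"
  have G: "complex_vector.subspace ?G" by (rule closure_csubspace[OF R])
  have "closed {p :: 'a \<times> 'b. norm (snd p) \<le> C * norm (fst p)}"
    by (intro closed_Collect_le continuous_intros)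
  then have "?G \<subseteq> {p. norm (snd p) \<le> C * norm (fst p)}"
    using bd by (intro closure_minimal) auto
  then have bdG: "norm y \<le> C * norm x" if "(x, y) \<in> ?G" for x y using that by auto
  have unique: "y = y'" if "(x, y) \<in> ?G" "(x, y') \<in> ?G" for x y y'
    using bdG[of 0 "y - y'"] complex_vector.subspace_diff[OF G that] by simp
  have "\<exists>y. (x, y) \<in> ?G" for x
  proof -
    have "x \<in> closure (Domain R)" using dense by simp
    then obtain f where f: "\<And>n. f n \<in> Domain R" "f \<longlonglongrightarrow> x" by (auto simp: closure_sequential)
    then obtain g where g: "\<And>n. (f n, g n) \<in> R" by (simp add: Domain_iff) metis
    have "Cauchy g"
    proof (rule metric_CauchyI)
      fix e :: real assume e: "e > 0"
      have "Cauchy f" using f(2) LIMSEQ_imp_Cauchy by blast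
      \<comment> \<open>\<open>\<bar>C\<bar> + 1\<close> replaces \<open>C\<close> so that the
        divisor is positive whatever the value of \<open>C\<close>.\<close>
      then obtain N where N: "\<And>m n. m \<ge> N \<Longrightarrow> n \<ge> N \<Longrightarrow> norm (f m - f n) < e / (\<bar>C\<bar> + 1)"
        using e metric_CauchyD[of f "e / (\<bar>C\<bar> + 1)"] by (auto simp: dist_norm)
      have "dist (g m) (g n) < e" if "m \<ge> N" "n \<ge> N" for m n
      proof -
        have "norm (g m - g n) \<le> C * norm (f m - f n)"
          using bd complex_vector.subspace_diff[OF R g g] by simp
        also have "\<dots> \<le> (\<bar>C\<bar> + 1) * norm (f m - f n)" by (intro mult_right_mono) auto
        also have "\<dots> < e" using N[OF that] by (simp add: pos_less_divide_eq mult.commute)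
        finally show ?thesis by (simp add: dist_norm)
      qed
      then show "\<exists>N. \<forall>m\<ge>N. \<forall>n\<ge>N. dist (g m) (g n) < e" by blast
    qed
    then obtain y where "g \<longlonglongrightarrow> y" using convergent_eq_Cauchy by blast
    then have "(\<lambda>n. (f n, g n)) \<longlonglongrightarrow> (x, y)" by (intro tendsto_Pair f)
    then have "(x, y) \<in> ?G" using g unfolding closure_sequential
      by (intro exI[of _ "\<lambda>n. (f n, g n)"]) simp
    then show ?thesis ..
  qed
  then obtain T where T: "\<And>x. (x, T x) \<in> ?G" by metis
  have eq: "T x = y" if "(x, y) \<in> ?G" for x y using T unique that by blast
  show ?thesis
  proof (rule that)
    show "bounded_clinear T"
    proof (rule bounded_clinearI[where C = C])
      show "T (x + y) = T x + T y" for x y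
        using complex_vector.subspace_add[OF G T T, of x y] eq by simp
      show "T (c *\<^sub>C x) = c *\<^sub>C T x" for c x
        using complex_vector.subspace_scale[OF G T, of c x] eq by (simp add: scaleC_prod_def)
      show "norm (T x) \<le> C * norm x" for x using bdG T by blast
    qed
    show "T x = y" if "(x, y) \<in> R" for x y
      using eq that closure_subset by blast
  qed
qed

subsection \<open>Operators on Hilbert space tensor products\<close>

lemma csubspace_Domain:
  assumes R: "complex_vector.subspace R"
  shows "complex_vector.subspace (Domain R)"
  unfolding complex_vector.subspace_def
proof (intro conjI ballI allI)
  show "0 \<in> Domain R"
    using complex_vector.subspace_0[OF R] by (auto simp: zero_prod_def)
  fix x c assume "x \<in> Domain R"
  then obtain x' where x: "(x, x') \<in> R" by auto
  show "c *\<^sub>C x \<in> Domain R"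
    using complex_vector.subspace_scale[OF R x, of c] by (auto simp: scaleC_prod_def)
  fix y assume "y \<in> Domain R"
  then obtain y' where y: "(y, y') \<in> R" by auto
  show "x + y \<in> Domain R"
    using complex_vector.subspace_add[OF R x y] by auto
qed

definition orthonormal :: "'a::complex_hilbert set \<Rightarrow> bool" where
  "orthonormal E \<longleftrightarrow> (\<forall>e\<in>E. \<forall>f\<in>E. cinner e f = (if e = f then 1 else 0))"

lemma orthonormal_expansion:
  assumes E: "orthonormal E" "finite E" and v: "v \<in> complex_vector.span E"
  shows "v = (\<Sum>e\<in>E. cinner e v *\<^sub>C e)"
proof -
  obtain u where u: "v = (\<Sum>e\<in>E. u e *\<^sub>C e)"
    using v by (auto simp: complex_vector.span_finite[OF E(2)])
  have "cinner e v = u e" if "e \<in> E" for e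
  proof -
    have "cinner e v = (\<Sum>f\<in>E. if e = f then u f else 0)"
      unfolding u cinner_sum_right using E(1) that
      by (intro sum.cong) (auto simp: cinner_scaleC_right orthonormal_def)
    then show ?thesis using E(2) that by simp
  qed
  then show ?thesis using u by simp
qed

lemma Gram_Schmidt:
  assumes "finite F"
  obtains E :: "'a::complex_hilbert set" where "finite E" "orthonormal E" "F \<subseteq> complex_vector.span E"
proof -
  have "\<exists>E::'a set. finite E \<and> orthonormal E \<and> F \<subseteq> complex_vector.span E"
    using assms
  proof (induction F rule: finite_induct)
    case empty
    show ?case by (rule exI[of _ "{}"]) (simp add: orthonormal_def)
  next
    case (insert v F)
    then obtain E :: "'a set" where E: "finite E" "orthonormal E" "F \<subseteq> complex_vector.span E" by blast
    let ?m = "\<Sum>e\<in>E. cinner e v *\<^sub>C e"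
    define p where "p = v - ?m"
    have m: "?m \<in> complex_vector.span E"
      by (intro complex_vector.span_sum complex_vector.span_scale complex_vector.span_base)
    show ?case
    proof (cases "p = 0")
      case True
      then show ?thesis using E m by (auto simp: p_def)
    next
      case False
      define n where "n = complex_of_real (inverse (norm p)) *\<^sub>C p"
      have orth: "cinner e p = 0" if "e \<in> E" for e
      proof -
        have "cinner e ?m = (\<Sum>f\<in>E. if e = f then cinner e v else 0)"
          unfolding cinner_sum_right using E(2) that
          by (intro sum.cong) (auto simp: cinner_scaleC_right orthonormal_def)
        then show ?thesis using E(1) that by (simp add: p_def cinner_diff_right)
      qed
      have orth': "cinner p e = 0" if "e \<in> E" for e
        using orth[OF that] cinner_eq_zero_commute by blast
      have "norm n = 1"
        using False by (simp add: n_def norm_scaleC norm_inverse)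
      then have "cinner n n = 1" by (simp add: cinner_self)
      moreover have n: "cinner e n = 0" "cinner n e = 0" if "e \<in> E" for e
        using orth[OF that] orth'[OF that]
        by (simp_all add: n_def cinner_scaleC_left cinner_scaleC_right)
      ultimately have "n \<notin> E" by fastforce
      then have "orthonormal (insert n E)"
        using E(2) n \<open>cinner n n = 1\<close> by (auto simp: orthonormal_def)
      moreover have "insert v F \<subseteq> complex_vector.span (insert n E)"
      proof -
        have sub: "complex_vector.span E \<subseteq> complex_vector.span (insert n E)"
          by (intro complex_vector.span_mono) auto
        have "p = complex_of_real (norm p) *\<^sub>C n"
          using False by (simp add: n_def scaleC_scaleC scaleC_one flip: of_real_mult)
        moreover have "complex_of_real (norm p) *\<^sub>C n \<in> complex_vector.span (insert n E)"
          by (intro complex_vector.span_scale complex_vector.span_base) simp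
        ultimately have "p \<in> complex_vector.span (insert n E)" by metis
        then have "p + ?m \<in> complex_vector.span (insert n E)"
          using m sub by (blast intro: complex_vector.span_add)
        then show ?thesis using E(3) sub by (auto simp: p_def)
      qed
      ultimately show ?thesis using E(1) by blast
    qed
  qed
  then show ?thesis using that by blast
qed

context
  fixes tens :: "'k::complex_hilbert \<Rightarrow> 'h::complex_hilbert \<Rightarrow> 't::complex_hilbert"
  assumes tens: "hilbert_tensor tens"
begin

lemma htens_linear:
  "tens (x + y) v = tens x v + tens y v" "tens x (v + w) = tens x v + tens x w"
  "tens (c *\<^sub>C x) v = c *\<^sub>C tens x v" "tens x (c *\<^sub>C v) = c *\<^sub>C tens x v"
  using tens by (auto simp: hilbert_tensor_def cbilinear_def clinear_on_def)

lemma cinner_htens: "cinner (tens x v) (tens y w) = cinner x y * cinner v w"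
  using tens by (auto simp: hilbert_tensor_def)

lemma htens_zero: "tens 0 v = 0" "tens x 0 = 0"
  using htens_linear(3)[of 0 0 v] htens_linear(4)[of x 0 0] by simp_all

lemma htens_sum:
  "tens (\<Sum>i\<in>I. f i) v = (\<Sum>i\<in>I. tens (f i) v)" "tens x (\<Sum>i\<in>I. g i) = (\<Sum>i\<in>I. tens x (g i))"
  by (induction I rule: infinite_finite_induct; simp add: htens_linear htens_zero)+

lemma norm_htens: "norm (tens x v) = norm x * norm v"
proof -
  have "complex_of_real ((norm (tens x v))\<^sup>2) = complex_of_real ((norm x * norm v)\<^sup>2)"
    by (metis cinner_htens cinner_self of_real_mult power_mult_distrib)
  then have "(norm (tens x v))\<^sup>2 = (norm x * norm v)\<^sup>2" by (simp only: of_real_eq_iff)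
  then show ?thesis by (simp add: power2_eq_iff_nonneg)
qed

lemma bounded_clinear_htens_left: "bounded_clinear (\<lambda>x. tens x v)"
  by (rule bounded_clinearI[where C = "norm v"]) (simp_all add: htens_linear norm_htens)

lemma htens_total: "closure (complex_vector.span {tens x v | x v. True}) = UNIV"
  using tens by (auto simp: hilbert_tensor_def)

text \<open>By this exchange, results about operators on the left factor also serve for the right
  factor.\<close>

lemma hilbert_tensor_flip: "hilbert_tensor (\<lambda>v x. tens x v)"
proof -
  have "{tens x v |v x. True} = {tens x v | x v. True}" by blast
  then show ?thesis using tens
    by (auto simp: hilbert_tensor_def cbilinear_def mult.commute)
qed

text \<open>Once the right factors of a finite sum are made orthonormal, the norms of the sum and of
  its image are sums of squares, so the bound of \<open>S\<close> carries over unchanged.\<close>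

lemma htens_operator_left:
  assumes S: "bounded_clinear S"
  obtains T where "bounded_clinear T" "\<And>x v. T (tens x v) = tens (S x) v"
proof -
  obtain C where C0: "C \<ge> 0" and C: "\<And>x. norm (S x) \<le> norm x * C"
    using bounded_linear.nonneg_bounded[OF bounded_clinear_bounded_linear[OF S]] by blast
  define G where "G = {(tens x v, tens (S x) v) | x v. True}"
  \<comment> \<open>Terms with the same right factor are collected, so that the finite set
    \<open>F\<close> of right factors itself indexes the sum.\<close>
  have rep: "\<exists>F f. finite F \<and> p = (\<Sum>v\<in>F. (tens (f v) v, tens (S (f v)) v))"
    if p: "p \<in> complex_vector.span G" for p
    using p
  proof (induction rule: complex_vector.span_induct_alt)
    case base
    show ?case by (intro exI[of _ "{}"]) simp
  next
    case (step c g p)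
    then obtain F f x v where F: "finite F" "p = (\<Sum>v\<in>F. (tens (f v) v, tens (S (f v)) v))"
      and g: "g = (tens x v, tens (S x) v)" by (auto simp: G_def)
    \<comment> \<open>The two summands default to 0 outside \<open>F\<close> and off
      \<open>v\<close>, which covers both the case of a new \<open>v\<close> and that of a
      \<open>v\<close> already in \<open>F\<close>.\<close>
    define f' where "f' = (\<lambda>w. (if w \<in> F then f w else 0) + (if w = v then c *\<^sub>C x else 0))"
    let ?t = "\<lambda>x w. (tens x w, tens (S x) w)"
    have t_add: "?t (x + y) w = ?t x w + ?t y w" for x y w
      by (simp add: htens_linear bounded_clinear_add[OF S])
    have t0: "?t 0 w = 0" for w
      by (simp add: htens_zero bounded_clinear_zero[OF S] zero_prod_def)
    have "(\<Sum>w\<in>insert v F. ?t (f' w) w) =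
        (\<Sum>w\<in>insert v F. ?t (if w \<in> F then f w else 0) w) + (\<Sum>w\<in>insert v F. ?t (if w = v then c *\<^sub>C x else 0) w)"
      unfolding f'_def t_add by (rule sum.distrib)
    also have "(\<Sum>w\<in>insert v F. ?t (if w \<in> F then f w else 0) w) = (\<Sum>w\<in>F. ?t (f w) w)"
      using F(1) by (intro sum.mono_neutral_cong_right) (auto simp: t0)
    also have "(\<Sum>w\<in>insert v F. ?t (if w = v then c *\<^sub>C x else 0) w) = (\<Sum>w\<in>{v}. ?t (c *\<^sub>C x) w)"
      using F(1) by (intro sum.mono_neutral_cong_right) (auto simp: t0)
    also have "(\<Sum>w\<in>{v}. ?t (c *\<^sub>C x) w) = c *\<^sub>C g"
      by (simp add: g scaleC_prod_def htens_linear bounded_clinear_scaleC[OF S])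
    finally have "c *\<^sub>C g + p = (\<Sum>w\<in>insert v F. ?t (f' w) w)"
      using F(2) by (simp add: add.commute)
    then show ?case using F(1) by (intro exI[of _ "insert v F"] exI[of _ f']) simp
  qed
  have "norm q \<le> C * norm p" if pqG: "(p, q) \<in> complex_vector.span G" for p q
  proof -
    obtain F f where F: "finite F" and pq: "(p, q) = (\<Sum>v\<in>F. (tens (f v) v, tens (S (f v)) v))"
      using rep[OF pqG] by blast
    have p: "p = (\<Sum>v\<in>F. tens (f v) v)" and q: "q = (\<Sum>v\<in>F. tens (S (f v)) v)"
      using arg_cong[OF pq, of fst] arg_cong[OF pq, of snd] by (simp_all add: fst_sum snd_sum)
    obtain E where E: "finite E" "orthonormal E" "F \<subseteq> complex_vector.span E"
      using Gram_Schmidt[OF F] .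
    define g where "g e = (\<Sum>v\<in>F. cinner e v *\<^sub>C f v)" for e
    \<comment> \<open>Change of right factors from \<open>F\<close> to the orthonormal
      \<open>E\<close>. Taking \<open>k\<close> to be \<open>S\<close> and the identity rewrites
      \<open>q\<close> and \<open>p\<close> with the same coefficients \<open>g\<close>.\<close>
    have lin: "(\<Sum>v\<in>F. tens (k (f v)) v) = (\<Sum>e\<in>E. tens (k (g e)) e)"
      if k: "bounded_clinear k" for k :: "'k \<Rightarrow> 'k"
    proof -
      have kg: "k (g e) = (\<Sum>v\<in>F. cinner e v *\<^sub>C k (f v))" for e
        unfolding g_def using k
        by (induction F rule: infinite_finite_induct)
          (simp_all add: bounded_clinear_zero bounded_clinear_add bounded_clinear_scaleC)
      have "(\<Sum>v\<in>F. tens (k (f v)) v) = (\<Sum>v\<in>F. \<Sum>e\<in>E. cinner e v *\<^sub>C tens (k (f v)) e)"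
      proof (rule sum.cong)
        fix v assume "v \<in> F"
        then have "v = (\<Sum>e\<in>E. cinner e v *\<^sub>C e)" using orthonormal_expansion E by blast
        then have "tens (k (f v)) v = tens (k (f v)) (\<Sum>e\<in>E. cinner e v *\<^sub>C e)" by simp
        then show "tens (k (f v)) v = (\<Sum>e\<in>E. cinner e v *\<^sub>C tens (k (f v)) e)"
          by (simp add: htens_sum htens_linear)
      qed simp
      also have "\<dots> = (\<Sum>e\<in>E. \<Sum>v\<in>F. cinner e v *\<^sub>C tens (k (f v)) e)" by (rule sum.swap)
      finally show ?thesis by (simp add: kg htens_sum htens_linear)
    qed
    have norm_eq: "(norm (\<Sum>e\<in>E. tens (k e) e))\<^sup>2 = (\<Sum>e\<in>E. (norm (k e))\<^sup>2)" for k
    proof -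
      have "norm e = 1" if "e \<in> E" for e
      proof -
        have "complex_of_real ((norm e)\<^sup>2) = 1"
          using E(2) that cinner_self[of e] by (simp only: orthonormal_def if_True simp_thms)
        then have "(norm e)\<^sup>2 = 1" using of_real_eq_1_iff by blast
        then show ?thesis using norm_ge_zero[of e] by (auto simp: power2_eq_1_iff simp del: norm_ge_zero)
      qed
      then have "norm (tens (k e) e) = norm (k e)" if "e \<in> E" for e
        using that by (simp add: norm_htens)
      moreover have "cinner (tens (k e) e) (tens (k f) f) = 0" if "e \<in> E" "f \<in> E" "e \<noteq> f" for e f
        using that E(2) by (simp add: cinner_htens orthonormal_def)
      ultimately show ?thesis
        using E(1) norm_sum_orthogonal[of E "\<lambda>e. tens (k e) e"] by simp
    qed
    have id: "bounded_clinear (\<lambda>x::'k. x)" by (rule bounded_clinearI[where C = 1]) simp_all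
    have "(norm q)\<^sup>2 = (\<Sum>e\<in>E. (norm (S (g e)))\<^sup>2)" by (simp only: q norm_eq lin[OF S])
    also have "\<dots> \<le> (\<Sum>e\<in>E. (norm (g e) * C)\<^sup>2)" by (intro sum_mono power_mono C) auto
    also have "\<dots> = C\<^sup>2 * (\<Sum>e\<in>E. (norm (g e))\<^sup>2)"
      by (simp add: power_mult_distrib sum_distrib_left mult.commute)
    also have "(\<Sum>e\<in>E. (norm (g e))\<^sup>2) = (norm p)\<^sup>2"
      by (simp only: p norm_eq lin[OF id])
    finally have "(norm q)\<^sup>2 \<le> (C * norm p)\<^sup>2" by (simp add: power_mult_distrib)
    then show ?thesis using C0 by (intro power2_le_imp_le[of "norm q"]) auto
  qed
  then have bd: "\<And>p q. (p, q) \<in> complex_vector.span G \<Longrightarrow> norm q \<le> C * norm p" .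
  have dense: "closure (Domain (complex_vector.span G)) = UNIV"
  proof -
    have "complex_vector.span {tens x v | x v. True} \<subseteq> Domain (complex_vector.span G)"
    proof (rule complex_vector.span_minimal)
      show "{tens x v | x v. True} \<subseteq> Domain (complex_vector.span G)"
      proof clarify
        fix x v
        have "(tens x v, tens (S x) v) \<in> complex_vector.span G"
          by (rule complex_vector.span_base) (auto simp: G_def)
        then show "tens x v \<in> Domain (complex_vector.span G)" by (rule DomainI)
      qed
    qed (intro csubspace_Domain complex_vector.subspace_span)
    from closure_mono[OF this] show ?thesis unfolding htens_total by auto
  qed
  show ?thesis
  proof (rule bounded_graph_extension[OF complex_vector.subspace_span dense bd])
    fix T assume T: "bounded_clinear T" "\<And>x y. (x, y) \<in> complex_vector.span G \<Longrightarrow> T x = y"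
    show ?thesis
    proof (rule that[OF T(1)])
      show "T (tens x v) = tens (S x) v" for x v
        by (intro T(2) complex_vector.span_base) (auto simp: G_def)
    qed
  qed
qed

end

lemma htens_operator:
  fixes tens :: "'k::complex_hilbert \<Rightarrow> 'h::complex_hilbert \<Rightarrow> 't::complex_hilbert"
  assumes tens: "hilbert_tensor tens" and S: "bounded_clinear S" and R: "bounded_clinear R"
  obtains T where "bounded_clinear T" "\<And>x v. T (tens x v) = tens (S x) (R v)"
proof -
  obtain T1 where T1: "bounded_clinear T1" "\<And>x v. T1 (tens x v) = tens (S x) v"
    by (rule htens_operator_left[OF tens S]) metis
  obtain T2 where T2: "bounded_clinear T2" "\<And>x v. T2 (tens x v) = tens x (R v)"
    by (rule htens_operator_left[OF hilbert_tensor_flip[OF tens] R]) metis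
  show ?thesis
    by (rule that[of "\<lambda>z. T1 (T2 z)"]) (simp_all add: T1 T2 bounded_clinear_compose)
qed

subsection \<open>Symmetric operators with a total set of eigenvectors\<close>

text \<open>Density of the domain is not demanded, because the part of \<open>D\<close> in
  \<open>K\<close> need not be densely defined in the ambient space.\<close>

definition symmetric_op :: "('x::complex_hilbert \<times> 'x) set \<Rightarrow> bool" where
  "symmetric_op T \<longleftrightarrow> (\<forall>(x, y)\<in>T. \<forall>(x', y')\<in>T. cinner y x' = cinner x y')"

definition eigspace :: "('x::complex_vector \<times> 'x) set \<Rightarrow> complex \<Rightarrow> 'x set" where
  "eigspace T \<mu> = {x. (x, \<mu> *\<^sub>C x) \<in> T}"

lemma symmetric_opD:
  assumes "symmetric_op T" "(x, y) \<in> T" "(x', y') \<in> T"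
  shows "cinner y x' = cinner x y'"
  using bspec[OF bspec[OF assms(1)[unfolded symmetric_op_def] assms(2), simplified] assms(3)] by simp

text \<open>For one fixed pair the condition on the other pair is closed, so the closure is taken in
  one argument at a time.\<close>

lemma symmetric_op_closure:
  assumes T: "symmetric_op T"
  shows "symmetric_op (closure T)"
proof -
  have closed: "closed {q. cinner y (fst q) = cinner x (snd q)}" for x y :: 'a
    by (intro closed_Collect_eq continuous_intros)
  have half: "cinner y x' = cinner x y'" if "(x, y) \<in> T" "(x', y') \<in> closure T" for x y x' y'
  proof -
    have "T \<subseteq> {q. cinner y (fst q) = cinner x (snd q)}"
      using symmetric_opD[OF T that(1)] by auto
    then have "closure T \<subseteq> {q. cinner y (fst q) = cinner x (snd q)}"
      using closed by (intro closure_minimal)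
    then have "(x', y') \<in> {q. cinner y (fst q) = cinner x (snd q)}" using that(2) by (rule subsetD)
    then show ?thesis by simp
  qed
  have "cinner y x' = cinner x y'" if "(x, y) \<in> closure T" "(x', y') \<in> closure T" for x y x' y'
  proof -
    have "T \<subseteq> {q. cinner y (fst q) = cinner x (snd q)}"
    proof
      fix q assume "q \<in> T"
      then have "cnj (cinner (snd q) x) = cnj (cinner (fst q) y)"
        using half[of "fst q" "snd q" x y] that(1) by simp
      then show "q \<in> {q. cinner y (fst q) = cinner x (snd q)}"
        by (simp flip: cinner_cnj)
    qed
    then have "closure T \<subseteq> {q. cinner y (fst q) = cinner x (snd q)}"
      using closed by (intro closure_minimal)
    then have "(x', y') \<in> {q. cinner y (fst q) = cinner x (snd q)}" using that(2) by (rule subsetD)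
    then show ?thesis by simp
  qed
  then show ?thesis unfolding symmetric_op_def by blast
qed

lemma csubspace_eigspace:
  assumes "complex_vector.subspace T"
  shows "complex_vector.subspace (eigspace T \<mu>)"
  unfolding complex_vector.subspace_def
proof (intro conjI ballI allI)
  show "0 \<in> eigspace T \<mu>"
    using complex_vector.subspace_0[OF assms] by (simp add: eigspace_def zero_prod_def)
  fix x c assume x: "x \<in> eigspace T \<mu>"
  then show "c *\<^sub>C x \<in> eigspace T \<mu>"
    using complex_vector.subspace_scale[OF assms, of "(x, \<mu> *\<^sub>C x)" c]
    by (simp add: eigspace_def scaleC_prod_def scaleC_scaleC mult.commute)
  fix y assume "y \<in> eigspace T \<mu>"
  then show "x + y \<in> eigspace T \<mu>"
    using x complex_vector.subspace_add[OF assms, of "(x, \<mu> *\<^sub>C x)" "(y, \<mu> *\<^sub>C y)"]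
    by (simp add: eigspace_def scaleC_add_right)
qed

text \<open>\<open>\<beta>\<close> is left complex so that this also applies to a hypothetical
  eigenvector for an arbitrary spectral parameter.\<close>

lemma eigspaces_orthogonal:
  assumes T: "symmetric_op T" and x: "x \<in> eigspace T (of_real \<alpha>)" and y: "y \<in> eigspace T \<beta>"
    and ne: "of_real \<alpha> \<noteq> \<beta>"
  shows "cinner x y = 0"
proof -
  have "cinner (of_real \<alpha> *\<^sub>C x) y = cinner x (\<beta> *\<^sub>C y)"
    using symmetric_opD[OF T] x y by (auto simp: eigspace_def)
  then show ?thesis using ne by (simp add: cinner_scaleC_left cinner_scaleC_right)
qed

text \<open>Having one vector per eigenvalue makes the summands pairwise orthogonal when
  \<open>T\<close> is symmetric, as the resolvent estimate requires.\<close>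

lemma span_eigspaces_expansion:
  assumes T: "complex_vector.subspace T"
    and x: "x \<in> complex_vector.span (\<Union>\<alpha>\<in>\<Sigma>. eigspace T (of_real \<alpha>))"
  obtains F f where "finite F" "F \<subseteq> \<Sigma>" "\<And>\<alpha>. \<alpha> \<in> F \<Longrightarrow> f \<alpha> \<in> eigspace T (of_real \<alpha>)" "x = (\<Sum>\<alpha>\<in>F. f \<alpha>)"
proof -
  have "\<exists>F f. finite F \<and> F \<subseteq> \<Sigma> \<and> (\<forall>\<alpha>\<in>F. f \<alpha> \<in> eigspace T (of_real \<alpha>)) \<and> x = (\<Sum>\<alpha>\<in>F. f \<alpha>)"
    using x
  proof (induction rule: complex_vector.span_induct_alt)
    case base
    show ?case by (intro exI[of _ "{}"]) simp
  next
    case (step c g p)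
    then obtain F f \<alpha> where F: "finite F" "F \<subseteq> \<Sigma>" "\<forall>\<alpha>\<in>F. f \<alpha> \<in> eigspace T (of_real \<alpha>)" "p = (\<Sum>\<alpha>\<in>F. f \<alpha>)"
      and \<alpha>: "\<alpha> \<in> \<Sigma>" "g \<in> eigspace T (of_real \<alpha>)" by auto
    define f1 where "f1 = (\<lambda>\<beta>. if \<beta> \<in> F then f \<beta> else 0)"
    define f2 where "f2 = (\<lambda>\<beta>. if \<beta> = \<alpha> then c *\<^sub>C g else 0)"
    have "f1 \<beta> + f2 \<beta> \<in> eigspace T (of_real \<beta>)" for \<beta>
      using F(3) \<alpha>(2) csubspace_eigspace[OF T, of "of_real \<beta>"]
      by (auto simp: f1_def f2_def intro: complex_vector.subspace_add complex_vector.subspace_scale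
          complex_vector.subspace_0)
    moreover have "(\<Sum>\<beta>\<in>insert \<alpha> F. f1 \<beta>) = p"
      unfolding F(4) using F(1) by (intro sum.mono_neutral_cong_right) (auto simp: f1_def)
    moreover have "(\<Sum>\<beta>\<in>insert \<alpha> F. f2 \<beta>) = (\<Sum>\<beta>\<in>{\<alpha>}. c *\<^sub>C g)"
      using F(1) by (intro sum.mono_neutral_cong_right) (auto simp: f2_def)
    ultimately show ?case
      using F(1,2) \<alpha>(1)
      by (intro exI[of _ "insert \<alpha> F"] exI[of _ "\<lambda>\<beta>. f1 \<beta> + f2 \<beta>"]) (simp add: sum.distrib add.commute)
  qed
  then show ?thesis using that by metis
qed

text \<open>Injectivity turns an arbitrary choice of bounded solutions into the inverse of
  \<open>T\<close> minus \<mu>; no linearity of the choice has to be shown.\<close>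

lemma resolvent_set_onI:
  assumes T: "complex_vector.subspace T" "T \<subseteq> K \<times> K" and K: "complex_vector.subspace K"
    and inj: "\<And>x. (x, \<mu> *\<^sub>C x) \<in> T \<Longrightarrow> x = 0"
    and surj: "\<And>z. z \<in> K \<Longrightarrow> \<exists>x. (x, z + \<mu> *\<^sub>C x) \<in> T \<and> norm x \<le> C * norm z"
  shows "\<mu> \<in> resolvent_set_on K T"
proof -
  obtain R where R: "\<And>z. z \<in> K \<Longrightarrow> (R z, z + \<mu> *\<^sub>C R z) \<in> T" "\<And>z. z \<in> K \<Longrightarrow> norm (R z) \<le> C * norm z"
    using surj by metis
  have "{(y - \<mu> *\<^sub>C x, x) | x y. (x, y) \<in> T} = {(z, R z) | z. z \<in> K}"
  proof (intro equalityI subsetI)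
    fix q assume "q \<in> {(y - \<mu> *\<^sub>C x, x) | x y. (x, y) \<in> T}"
    then obtain x y where q: "q = (y - \<mu> *\<^sub>C x, x)" and xy: "(x, y) \<in> T" by blast
    define z where "z = y - \<mu> *\<^sub>C x"
    have z: "z \<in> K"
      using xy T(2) K unfolding z_def
      by (intro complex_vector.subspace_diff complex_vector.subspace_scale) auto
    have "(x - R z, y - (z + \<mu> *\<^sub>C R z)) \<in> T"
      using complex_vector.subspace_diff[OF T(1) xy R(1)[OF z]] by simp
    moreover have "y - (z + \<mu> *\<^sub>C R z) = \<mu> *\<^sub>C (x - R z)"
      by (simp add: z_def complex_vector.scale_right_diff_distrib)
    ultimately have "(x - R z, \<mu> *\<^sub>C (x - R z)) \<in> T" by metis
    then have "x - R z = 0" by (rule inj)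
    then have "x = R z" by simp
    then have "q = (z, R z)" unfolding z_def using q by simp
    then show "q \<in> {(z, R z) | z. z \<in> K}" using z by fast
  next
    fix q assume "q \<in> {(z, R z) | z. z \<in> K}"
    then obtain z where z: "q = (z, R z)" "z \<in> K" by fast
    have "q = (z + \<mu> *\<^sub>C R z - \<mu> *\<^sub>C R z, R z)" using z by simp
    then show "q \<in> {(y - \<mu> *\<^sub>C x, x) | x y. (x, y) \<in> T}" using R(1)[OF z(2)] by fast
  qed
  then show ?thesis unfolding resolvent_set_on_def mem_Collect_eq
    by (intro exI[of _ R] exI[of _ C] conjI ballI R(2))
qed

lemma resolvent_set_on_lower_bound:
  assumes "\<mu> \<in> resolvent_set_on K T"
  obtains C where "\<And>x y. (x, y) \<in> T \<Longrightarrow> norm x \<le> C * norm (y - \<mu> *\<^sub>C x)"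
proof -
  obtain R C where R: "{(y - \<mu> *\<^sub>C x, x) | x y. (x, y) \<in> T} = {(z, R z) | z. z \<in> K}"
    and C: "\<forall>z\<in>K. norm (R z) \<le> C * norm z"
    using assms unfolding resolvent_set_on_def by blast
  have "norm x \<le> C * norm (y - \<mu> *\<^sub>C x)" if "(x, y) \<in> T" for x y
  proof -
    have "(y - \<mu> *\<^sub>C x, x) \<in> {(z, R z) | z. z \<in> K}" unfolding R[symmetric] using that by fast
    then show ?thesis using C by auto
  qed
  then show ?thesis by (rule that)
qed

text \<open>On a finite sum of eigenvectors the equation is solved termwise by dividing by \<alpha>
  - \<mu>; orthogonality bounds the solution by the factor 1/r. Totality and closedness of
  \<open>T\<close> extend this to all of \<open>K\<close>.\<close>

theorem resolvent_set_on_total_eigspaces: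
  fixes T :: "('x::complex_hilbert \<times> 'x) set" and \<Sigma> :: "real set"
  assumes T: "complex_vector.subspace T" "closed T" "T \<subseteq> K \<times> K" "symmetric_op T"
    and K: "complex_vector.subspace K"
    and total: "K \<subseteq> closure (complex_vector.span (\<Union>\<alpha>\<in>\<Sigma>. eigspace T (of_real \<alpha>)))"
    and r: "r > 0" "\<And>\<alpha>. \<alpha> \<in> \<Sigma> \<Longrightarrow> r \<le> cmod (of_real \<alpha> - \<mu>)"
  shows "\<mu> \<in> resolvent_set_on K T"
proof -
  let ?E = "\<Union>\<alpha>\<in>\<Sigma>. eigspace T (of_real \<alpha>)"
  \<comment> \<open>An eigenvector for \<mu> is orthogonal to all the given eigenspaces, which are
    total in \<open>K\<close>, hence to itself.\<close>
  have inj: "x = 0" if x: "(x, \<mu> *\<^sub>C x) \<in> T" for x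
  proof -
    have "x \<in> orth_complement ?E"
      unfolding orth_complement_def
    proof clarify
      fix e \<alpha> assume e: "\<alpha> \<in> \<Sigma>" "e \<in> eigspace T (of_real \<alpha>)"
      then have "of_real \<alpha> \<noteq> \<mu>" using r by fastforce
      then show "cinner e x = 0"
        using eigspaces_orthogonal[OF T(4) e(2)] x by (auto simp: eigspace_def)
    qed
    then have "x \<in> orth_complement (closure (complex_vector.span ?E))"
      by (simp add: orth_complement_closure_span)
    moreover have "x \<in> closure (complex_vector.span ?E)" using x T(3) total by auto
    ultimately have "cinner x x = 0" unfolding orth_complement_def by blast
    then show ?thesis by simp
  qed
  have span: "\<exists>y. (y, x + \<mu> *\<^sub>C y) \<in> T \<and> norm y \<le> inverse r * norm x"
    if x: "x \<in> complex_vector.span ?E" for x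
  proof -
    obtain F f where F: "finite F" "F \<subseteq> \<Sigma>" "\<And>\<alpha>. \<alpha> \<in> F \<Longrightarrow> f \<alpha> \<in> eigspace T (of_real \<alpha>)"
      and xF: "x = (\<Sum>\<alpha>\<in>F. f \<alpha>)"
      using span_eigspaces_expansion[OF T(1) x] by metis
    define g where "g \<alpha> = inverse (of_real \<alpha> - \<mu>) *\<^sub>C f \<alpha>" for \<alpha>
    define y where "y = (\<Sum>\<alpha>\<in>F. g \<alpha>)"
    have ne: "of_real \<alpha> - \<mu> \<noteq> 0" if "\<alpha> \<in> F" for \<alpha> using r F(2) that by fastforce
    have g: "g \<alpha> \<in> eigspace T (of_real \<alpha>)" if "\<alpha> \<in> F" for \<alpha>
      using F(3)[OF that] csubspace_eigspace[OF T(1)] complex_vector.subspace_scale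
      unfolding g_def by blast
    have "(\<Sum>\<alpha>\<in>F. (g \<alpha>, of_real \<alpha> *\<^sub>C g \<alpha>)) \<in> T"
      using g by (intro complex_vector.subspace_sum[OF T(1)]) (auto simp: eigspace_def)
    moreover have "of_real \<alpha> *\<^sub>C g \<alpha> = f \<alpha> + \<mu> *\<^sub>C g \<alpha>" if "\<alpha> \<in> F" for \<alpha>
    proof -
      have "(of_real \<alpha> - \<mu>) *\<^sub>C g \<alpha> = f \<alpha>"
        using ne[OF that] by (simp add: g_def scaleC_scaleC scaleC_one)
      then show ?thesis
        by (simp add: complex_vector.scale_left_diff_distrib algebra_simps)
    qed
    then have "(\<Sum>\<alpha>\<in>F. (g \<alpha>, of_real \<alpha> *\<^sub>C g \<alpha>)) = (\<Sum>\<alpha>\<in>F. (g \<alpha>, f \<alpha> + \<mu> *\<^sub>C g \<alpha>))"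
      by (intro sum.cong) auto
    moreover have "(\<Sum>\<alpha>\<in>F. (g \<alpha>, f \<alpha> + \<mu> *\<^sub>C g \<alpha>)) = (y, x + \<mu> *\<^sub>C y)"
      by (simp add: prod_eq_iff fst_sum snd_sum y_def xF sum.distrib complex_vector.scale_sum_right)
    ultimately have "(y, x + \<mu> *\<^sub>C y) \<in> T" by simp
    moreover have "norm y \<le> inverse r * norm x"
    proof -
      have orth: "cinner (f' \<alpha>) (f' \<beta>) = 0"
        if "\<And>\<alpha>. \<alpha> \<in> F \<Longrightarrow> f' \<alpha> \<in> eigspace T (of_real \<alpha>)" "\<alpha> \<in> F" "\<beta> \<in> F" "\<alpha> \<noteq> \<beta>" for f' \<alpha> \<beta>
        using eigspaces_orthogonal[OF T(4), of "f' \<alpha>" \<alpha> "f' \<beta>" "of_real \<beta>"] that by simp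
      have "(norm y)\<^sup>2 = (\<Sum>\<alpha>\<in>F. (norm (g \<alpha>))\<^sup>2)"
        unfolding y_def using F(1) g by (intro norm_sum_orthogonal) (auto intro: orth)
      also have "\<dots> \<le> (\<Sum>\<alpha>\<in>F. (inverse r * norm (f \<alpha>))\<^sup>2)"
      proof (intro sum_mono power_mono)
        fix \<alpha> assume "\<alpha> \<in> F"
        then have "inverse (cmod (of_real \<alpha> - \<mu>)) \<le> inverse r"
          using r F(2) by (intro le_imp_inverse_le) auto
        then show "norm (g \<alpha>) \<le> inverse r * norm (f \<alpha>)"
          unfolding g_def norm_scaleC norm_inverse by (rule mult_right_mono) simp
      qed simp
      also have "\<dots> = (inverse r)\<^sup>2 * (\<Sum>\<alpha>\<in>F. (norm (f \<alpha>))\<^sup>2)"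
        by (simp add: power_mult_distrib sum_distrib_left)
      also have "(\<Sum>\<alpha>\<in>F. (norm (f \<alpha>))\<^sup>2) = (norm x)\<^sup>2"
        unfolding xF using F(1,3) by (intro norm_sum_orthogonal[symmetric]) (auto intro: orth)
      finally have "(norm y)\<^sup>2 \<le> (inverse r * norm x)\<^sup>2" by (simp add: power_mult_distrib)
      then show ?thesis using r(1) by (intro power2_le_imp_le[of "norm y"]) auto
    qed
    ultimately show ?thesis by blast
  qed
  have surj: "\<exists>x. (x, z + \<mu> *\<^sub>C x) \<in> T \<and> norm x \<le> inverse r * norm z" if "z \<in> K" for z
  proof -
    have "z \<in> closure (complex_vector.span ?E)" using that total by blast
    then obtain s where s: "\<And>n. s n \<in> complex_vector.span ?E" "s \<longlonglongrightarrow> z"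
      by (auto simp: closure_sequential)
    obtain y where y: "\<And>n. (y n, s n + \<mu> *\<^sub>C y n) \<in> T" "\<And>n. norm (y n) \<le> inverse r * norm (s n)"
      using span[OF s(1)] by metis
    \<comment> \<open>The \<open>y n\<close> were merely chosen, so their difference has no bound of
      its own; \<open>inj\<close> identifies it with the bounded solution \<open>u\<close> for
      \<open>s m - s n\<close>.\<close>
    have diff: "norm (y m - y n) \<le> inverse r * norm (s m - s n)" for m n
    proof -
      obtain u where u: "(u, s m - s n + \<mu> *\<^sub>C u) \<in> T" "norm u \<le> inverse r * norm (s m - s n)"
        using span[OF complex_vector.span_diff[OF s(1) s(1)]] by blast
      have "(y m - y n - u, \<mu> *\<^sub>C (y m - y n - u)) \<in> T"
        using complex_vector.subspace_diff[OF T(1) complex_vector.subspace_diff[OF T(1) y(1) y(1)] u(1), of m n]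
        by (simp add: complex_vector.scale_right_diff_distrib algebra_simps)
      then have "y m - y n - u = 0" by (rule inj)
      then have "y m - y n = u" by simp
      then show ?thesis using u by simp
    qed
    have "Cauchy y"
    proof (rule metric_CauchyI)
      fix e :: real assume e: "e > 0"
      have "Cauchy s" using s(2) LIMSEQ_imp_Cauchy by blast
      then obtain N where N: "\<And>m n. m \<ge> N \<Longrightarrow> n \<ge> N \<Longrightarrow> dist (s m) (s n) < r * e"
        using e r metric_CauchyD[of s "r * e"] by auto
      have "dist (y m) (y n) < e" if "m \<ge> N" "n \<ge> N" for m n
      proof -
        have "inverse r * norm (s m - s n) < inverse r * (r * e)"
          using N[OF that] r(1) by (intro mult_strict_left_mono) (auto simp: dist_norm)
        also have "inverse r * (r * e) = e" using r(1) by simp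
        finally show ?thesis using diff[of m n] by (simp add: dist_norm)
      qed
      then show "\<exists>N. \<forall>m\<ge>N. \<forall>n\<ge>N. dist (y m) (y n) < e" by blast
    qed
    then obtain x where x: "y \<longlonglongrightarrow> x" using convergent_eq_Cauchy by blast
    have "(\<lambda>n. (y n, s n + \<mu> *\<^sub>C y n)) \<longlonglongrightarrow> (x, z + \<mu> *\<^sub>C x)"
      by (intro tendsto_intros x s)
    then have "(x, z + \<mu> *\<^sub>C x) \<in> T"
      using T(2) y(1) by (rule_tac closed_sequentially)
    moreover have "norm x \<le> inverse r * norm z"
      by (rule LIMSEQ_le[OF tendsto_norm[OF x] tendsto_mult_left[OF tendsto_norm[OF s(2)]]])
        (use y(2) in blast)
    ultimately show ?thesis by blast
  qed
  show ?thesis by (rule resolvent_set_onI[OF T(1,3) K inj surj])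
qed

text \<open>The image of a basis of \<open>U\<close> is independent inside the span of
  \<open>B\<close>, hence finite. This later carries finite multiplicity from \<open>H\<close> to
  \<open>D\<close>.\<close>

lemma finite_dim_injective:
  fixes f :: "'x::complex_vector \<Rightarrow> 'y::complex_vector"
  assumes U: "complex_vector.subspace U" and f: "clinear_on UNIV f"
    and inj: "\<And>x. x \<in> U \<Longrightarrow> f x = 0 \<Longrightarrow> x = 0"
    and B: "finite B" "f ` U \<subseteq> complex_vector.span B"
  shows "\<exists>B'. finite B' \<and> U = complex_vector.span B'"
proof -
  interpret vp: vector_space_pair "scaleC :: complex \<Rightarrow> 'x \<Rightarrow> 'x" "scaleC :: complex \<Rightarrow> 'y \<Rightarrow> 'y"
    by unfold_locales
  have lin: "Vector_Spaces.linear scaleC scaleC f"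
    using f by unfold_locales (auto simp: clinear_on_def)
  obtain B' where B': "B' \<subseteq> U" "complex_vector.independent B'" "U \<subseteq> complex_vector.span B'"
    by (rule complex_vector.basis_exists[of U])
  have span: "complex_vector.span B' = U"
    using B' U by (intro equalityI complex_vector.span_minimal)
  have inj_on: "inj_on f (complex_vector.span B')"
    unfolding span
  proof (rule inj_onI)
    fix x y assume "x \<in> U" "y \<in> U" "f x = f y"
    then have "f (x - y) = 0" "x - y \<in> U"
      using vp.linear_diff[OF lin] complex_vector.subspace_diff[OF U] by auto
    then show "x = y" using inj[of "x - y"] by simp
  qed
  have "complex_vector.independent (f ` B')"
    by (rule vp.linear_independent_injective_image[OF lin B'(2) inj_on])
  then have "finite (f ` B')"
    using complex_vector.independent_span_bound[OF B(1)] B(2) B'(1) by blast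
  then have "finite B'"
    by (rule finite_imageD[OF _ inj_on_subset[OF inj_on complex_vector.span_superset]])
  then show ?thesis using span by blast
qed

subsection \<open>Adjoints of closed operators\<close>

lemma op_adjoint_iff:
  "(y, z) \<in> op_adjoint T \<longleftrightarrow> (\<forall>x w. (x, w) \<in> T \<longrightarrow> cinner y w = cinner z x)"
  by (auto simp: op_adjoint_def)

lemma op_adjointD:
  "(y, z) \<in> op_adjoint T \<Longrightarrow> (x, w) \<in> T \<Longrightarrow> cinner y w = cinner z x"
  by (simp add: op_adjoint_iff)

text \<open>Up to a rotation by a right angle the graph of the adjoint is the orthogonal complement
  of the graph, which reduces facts about adjoints to facts about closed subspaces.\<close>

lemma op_adjoint_orth:
  "(y, z) \<in> op_adjoint T \<longleftrightarrow> (- z, y) \<in> orth_complement T"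
proof -
  have "cinner y w = cinner z x \<longleftrightarrow> cinner (x, w) (- z, y) = 0" for x w
  proof -
    have "cinner (x, w) (- z, y) = cnj (cinner y w - cinner z x)"
      using cinner_cnj[of w y] cinner_cnj[of x z] by (simp add: cinner_prod_def cinner_minus_right)
    then show ?thesis by simp
  qed
  then show ?thesis by (auto simp: op_adjoint_iff orth_complement_def)
qed

lemma csubspace_op_adjoint: "complex_vector.subspace (op_adjoint T)"
  unfolding complex_vector.subspace_def
proof (intro conjI ballI allI)
  show "0 \<in> op_adjoint T" by (simp add: zero_prod_def op_adjoint_iff)
  fix p c assume p: "p \<in> op_adjoint T"
  then show "c *\<^sub>C p \<in> op_adjoint T"
    by (cases p) (simp add: scaleC_prod_def op_adjoint_iff cinner_scaleC_left)
  fix q assume "q \<in> op_adjoint T"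
  with p show "p + q \<in> op_adjoint T"
    by (cases p; cases q) (simp add: op_adjoint_iff cinner_add_left)
qed

lemma op_adjoint_closure:
  assumes "complex_vector.subspace T"
  shows "op_adjoint (closure T) = op_adjoint T"
proof -
  have "orth_complement (closure T) = orth_complement T"
    using orth_complement_closure_span[of T] assms complex_vector.span_eq_iff by metis
  then have "p \<in> op_adjoint (closure T) \<longleftrightarrow> p \<in> op_adjoint T" for p
    by (cases p) (simp add: op_adjoint_orth)
  then show ?thesis by blast
qed

lemma closed_op_adjoint: "closed (op_adjoint T)"
proof -
  have "op_adjoint T = (\<lambda>q. (- snd q, fst q)) -` orth_complement T"
    using op_adjoint_orth[of _ _ T] by auto
  moreover have "closed ((\<lambda>q. (- snd q, fst q)) -` orth_complement T)"
    by (intro closed_vimage closed_orth_complement continuous_intros)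
  ultimately show ?thesis by simp
qed

text \<open>The component of a point of the double adjoint that is orthogonal to \<open>T\<close> is
  a rotated point of the adjoint, hence orthogonal to the given point as well, and so it
  vanishes.\<close>

lemma op_adjoint_adjoint:
  assumes T: "complex_vector.subspace T" "closed T"
  shows "op_adjoint (op_adjoint T) = T"
proof (intro equalityI subrelI)
  fix x w assume xw: "(x, w) \<in> op_adjoint (op_adjoint T)"
  obtain m p where mp: "m \<in> T" "p \<in> orth_complement T" "(x, w) = m + p"
    using orthogonal_decomposition[OF T] by metis
  obtain a b where p: "p = (a, b)" by (cases p)
  have "(b, - a) \<in> op_adjoint T" using mp(2) by (simp add: op_adjoint_orth p)
  then have "cinner x (- a) = cinner w b" using xw by (simp add: op_adjoint_iff)
  then have "cinner x a + cinner w b = 0"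
    by (metis add.right_inverse cinner_minus_right)
  then have 1: "cinner (x, w) p = 0" by (simp add: p cinner_prod_def)
  have 2: "cinner m p = 0" using mp by (simp add: orth_complement_def)
  have "cinner p p = 0" using 1 2 mp(3) by (simp add: cinner_add_left)
  then have "p = 0" by simp
  then show "(x, w) \<in> T" using mp by simp
next
  fix x w assume xw: "(x, w) \<in> T"
  show "(x, w) \<in> op_adjoint (op_adjoint T)"
    unfolding op_adjoint_iff[of _ _ "op_adjoint T"]
  proof (intro allI impI)
    fix y z assume "(y, z) \<in> op_adjoint T"
    then have "cinner y w = cinner z x" using xw by (rule op_adjointD)
    then have "cnj (cinner y w) = cnj (cinner z x)" by simp
    then show "cinner x z = cinner w y" by (simp flip: cinner_cnj)
  qed
qed

text \<open>Taking the adjoint of the off-diagonal matrix exchanges its entries and replaces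
  \<open>d\<close> by its double adjoint, which is \<open>d\<close> again because \<open>d\<close>
  is closed.\<close>

lemma self_adjoint_dirac_op:
  fixes d :: "('l::complex_hilbert \<times> 't::complex_hilbert) set"
  assumes d: "complex_vector.subspace d" "closed d" "single_valued d" "closure (Domain d) = UNIV"
  shows "self_adjoint (dirac_op d)"
proof -
  let ?d' = "op_adjoint d"
  have d'0: "z = 0" if "(0, z) \<in> ?d'" for z
  proof (rule dense_orth_zero[OF d(4)])
    fix x assume "x \<in> Domain d"
    then show "cinner x z = 0"
      using that by (auto simp: op_adjoint_iff cinner_eq_zero_commute[of x])
  qed
  have d0: "v = 0" if "(0, v) \<in> d" for v
    using that d(3) complex_vector.subspace_0[OF d(1)]
    by (auto simp: single_valued_def zero_prod_def)
  \<comment> \<open>A \<open>v\<close> orthogonal to the domain of the adjoint puts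
    \<open>(0, v)\<close> into the double adjoint, that is into \<open>d\<close>, and
    \<open>d\<close> is single-valued.\<close>
  have dense': "closure (Domain ?d') = UNIV"
  proof (rule dense_if_orth_zero[OF csubspace_Domain[OF csubspace_op_adjoint]])
    fix v assume v: "v \<in> orth_complement (Domain ?d')"
    have "(0, v) \<in> op_adjoint ?d'"
      using v by (auto simp: op_adjoint_iff orth_complement_def Domain_iff cinner_eq_zero_commute[of v])
    then show "v = 0" using d0 op_adjoint_adjoint[OF d(1,2)] by simp
  qed
  have "Domain (dirac_op d) = Domain ?d' \<times> Domain d"
    by (auto simp: dirac_op_def)
  then have "closure (Domain (dirac_op d)) = UNIV"
    using dense' d(4) by (simp add: closure_Times)
  moreover have "single_valued (dirac_op d)"
  proof -
    have "single_valued ?d'"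
    proof (rule single_valuedI)
      fix x y z assume "(x, y) \<in> ?d'" "(x, z) \<in> ?d'"
      then have "(0, y - z) \<in> ?d'"
        using complex_vector.subspace_diff[OF csubspace_op_adjoint, of "(x, y)" d "(x, z)"] by simp
      from d'0[OF this] show "y = z" by simp
    qed
    then show ?thesis using d(3) by (auto simp: single_valued_def dirac_op_def)
  qed
  moreover have "op_adjoint (dirac_op d) = dirac_op d"
  proof (intro equalityI subsetI)
    fix q assume q: "q \<in> op_adjoint (dirac_op d)"
    obtain v w v' w' where [simp]: "q = ((v, w), (v', w'))" by (metis prod.exhaust)
    have adj: "cinner v a' + cinner w b' = cinner v' a + cinner w' b"
      if "(b, a') \<in> d" "(a, b') \<in> ?d'" for a b a' b'
    proof -
      have "((a, b), (a', b')) \<in> dirac_op d" using that by (simp add: dirac_op_def)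
      from op_adjointD[OF _ this, of "(v, w)" "(v', w')"] show ?thesis
        using q by (simp add: cinner_prod_def)
    qed
    \<comment> \<open>Pairing with elements that vanish in one of the two components separates the
      two adjoint conditions.\<close>
    have 00: "(0, 0) \<in> d" "(0, 0) \<in> ?d'"
      using complex_vector.subspace_0[OF d(1)] complex_vector.subspace_0[OF csubspace_op_adjoint, of d]
      by (simp_all add: zero_prod_def)
    have "(v, w') \<in> ?d'"
      using adj[OF _ 00(2)] by (simp add: op_adjoint_iff)
    moreover have "(w, v') \<in> op_adjoint ?d'"
      using adj[OF 00(1)] by (simp add: op_adjoint_iff[of _ _ ?d'])
    ultimately show "q \<in> dirac_op d"
      using op_adjoint_adjoint[OF d(1,2)] by (simp add: dirac_op_def)
  next
    fix q assume q: "q \<in> dirac_op d"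
    obtain v w v' w' where [simp]: "q = ((v, w), (v', w'))" by (metis prod.exhaust)
    have vw: "(v, w') \<in> ?d'" "(w, v') \<in> op_adjoint ?d'"
      using q op_adjoint_adjoint[OF d(1,2)] by (auto simp: dirac_op_def)
    have "cinner (v, w) y = cinner (v', w') x" if xy: "(x, y) \<in> dirac_op d" for x y
    proof -
      obtain a b a' b' where [simp]: "x = (a, b)" "y = (a', b')" by (metis prod.exhaust)
      have "(b, a') \<in> d" "(a, b') \<in> ?d'" using xy by (auto simp: dirac_op_def)
      then show ?thesis
        using op_adjointD[OF vw(1)] op_adjointD[OF vw(2)] by (simp add: cinner_prod_def)
    qed
    then show "q \<in> op_adjoint (dirac_op d)" by (simp add: op_adjoint_iff)
  qed
  ultimately show ?thesis by (simp add: self_adjoint_def)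
qed

subsection \<open>The Dirac operator of a diagonalisable form\<close>

text \<open>\<open>d0\<close> and \<open>h0\<close> are the graphs of the restrictions of \<open>d\<close> and \<open>H\<^sub>\<phi>\<close> to the core \<open>A \<xi>\<^sub>h\<close>.\<close>

locale diagonal_form =
  fixes d0 :: "('l::complex_hilbert \<times> 't::complex_hilbert) set" and h0 :: "('l \<times> 'l) set"
  assumes sub_d0: "complex_vector.subspace d0" and sub_h0: "complex_vector.subspace h0"
    and dom: "Domain h0 = Domain d0" and dense: "closure (Domain d0) = UNIV"
    and form: "(x, f) \<in> d0 \<Longrightarrow> (y, g) \<in> d0 \<Longrightarrow> (y, k) \<in> h0 \<Longrightarrow> cinner f g = 2 * cinner x k"
    and diagonal: "Domain d0 \<subseteq> complex_vector.span (\<Union>\<beta>. eigspace h0 \<beta>)"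
begin

text \<open>Recorded as nonnegative reals so that \<open>sqrt (2 * \<beta>)\<close> is at hand;
  \<open>eigvals_real\<close> shows that no eigenvalue is lost.\<close>

definition eigvals :: "real set" where
  "eigvals = {\<beta>. \<beta> \<ge> 0 \<and> (\<exists>y. y \<noteq> 0 \<and> y \<in> eigspace h0 (of_real \<beta>))}"

abbreviation "d \<equiv> closure d0"
abbreviation "H \<equiv> closure h0"
abbreviation "D \<equiv> dirac_op d"
abbreviation "K \<equiv> orth_complement (op_kernel D)"

lemma sub_d: "complex_vector.subspace d"
  by (rule closure_csubspace[OF sub_d0])

lemma d_zero: "(0, 0) \<in> d"
  using complex_vector.subspace_0[OF sub_d] by (simp add: zero_prod_def)

lemma form_diag:
  assumes "(y, f) \<in> d0" "y \<in> eigspace h0 \<beta>"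
  shows "of_real ((norm f)\<^sup>2) = 2 * \<beta> * of_real ((norm y)\<^sup>2)"
  using form[OF assms(1) assms(1), of "\<beta> *\<^sub>C y"] assms(2)
  by (simp add: eigspace_def cinner_scaleC_right cinner_self)

lemma eigspace_in_domain: "y \<in> eigspace h0 \<beta> \<Longrightarrow> \<exists>f. (y, f) \<in> d0"
  using dom by (auto simp: eigspace_def)

lemma eigvals_real:
  assumes y: "y \<in> eigspace h0 \<beta>" "y \<noteq> 0"
  obtains \<beta>' where "\<beta> = of_real \<beta>'" "\<beta>' \<in> eigvals"
proof -
  obtain f where f: "(y, f) \<in> d0" using eigspace_in_domain y by blast
  \<comment> \<open>The Rayleigh quotient of \<open>y\<close>, solved from
    \<open>form_diag\<close>.\<close>
  define \<beta>' where "\<beta>' = (norm f)\<^sup>2 / (2 * (norm y)\<^sup>2)"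
  have "\<beta> = of_real \<beta>'"
    using form_diag[OF f y(1)] y(2) by (simp add: \<beta>'_def field_simps)
  moreover have "\<beta>' \<ge> 0" by (simp add: \<beta>'_def)
  ultimately show ?thesis using that y by (auto simp: eigvals_def)
qed

lemma diagonal_real: "Domain d0 \<subseteq> complex_vector.span (\<Union>\<beta>\<in>eigvals. eigspace h0 (of_real \<beta>))"
proof -
  have "(\<Union>\<beta>. eigspace h0 \<beta>) \<subseteq> complex_vector.span (\<Union>\<beta>\<in>eigvals. eigspace h0 (of_real \<beta>))"
  proof clarify
    fix y \<beta> assume y: "y \<in> eigspace h0 \<beta>"
    show "y \<in> complex_vector.span (\<Union>\<beta>\<in>eigvals. eigspace h0 (of_real \<beta>))"
    proof (cases "y = 0")
      case False
      then obtain \<beta>' where "\<beta> = of_real \<beta>'" "\<beta>' \<in> eigvals" using eigvals_real[OF y] by metis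
      then show ?thesis using y by (intro complex_vector.span_base) auto
    qed (simp add: complex_vector.span_zero)
  qed
  then show ?thesis
    using diagonal complex_vector.span_minimal[OF _ complex_vector.subspace_span] by blast
qed

lemma symmetric_h0: "symmetric_op h0"
  unfolding symmetric_op_def
proof clarify
  fix x k y m assume xk: "(x, k) \<in> h0" and ym: "(y, m) \<in> h0"
  then obtain f g where f: "(x, f) \<in> d0" and g: "(y, g) \<in> d0" using dom by blast
  have "2 * cinner x m = cinner f g" using form[OF f g ym] by simp
  also have "\<dots> = cnj (cinner g f)" by (rule cinner_cnj)
  also have "\<dots> = cnj (2 * cinner y k)" using form[OF g f xk] by simp
  also have "\<dots> = 2 * cinner k y" by (simp flip: cinner_cnj)
  finally show "cinner k y = cinner x m" by simp
qed

lemma eigspace_orth_zero: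
  assumes "\<And>\<beta> y. \<beta> \<in> eigvals \<Longrightarrow> y \<in> eigspace h0 (of_real \<beta>) \<Longrightarrow> cinner y w = 0"
  shows "w = 0"
proof (rule dense_orth_zero[OF dense])
  fix x assume "x \<in> Domain d0"
  then have "x \<in> complex_vector.span (\<Union>\<beta>\<in>eigvals. eigspace h0 (of_real \<beta>))"
    using diagonal_real by blast
  moreover have "complex_vector.span (\<Union>\<beta>\<in>eigvals. eigspace h0 (of_real \<beta>)) \<subseteq> orth_complement {w}"
    using assms
    by (intro complex_vector.span_minimal orth_complement_csubspace)
      (auto simp: orth_complement_def cinner_eq_zero_commute[of w])
  ultimately show "cinner x w = 0"
    by (auto simp: orth_complement_def cinner_eq_zero_commute[of x])
qed

text \<open>This is closability. If x_n tends to 0 and f_n to y, the form identity makes y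
  orthogonal to the whole range of \<open>d0\<close>, in particular to every f_n, hence to y
  itself.\<close>

lemma single_valued_d: "single_valued d"
proof (rule single_valuedI)
  have zero: "y = 0" if y: "(0, y) \<in> d" for y
  proof -
    obtain s where s: "\<And>n. s n \<in> d0" "s \<longlonglongrightarrow> (0, y)" using y by (auto simp: closure_sequential)
    define x f where "x n = fst (s n)" and "f n = snd (s n)" for n
    have xf: "(x n, f n) \<in> d0" for n using s(1) by (simp add: x_def f_def)
    have lim: "x \<longlonglongrightarrow> 0" "f \<longlonglongrightarrow> y"
      unfolding x_def f_def using tendsto_fst[OF s(2)] tendsto_snd[OF s(2)] by simp_all
    have orth: "cinner y g = 0" if g: "(b, g) \<in> d0" for b g
    proof -
      obtain k where k: "(b, k) \<in> h0" using g dom by blast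
      have "(\<lambda>n. cinner (f n) g) \<longlonglongrightarrow> cinner y g" by (intro tendsto_intros lim)
      moreover have "(\<lambda>n. 2 * cinner (x n) k) \<longlonglongrightarrow> 2 * cinner 0 k" by (intro tendsto_intros lim)
      moreover have "cinner (f n) g = 2 * cinner (x n) k" for n by (rule form[OF xf g k])
      ultimately have "cinner y g = 2 * cinner 0 k" by (simp only: LIMSEQ_unique)
      then show ?thesis by simp
    qed
    have "(\<lambda>n. cinner y (f n)) \<longlonglongrightarrow> cinner y y" by (intro tendsto_intros lim)
    then have "(\<lambda>n. 0) \<longlonglongrightarrow> cinner y y" using orth[OF xf] by simp
    then show ?thesis by (simp add: LIMSEQ_const_iff)
  qed
  fix x y z assume "(x, y) \<in> d" "(x, z) \<in> d"
  then have "(0, y - z) \<in> d"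
    using complex_vector.subspace_diff[OF sub_d, of "(x, y)" "(x, z)"] by simp
  from zero[OF this] show "y = z" by simp
qed

lemma self_adjoint_D: "self_adjoint D"
proof (rule self_adjoint_dirac_op[OF sub_d closed_closure single_valued_d])
  have "Domain d0 \<subseteq> Domain d" using closure_subset by blast
  from closure_mono[OF this] show "closure (Domain d) = UNIV" unfolding dense by auto
qed

text \<open>This is where the relation between \<open>H\<close> and the adjoint of \<open>d\<close>
  applied after \<open>d\<close> becomes rigorous: on eigenvectors only, tested on
  \<open>d0\<close>, which has the same adjoint as \<open>d\<close>.\<close>

lemma eigspace_adjoint:
  assumes y: "y \<in> eigspace h0 (of_real \<beta>)" and f: "(y, f) \<in> d0"
  shows "(f, of_real (2 * \<beta>) *\<^sub>C y) \<in> op_adjoint d"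
  unfolding op_adjoint_closure[OF sub_d0] op_adjoint_iff
proof (intro allI impI)
  fix x w assume x: "(x, w) \<in> d0"
  have "cinner w f = 2 * cinner x (of_real \<beta> *\<^sub>C y)"
    using form[OF x f] y by (simp add: eigspace_def)
  then have "cnj (cinner w f) = cnj (2 * of_real \<beta> * cinner x y)"
    by (simp add: cinner_scaleC_right)
  then show "cinner f w = cinner (of_real (2 * \<beta>) *\<^sub>C y) x"
    by (simp add: cinner_scaleC_left flip: cinner_cnj)
qed

lemma sub_D: "complex_vector.subspace D"
  using self_adjoint_D csubspace_op_adjoint[of D] by (simp add: self_adjoint_def)

lemma closed_D: "closed D"
  using self_adjoint_D closed_op_adjoint[of D] by (simp add: self_adjoint_def)

lemma symmetric_D: "symmetric_op D"
  unfolding symmetric_op_def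
proof clarify
  fix a b c e a' b' c' e'
  assume 1: "((a, b), (c, e)) \<in> D" and 2: "((a', b'), (c', e')) \<in> D"
  have "((a, b), (c, e)) \<in> op_adjoint D" using 1 self_adjoint_D by (simp add: self_adjoint_def)
  from op_adjointD[OF this 2] show "cinner (c, e) (a', b') = cinner (a, b) (c', e')" by simp
qed

text \<open>By symmetry of \<open>D\<close>, an eigenvector for a nonzero eigenvalue is orthogonal
  to the kernel.\<close>

lemma eigspace_D_in_K:
  assumes x: "x \<in> eigspace D \<mu>" and \<mu>: "\<mu> \<noteq> 0"
  shows "x \<in> eigspace (D \<inter> K \<times> K) \<mu>"
proof -
  have "x \<in> K"
    unfolding orth_complement_def
  proof clarify
    fix k assume "k \<in> op_kernel D"
    then have "cinner 0 x = cinner k (\<mu> *\<^sub>C x)"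
      using x symmetric_opD[OF symmetric_D, of k 0 x "\<mu> *\<^sub>C x"]
      by (simp add: op_kernel_def eigspace_def)
    then show "cinner k x = 0" using \<mu> by (simp add: cinner_scaleC_right)
  qed
  moreover have "\<mu> *\<^sub>C x \<in> K"
    using \<open>x \<in> K\<close> complex_vector.subspace_scale[OF orth_complement_csubspace] by blast
  ultimately show ?thesis using x by (simp add: eigspace_def)
qed

text \<open>Each positive \<beta> contributes both square roots of 2 \<beta>; zero is left out
  because the kernel is orthogonal to \<open>K\<close>.\<close>

definition dirac_eigvals :: "real set" where
  "dirac_eigvals = {s. s \<noteq> 0 \<and> s\<^sup>2 / 2 \<in> eigvals}"

text \<open>The adjoint of \<open>d\<close> sends \<open>f\<close> to s^2 y, so \<open>D\<close>
  sends (f/s, y) to (f, s y), which is s times that vector.\<close>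

lemma dirac_eigvector:
  assumes s: "s \<noteq> 0" and y: "y \<in> eigspace h0 (of_real (s\<^sup>2 / 2))" and f: "(y, f) \<in> d0"
  shows "(of_real (1 / s) *\<^sub>C f, y) \<in> eigspace (D \<inter> K \<times> K) (of_real s)"
proof (rule eigspace_D_in_K)
  have "(y, f) \<in> d" using f closure_subset by blast
  moreover have "of_real (1 / s) *\<^sub>C (f, of_real (2 * (s\<^sup>2 / 2)) *\<^sub>C y) \<in> op_adjoint d"
    by (intro complex_vector.subspace_scale[OF csubspace_op_adjoint] eigspace_adjoint y f)
  then have "(of_real (1 / s) *\<^sub>C f, of_real s *\<^sub>C y) \<in> op_adjoint d"
    using s by (simp add: scaleC_prod_def scaleC_scaleC power2_eq_square)
  ultimately show "(of_real (1 / s) *\<^sub>C f, y) \<in> eigspace D (of_real s)"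
    using s by (simp add: eigspace_def dirac_op_def scaleC_prod_def scaleC_scaleC scaleC_one)
qed (use s in simp)

text \<open>Orthogonality of (v, w) to the eigenvectors for s and for -s separates, by sum and
  difference, into orthogonality of \<open>w\<close> to \<open>y\<close> and of \<open>v\<close> to
  \<open>f\<close>. Then \<open>w\<close> is 0 by density, while (v, 0) lies in the kernel and is
  also orthogonal to it.\<close>

lemma dirac_total:
  "K \<subseteq> closure (complex_vector.span (\<Union>s\<in>dirac_eigvals. eigspace (D \<inter> K \<times> K) (of_real s)))"
proof -
  let ?E = "\<Union>s\<in>dirac_eigvals. eigspace (D \<inter> K \<times> K) (of_real s)"
  have "closure (complex_vector.span ?E) = K"
  proof (rule total_iff_orth[OF orth_complement_csubspace closed_orth_complement])
    show "?E \<subseteq> K" by (auto simp: eigspace_def)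
    fix z assume z: "z \<in> K" "z \<in> orth_complement ?E"
    obtain v w where [simp]: "z = (v, w)" by (cases z)
    have ker: "(x, 0) \<in> D \<Longrightarrow> cinner x z = 0" for x
      using z(1) unfolding orth_complement_def op_kernel_def by blast
    have key: "cinner y w = 0 \<and> cinner f v = 0"
      if \<beta>: "\<beta> \<in> eigvals" and y: "y \<in> eigspace h0 (of_real \<beta>)" and f: "(y, f) \<in> d0" for \<beta> y f
    proof (cases "\<beta> = 0")
      \<comment> \<open>For \<beta> = 0 there is no s, but then \<open>d\<close> kills
        \<open>y\<close>, so (0, y) is in the kernel, to which \<open>z\<close> is
        orthogonal.\<close>
      case True
      then have "f = 0" using form_diag[OF f y] by simp
      then have "(y, 0) \<in> d" using f closure_subset by blast
      moreover have "(0, 0) \<in> op_adjoint d" by (simp add: op_adjoint_iff)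
      ultimately have "((0, y), 0) \<in> D" by (simp add: dirac_op_def zero_prod_def)
      from ker[OF this] show ?thesis using \<open>f = 0\<close> by (simp add: cinner_prod_def)
    next
      case False
      have "\<beta> \<ge> 0" using \<beta> by (simp add: eigvals_def)
      define s where "s = sqrt (2 * \<beta>)"
      have s: "s \<noteq> 0" "s\<^sup>2 / 2 = \<beta>" using \<open>\<beta> \<ge> 0\<close> False by (simp_all add: s_def)
      have orth: "cinner (of_real (1 / t) *\<^sub>C f, y) z = 0" if "t \<noteq> 0" "t\<^sup>2 / 2 = \<beta>" for t :: real
      proof -
        have "(of_real (1 / t) *\<^sub>C f, y) \<in> ?E"
          using dirac_eigvector[OF that(1) _ f] y \<beta> that by (auto simp: dirac_eigvals_def)
        then show ?thesis using z(2) by (simp only: orth_complement_def mem_Collect_eq)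
      qed
      have "cinner f v / of_real s + cinner y w = 0" "- cinner f v / of_real s + cinner y w = 0"
        using orth[of s] orth[of "- s"] s
        by (simp_all add: cinner_prod_def cinner_scaleC_left cinner_minus_left)
      then have "cinner f v / of_real s = 0" "cinner y w = 0"
        by (simp_all add: add_eq_0_iff)
      then show ?thesis using s(1) by simp
    qed
    have "w = 0"
    proof (rule eigspace_orth_zero)
      fix \<beta> y assume "\<beta> \<in> eigvals" "y \<in> eigspace h0 (of_real \<beta>)"
      then show "cinner y w = 0" using key eigspace_in_domain by blast
    qed
    have "v = 0"
    proof -
      \<comment> \<open>\<open>?V\<close> consists of the points that \<open>d\<close> maps into the
        complement of \<open>v\<close>. It is a subspace containing the eigenvectors, hence the
        core, and so the adjoint of \<open>d\<close> kills \<open>v\<close>.\<close>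
      let ?V = "Domain (d \<inter> UNIV \<times> orth_complement {v})"
      have "complex_vector.subspace (UNIV \<times> orth_complement {v} :: ('l \<times> 't) set)"
        using orth_complement_csubspace[of "{v}"]
        by (auto simp: complex_vector.subspace_def zero_prod_def scaleC_prod_def)
      then have "complex_vector.subspace ?V"
        by (intro csubspace_Domain complex_vector.subspace_inter sub_d)
      moreover have "(\<Union>\<beta>\<in>eigvals. eigspace h0 (of_real \<beta>)) \<subseteq> ?V"
      proof clarify
        fix \<beta> y assume y: "\<beta> \<in> eigvals" "y \<in> eigspace h0 (of_real \<beta>)"
        then obtain f where f: "(y, f) \<in> d0" using eigspace_in_domain by blast
        have "cinner v f = 0" using key[OF y f] cinner_eq_zero_commute by blast
        then have "(y, f) \<in> d \<inter> UNIV \<times> orth_complement {v}"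
          using f closure_subset by (auto simp: orth_complement_def)
        then show "y \<in> ?V" by (rule DomainI)
      qed
      ultimately have "complex_vector.span (\<Union>\<beta>\<in>eigvals. eigspace h0 (of_real \<beta>)) \<subseteq> ?V"
        by (rule_tac complex_vector.span_minimal)
      then have V: "Domain d0 \<subseteq> ?V" using diagonal_real by blast
      have "(v, 0) \<in> op_adjoint d"
        unfolding op_adjoint_closure[OF sub_d0] op_adjoint_iff
      proof (intro allI impI)
        fix x f assume f: "(x, f) \<in> d0"
        then obtain f' where f': "(x, f') \<in> d" "cinner v f' = 0"
          using V by (auto simp: orth_complement_def)
        have "(x, f) \<in> d" using f closure_subset by blast
        then have "f = f'" using f'(1) single_valued_d by (auto dest: single_valuedD)
        then show "cinner v f = cinner 0 x" using f' by simp
      qed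
      then have "((v, 0), 0) \<in> D" using d_zero by (simp add: dirac_op_def zero_prod_def)
      from ker[OF this] show ?thesis by (simp add: cinner_prod_def)
    qed
    then show "z = 0" using \<open>w = 0\<close> by (simp add: zero_prod_def)
  qed
  then show ?thesis by simp
qed

lemma sub_DK: "complex_vector.subspace (D \<inter> K \<times> K)"
proof -
  have "complex_vector.subspace (K \<times> K)"
    using orth_complement_csubspace[of "op_kernel D"]
    by (auto simp: complex_vector.subspace_def zero_prod_def scaleC_prod_def)
  then show ?thesis by (intro complex_vector.subspace_inter sub_D)
qed

section \<open>From the spectrum of \<open>H\<close> to the spectrum of \<open>D\<close>\<close>

lemma dirac_resolvent:
  assumes "r > 0" "\<And>s. s \<in> dirac_eigvals \<Longrightarrow> r \<le> cmod (of_real s - \<mu>)"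
  shows "\<mu> \<in> resolvent_set_on K (D \<inter> K \<times> K)"
proof (rule resolvent_set_on_total_eigspaces[OF sub_DK _ _ _ orth_complement_csubspace dirac_total assms])
  show "closed (D \<inter> K \<times> K)"
    by (intro closed_Int closed_Times closed_D closed_orth_complement)
  show "symmetric_op (D \<inter> K \<times> K)"
    using symmetric_D unfolding symmetric_op_def by blast
qed auto

lemma eigvals_lower_bound:
  assumes "\<kappa> \<in> resolvent_set_on UNIV H"
  obtains C where "\<And>\<beta>. \<beta> \<in> eigvals \<Longrightarrow> 1 \<le> C * cmod (of_real \<beta> - \<kappa>)"
proof -
  obtain C where C: "\<And>x y. (x, y) \<in> H \<Longrightarrow> norm x \<le> C * norm (y - \<kappa> *\<^sub>C x)"
    using resolvent_set_on_lower_bound[OF assms] by metis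
  have "1 \<le> C * cmod (of_real \<beta> - \<kappa>)" if \<beta>: "\<beta> \<in> eigvals" for \<beta>
  proof -
    obtain y where y: "y \<noteq> 0" "(y, of_real \<beta> *\<^sub>C y) \<in> h0"
      using \<beta> by (auto simp: eigvals_def eigspace_def)
    then have "(y, of_real \<beta> *\<^sub>C y) \<in> H" using closure_subset by blast
    from C[OF this] have "norm y \<le> C * (cmod (of_real \<beta> - \<kappa>) * norm y)"
      by (simp add: norm_scaleC flip: complex_vector.scale_left_diff_distrib)
    then show ?thesis using y(1) by (simp add: mult.assoc[symmetric] pos_le_divide_eq[symmetric])
  qed
  then show ?thesis by (rule that)
qed

lemma eigvals_in_spectrum:
  assumes "\<beta> \<in> eigvals"
  shows "of_real \<beta> \<in> spectrum_on UNIV H"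
proof (rule ccontr)
  assume "of_real \<beta> \<notin> spectrum_on UNIV H"
  then obtain C where "\<And>\<beta>'. \<beta>' \<in> eigvals \<Longrightarrow> 1 \<le> C * cmod (of_real \<beta>' - complex_of_real \<beta>)"
    using eigvals_lower_bound[of "of_real \<beta>"] by (auto simp: spectrum_on_def)
  from this[OF assms] show False by simp
qed

text \<open>A spectral point \<mu> is a limit of Dirac eigenvalues s_n, so \<mu>^2/2 is a limit of
  eigenvalues of \<open>H\<close> and thus spectral. Being isolated, it equals some s_n^2/2, whence
  \<mu> is s_n or -s_n.\<close>

lemma dirac_spectrum:
  assumes disc: "discrete_spectrum_on UNIV H" and \<mu>: "\<mu> \<in> spectrum_on K (D \<inter> K \<times> K)"
  shows "\<mu>\<^sup>2 / 2 \<in> spectrum_on UNIV H" "\<mu> \<in> of_real ` dirac_eigvals"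
proof -
  \<comment> \<open>Otherwise the Dirac eigenvalues keep a positive distance from \<mu>, and
    \<open>dirac_resolvent\<close> applies.\<close>
  have "\<exists>s\<in>dirac_eigvals. cmod (of_real s - \<mu>) < inverse (real (Suc n))" for n
  proof (rule ccontr)
    assume "\<not> ?thesis"
    then have "\<mu> \<in> resolvent_set_on K (D \<inter> K \<times> K)"
      by (intro dirac_resolvent[of "inverse (real (Suc n))"]) (auto simp: not_less)
    then show False using \<mu> by (simp add: spectrum_on_def)
  qed
  then obtain s where s: "\<And>n. s n \<in> dirac_eigvals"
    "\<And>n. cmod (of_real (s n) - \<mu>) < inverse (real (Suc n))" by metis
  have s_lim: "(\<lambda>n. complex_of_real (s n)) \<longlonglongrightarrow> \<mu>"
    using s(2) by (intro LIMSEQ_norm_0[THEN LIM_zero_cancel])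
      (auto simp: field_simps intro: less_imp_le)
  define \<beta> where "\<beta> n = (s n)\<^sup>2 / 2" for n
  have \<beta>: "\<beta> n \<in> eigvals" for n using s(1) by (simp add: \<beta>_def dirac_eigvals_def)
  have "(\<lambda>n. (complex_of_real (s n))\<^sup>2 / 2) \<longlonglongrightarrow> \<mu>\<^sup>2 / 2" by (intro tendsto_intros s_lim) simp
  then have lim: "(\<lambda>n. complex_of_real (\<beta> n)) \<longlonglongrightarrow> \<mu>\<^sup>2 / 2" by (simp add: \<beta>_def)
  show spec: "\<mu>\<^sup>2 / 2 \<in> spectrum_on UNIV H"
  proof (rule ccontr)
    assume "\<mu>\<^sup>2 / 2 \<notin> spectrum_on UNIV H"
    then obtain C where C: "\<And>\<beta>. \<beta> \<in> eigvals \<Longrightarrow> 1 \<le> C * cmod (of_real \<beta> - \<mu>\<^sup>2 / 2)"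
      using eigvals_lower_bound[of "\<mu>\<^sup>2 / 2"] by (auto simp: spectrum_on_def)
    have "(\<lambda>n. C * cmod (of_real (\<beta> n) - \<mu>\<^sup>2 / 2)) \<longlonglongrightarrow> C * cmod (\<mu>\<^sup>2 / 2 - \<mu>\<^sup>2 / 2)"
      by (intro tendsto_intros lim)
    then have "1 \<le> C * cmod (\<mu>\<^sup>2 / 2 - \<mu>\<^sup>2 / 2)"
      using C[OF \<beta>] by (intro LIMSEQ_le_const) auto
    then show False by simp
  qed
  have "(\<mu>\<^sup>2 / 2) isolated_in spectrum_on UNIV H"
    using disc spec by (simp add: discrete_spectrum_on_def)
  then obtain U where U: "open U" "U \<inter> spectrum_on UNIV H = {\<mu>\<^sup>2 / 2}"
    by (auto simp: isolated_in_def)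
  have "\<forall>\<^sub>F n in sequentially. complex_of_real (\<beta> n) \<in> U"
    using U by (intro topological_tendstoD[OF lim]) auto
  then obtain n where "complex_of_real (\<beta> n) \<in> U"
    using eventually_happens'[OF sequentially_bot] by blast
  then have "complex_of_real (\<beta> n) = \<mu>\<^sup>2 / 2" using eigvals_in_spectrum[OF \<beta>] U(2) by blast
  then have "(complex_of_real (s n))\<^sup>2 = \<mu>\<^sup>2" by (simp add: \<beta>_def)
  then have "\<mu> = of_real (s n) \<or> \<mu> = of_real (- s n)" by (auto simp: power2_eq_iff)
  moreover have "- s n \<in> dirac_eigvals" using s(1)[of n] by (simp add: dirac_eigvals_def)
  ultimately show "\<mu> \<in> of_real ` dirac_eigvals" using s(1) by blast
qed

text \<open>As s \<noteq> 0, the first component of an eigenvector is determined by the second one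
  \<open>w\<close>. That \<open>w\<close> is an eigenvector of the closure \<open>H\<close> cannot
  be read off the core; instead the part \<open>p\<close> of \<open>w\<close> orthogonal to the
  eigenspace of \<open>H\<close> is shown orthogonal to every eigenvector of
  \<open>h0\<close>.\<close>

lemma dirac_eigspace_finite:
  assumes s: "s \<in> dirac_eigvals"
    and B: "finite B" "{x. (x, complex_of_real (s\<^sup>2 / 2) *\<^sub>C x) \<in> H} = complex_vector.span B"
  shows "\<exists>B. finite B \<and> eigspace (D \<inter> K \<times> K) (of_real s) = complex_vector.span B"
proof (rule finite_dim_injective[OF csubspace_eigspace[OF sub_DK]])
  let ?\<kappa> = "complex_of_real (s\<^sup>2 / 2)" and ?U = "eigspace (D \<inter> K \<times> K) (of_real s)"
  show "clinear_on UNIV (snd :: 't \<times> 'l \<Rightarrow> 'l)" by (simp add: clinear_on_def scaleC_prod_def)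
  have s0: "s \<noteq> 0" using s by (simp add: dirac_eigvals_def)
  have U: "(w, of_real s *\<^sub>C v) \<in> d" "(v, of_real s *\<^sub>C w) \<in> op_adjoint d" if "(v, w) \<in> ?U" for v w
    using that by (auto simp: eigspace_def dirac_op_def scaleC_prod_def)
  show "x = 0" if x: "x \<in> ?U" "snd x = 0" for x
  proof -
    obtain v where [simp]: "x = (v, 0)" using x(2) by (cases x) auto
    have "of_real s *\<^sub>C v = 0"
      using U(1)[of v 0] x(1) d_zero single_valued_d by (auto dest: single_valuedD)
    then show ?thesis using s0 by (simp add: zero_prod_def)
  qed
  show "finite B" by (rule B)
  show "snd ` ?U \<subseteq> complex_vector.span B"
  proof clarify
    fix v w assume vw: "(v, w) \<in> ?U"
    let ?F = "eigspace H ?\<kappa>"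
    have subH: "complex_vector.subspace H" by (rule closure_csubspace[OF sub_h0])
    have "closed ((\<lambda>x. (x, ?\<kappa> *\<^sub>C x)) -` H)"
      by (intro closed_vimage closed_closure continuous_intros)
    then have "closed ?F" by (simp add: eigspace_def vimage_def)
    then obtain m p where mp: "m \<in> ?F" "p \<in> orth_complement ?F" "w = m + p"
      using orthogonal_decomposition[OF csubspace_eigspace[OF subH]] by metis
    have h0H: "eigspace h0 \<gamma> \<subseteq> eigspace H \<gamma>" for \<gamma>
      using closure_subset by (auto simp: eigspace_def)
    have "p = 0"
    proof (rule eigspace_orth_zero)
      fix \<beta> y assume \<beta>: "\<beta> \<in> eigvals" and y: "y \<in> eigspace h0 (of_real \<beta>)"
      show "cinner y p = 0"
      proof (cases "\<beta> = s\<^sup>2 / 2")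
        case True
        then have "y \<in> ?F" using y h0H by blast
        then show ?thesis using mp(2) by (simp add: orth_complement_def)
      next
        case False
        obtain f where f: "(y, f) \<in> d0" using eigspace_in_domain y by blast
        \<comment> \<open>Computing the inner product of \<open>f\<close> and \<open>v\<close> from
          each half of the eigenvalue equation gives s^2 \<langle>y, w\<rangle> = 2 \<beta>
          \<langle>y, w\<rangle>, and the two factors differ.\<close>
        have "cinner f (of_real s *\<^sub>C v) = cinner (of_real (2 * \<beta>) *\<^sub>C y) w"
          by (rule op_adjointD[OF eigspace_adjoint[OF y f] U(1)[OF vw]])
        then have 1: "of_real s * cinner f v = 2 * of_real \<beta> * cinner y w"
          by (simp add: cinner_scaleC_left cinner_scaleC_right)
        have "(y, f) \<in> d" using f closure_subset by blast
        then have "cinner v f = cinner (of_real s *\<^sub>C w) y"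
          by (rule op_adjointD[OF U(2)[OF vw]])
        then have "cnj (cinner v f) = cnj (of_real s * cinner w y)"
          by (simp add: cinner_scaleC_left)
        then have "cinner f v = of_real s * cinner y w" by (simp flip: cinner_cnj)
        with 1 have "of_real (s\<^sup>2) * cinner y w = of_real (2 * \<beta>) * cinner y w"
          by (simp add: power2_eq_square mult.assoc)
        moreover have "complex_of_real (s\<^sup>2) \<noteq> of_real (2 * \<beta>)"
          unfolding of_real_eq_iff using False by auto
        ultimately have "cinner y w = 0" by (metis mult_cancel_right)
        moreover have "cinner y m = 0"
          using eigspaces_orthogonal[OF symmetric_op_closure[OF symmetric_h0] _ mp(1)] y h0H False
          by (metis of_real_eq_iff subsetD)
        ultimately show ?thesis using mp(3) by (simp add: cinner_add_right)
      qed
    qed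
    then have "w \<in> {x. (x, ?\<kappa> *\<^sub>C x) \<in> H}" using mp by (simp add: eigspace_def)
    then show "snd (v, w) \<in> complex_vector.span B" unfolding B(2) by simp
  qed
qed

theorem discrete_spectrum_dirac:
  assumes disc: "discrete_spectrum_on UNIV H"
  shows "discrete_spectrum_on K (D \<inter> K \<times> K)"
  unfolding discrete_spectrum_on_def
proof (intro ballI conjI)
  let ?T = "D \<inter> K \<times> K"
  fix \<mu> assume \<mu>: "\<mu> \<in> spectrum_on K ?T"
  note spec = dirac_spectrum[OF disc \<mu>]
  obtain s where s: "s \<in> dirac_eigvals" and \<mu>s: "\<mu> = of_real s" using spec(2) by blast
  then have \<mu>0: "\<mu> \<noteq> 0" by (simp add: dirac_eigvals_def)
  have fin: "\<exists>B. finite B \<and> {x. (x, (\<mu>\<^sup>2 / 2) *\<^sub>C x) \<in> H} = complex_vector.span B"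
    using disc spec(1) by (simp add: discrete_spectrum_on_def)
  then obtain B where B: "finite B" "{x. (x, complex_of_real (s\<^sup>2 / 2) *\<^sub>C x) \<in> H} = complex_vector.span B"
    by (auto simp: \<mu>s)
  show "\<exists>B. finite B \<and> {x. (x, \<mu> *\<^sub>C x) \<in> ?T} = complex_vector.span B"
    using dirac_eigspace_finite[OF s B] unfolding \<mu>s eigspace_def .
  obtain y where y: "y \<noteq> 0" "y \<in> eigspace h0 (of_real (s\<^sup>2 / 2))"
    using s by (auto simp: dirac_eigvals_def eigvals_def)
  obtain f where f: "(y, f) \<in> d0" using eigspace_in_domain y by blast
  have "(of_real (1 / s) *\<^sub>C f, y) \<in> eigspace ?T \<mu>"
    unfolding \<mu>s using s by (intro dirac_eigvector y f) (simp add: dirac_eigvals_def)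
  then show "\<exists>x. x \<noteq> 0 \<and> (x, \<mu> *\<^sub>C x) \<in> ?T"
    using y(1) by (intro exI[of _ "(of_real (1 / s) *\<^sub>C f, y)"]) (simp add: eigspace_def zero_prod_def)
  have "(\<mu>\<^sup>2 / 2) isolated_in spectrum_on UNIV H"
    using disc spec(1) by (simp add: discrete_spectrum_on_def)
  then obtain U where U: "open U" "U \<inter> spectrum_on UNIV H = {\<mu>\<^sup>2 / 2}"
    by (auto simp: isolated_in_def)
  \<comment> \<open>The preimage of \<open>U\<close> still admits -\<mu>, the other solution of
    \<nu>^2 = \<mu>^2; the ball of radius \<bar>\<mu>\<bar> around \<mu> excludes it.\<close>
  define V where "V = (\<lambda>\<nu>. \<nu>\<^sup>2 / 2) -` U \<inter> ball \<mu> (cmod \<mu>)"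
  have "open V"
    unfolding V_def using U(1) by (intro open_Int open_vimage continuous_intros) auto
  moreover have "V \<inter> spectrum_on K ?T = {\<mu>}"
  proof (intro equalityI subsetI)
    fix \<nu> assume \<nu>: "\<nu> \<in> V \<inter> spectrum_on K ?T"
    then have "\<nu>\<^sup>2 / 2 \<in> U \<inter> spectrum_on UNIV H" using dirac_spectrum(1)[OF disc] by (simp add: V_def)
    then have "\<nu>\<^sup>2 / 2 = \<mu>\<^sup>2 / 2" using U(2) by blast
    then have "\<nu> = \<mu> \<or> \<nu> = - \<mu>" by (simp add: power2_eq_iff)
    moreover have "\<nu> \<noteq> - \<mu>"
    proof
      assume "\<nu> = - \<mu>"
      then have "dist \<mu> \<nu> = 2 * cmod \<mu>" by (simp add: dist_norm norm_mult flip: mult_2)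
      then show False using \<nu> \<mu>0 by (simp add: V_def)
    qed
    ultimately show "\<nu> \<in> {\<mu>}" by simp
  next
    fix \<nu> assume "\<nu> \<in> {\<mu>}"
    then show "\<nu> \<in> V \<inter> spectrum_on K ?T" using \<mu> \<mu>0 U(2) by (auto simp: V_def)
  qed
  ultimately show "\<mu> isolated_in spectrum_on K ?T" using \<mu> by (auto simp: isolated_in_def)
qed

end

subsection \<open>Continuity of states\<close>

lemma star_zero [simp]: "star (0::'a::cstar_algebra) = 0"
  using star_scaleC[of 0 "0::'a"] by simp

lemma star_one [simp]: "star (1::'a::cstar_algebra) = 1"
  by (metis mult.right_neutral star_mult star_star)

lemma star_minus: "star (- x) = - star (x::'a::cstar_algebra)"
  using star_scaleC[of "- 1" x] by (simp add: scaleC_minus_one)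

lemma star_diff: "star (x - y) = star x - star (y::'a::cstar_algebra)"
  using star_add[of x "- y"] by (simp add: star_minus)

lemma star_sum: "star (\<Sum>i\<in>I. f i) = (\<Sum>i\<in>I. star (f i :: 'a::cstar_algebra))"
  by (induction I rule: infinite_finite_induct) (simp_all add: star_add)

lemma star_power: "star (x ^ n) = star x ^ n" for x :: "'a::cstar_algebra"
  by (induction n) (simp_all add: star_mult power_commutes)

lemma norm_star: "norm (star x) = norm (x::'a::cstar_algebra)"
proof -
  have le: "norm y \<le> norm (star y)" for y :: 'a
  proof (cases "y = 0")
    case False
    have "norm y * norm y \<le> norm (star y) * norm y"
      using norm_star_mult[of y] norm_mult_ineq[of "star y" y] by (simp add: power2_eq_square)
    then show ?thesis using False by simp
  qed simp
  show ?thesis using le[of x] le[of "star x"] by (simp add: star_star)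
qed

lemma bounded_linear_star: "bounded_linear (star :: 'a::cstar_algebra \<Rightarrow> 'a)"
  by (rule bounded_linear_intro[where K = 1])
    (simp_all add: star_add star_scaleC scaleR_scaleC norm_star)

text \<open>Successive coefficients differ by the factor (1/2 - n)/(n + 1), of modulus at most 1.
  The bound lets a geometric series dominate the binomial series.\<close>

lemma abs_gbinomial_half_le: "\<bar>(1/2::real) gchoose n\<bar> \<le> 1"
proof (induction n)
  case (Suc n)
  have "of_nat (Suc n) * ((1/2::real) gchoose Suc n) = (1/2 - of_nat n) * ((1/2) gchoose n)"
    using gbinomial_mult_1[of "1/2::real" n] by (simp add: algebra_simps)
  then have "real (Suc n) * \<bar>(1/2::real) gchoose Suc n\<bar> = \<bar>1/2 - real n\<bar> * \<bar>(1/2) gchoose n\<bar>"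
    by (metis abs_mult abs_of_nat)
  also have "\<dots> \<le> real (Suc n) * 1"
    using Suc by (intro mult_mono) auto
  finally show ?case by (simp only: mult_le_cancel_left_pos of_nat_0_less_iff zero_less_Suc)
qed simp

text \<open>\<open>b\<close> is the binomial series of the square root of 1 - t; its coefficients
  are real, so it is self-adjoint, and its square is computed by the Cauchy product and
  Vandermonde's identity.\<close>

lemma sqrt_one_minus:
  fixes t :: "'a::cstar_algebra"
  assumes t: "star t = t" and nt: "norm t < 1"
  obtains b where "star b = b" "b * b = 1 - t"
proof -
  define c where "c n = (- 1) ^ n * ((1/2::real) gchoose n)" for n
  define a where "a n = c n *\<^sub>R t ^ n" for n
  have "norm (a n) \<le> norm t ^ n" for n
  proof -
    have "\<bar>c n\<bar> \<le> 1" using abs_gbinomial_half_le[of n] by (simp add: c_def abs_mult power_abs)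
    then have "norm (a n) \<le> 1 * norm (t ^ n)"
      unfolding a_def norm_scaleR by (intro mult_right_mono) auto
    then show ?thesis using norm_power_ineq[of t n] by simp
  qed
  then have sum: "summable (\<lambda>n. norm (a n))"
    using nt by (intro summable_comparison_test'[OF summable_geometric[of "norm t"]]) auto
  define b where "b = (\<Sum>n. a n)"
  have conv: "(\<Sum>i\<le>k. a i * a (k - i)) = (if k = 0 then 1 else if k = 1 then - t else 0)" for k
  proof -
    have "(\<Sum>i\<le>k. a i * a (k - i)) = (\<Sum>i\<le>k. (c i * c (k - i)) *\<^sub>R t ^ k)"
      by (intro sum.cong) (auto simp: a_def simp flip: power_add)
    also have "\<dots> = (\<Sum>i\<le>k. c i * c (k - i)) *\<^sub>R t ^ k" by (simp add: scaleR_sum_left)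
    also have "(\<Sum>i\<le>k. c i * c (k - i)) = (\<Sum>i\<le>k. (- 1) ^ k * (((1/2) gchoose i) * ((1/2) gchoose (k - i))))"
    proof (intro sum.cong refl)
      fix i assume "i \<in> {..k}"
      then have "(- 1::real) ^ i * (- 1) ^ (k - i) = (- 1) ^ k" by (simp flip: power_add)
      then show "c i * c (k - i) = (- 1) ^ k * (((1/2) gchoose i) * ((1/2) gchoose (k - i)))"
        by (simp add: c_def mult_ac)
    qed
    also have "\<dots> = (- 1) ^ k * (1 gchoose k)"
      using gbinomial_Vandermonde[of "1/2::real" "1/2" k]
      by (simp add: sum_distrib_left[symmetric] atLeast0AtMost)
    \<comment> \<open>As an integer binomial coefficient this vanishes from k = 2 on, so only 1 and
      -t survive.\<close>
    also have "(1::real) gchoose k = of_nat (1 choose k)"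
      using binomial_gbinomial[of 1 k, where ?'a = real] by simp
    finally show ?thesis
      by (cases k; cases "k - 1") auto
  qed
  have "(\<lambda>k. if k = 0 then 1 else if k = 1 then - t else 0) sums (b * b)"
    using Cauchy_product_sums[OF sum sum] by (simp add: conv b_def)
  moreover have "(\<lambda>k. if k = 0 then 1 else if k = 1 then - t else 0) sums
      (\<Sum>k\<in>{0, 1::nat}. if k = 0 then 1 else if k = 1 then - t else 0)"
    by (rule sums_finite) auto
  ultimately have "b * b = 1 - t" by (auto dest: sums_unique2)
  moreover have "star b = b"
  proof -
    have "star (a n) = a n" for n
      by (simp add: a_def scaleR_scaleC star_scaleC star_power t)
    then show ?thesis
      using bounded_linear.suminf[OF bounded_linear_star summable_norm_cancel[OF sum]]
      by (simp add: b_def)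
  qed
  ultimately show ?thesis using that by blast
qed

text \<open>When y has norm below 1, 1 - star y y is the square of a self-adjoint element, so
  positivity of \<open>h\<close> bounds h(star y y) by h(1) = 1; the general case follows by
  scaling.\<close>

lemma positive_functional_bound:
  fixes h :: "'a::cstar_algebra \<Rightarrow> complex"
  assumes lin: "clinear_on UNIV h" and one: "h 1 = 1" and pos: "\<And>a. h (star a * a) \<in> \<real>\<^sub>\<ge>\<^sub>0"
  shows "Re (h (star x * x)) \<le> 4 * (norm x)\<^sup>2"
proof (cases "x = 0")
  case True
  then show ?thesis using lin unfolding clinear_on_def
    by (metis (no_types, opaque_lifting) UNIV_I complex_vector.scale_zero_left mult_zero_right norm_zero
        order_refl power_zero_numeral zero_complex.simps(1))
next
  case False
  note add = lin[unfolded clinear_on_def, THEN conjunct1, rule_format, OF UNIV_I UNIV_I]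
  note scale = lin[unfolded clinear_on_def, THEN conjunct2, rule_format, OF UNIV_I]
  \<comment> \<open>Scaling to norm 1/2 keeps strictly inside the radius of convergence; squaring
    the 2 produces the constant 4.\<close>
  define c where "c = inverse (2 * norm x)"
  define y where "y = complex_of_real c *\<^sub>C x"
  have yy: "star y * y = complex_of_real (c\<^sup>2) *\<^sub>C (star x * x)"
    by (simp add: y_def star_scaleC scaleC_mult_left scaleC_mult_right scaleC_scaleC power2_eq_square)
  have ny: "norm y = 1/2" using False by (simp add: y_def c_def norm_scaleC norm_mult norm_inverse)
  have "norm (star y * y) < 1" unfolding norm_star_mult ny by (simp add: power2_eq_square)
  moreover have "star (star y * y) = star y * y" by (simp add: star_mult star_star)
  ultimately obtain b where b: "star b = b" "b * b = 1 - star y * y"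
    using sqrt_one_minus by metis
  have "h 1 = h (1 - star y * y) + h (star y * y)" using add[of "1 - star y * y" "star y * y"] by simp
  moreover have "Re (h (1 - star y * y)) \<ge> 0"
    using pos[of b] b by (auto simp: complex_nonneg_Reals_iff)
  ultimately have "Re (h (star y * y)) \<le> 1" using one by (metis add.commute le_add_same_cancel1 one_complex.simps(1) plus_complex.simps(1) add_le_cancel_left)
  then have "c\<^sup>2 * Re (h (star x * x)) \<le> 1" by (simp add: yy scale scaleC_complex_def)
  then show ?thesis using False by (simp add: c_def power2_eq_square field_simps)
qed

subsection \<open>Diagonalisation of locally finite symmetric operators\<close>

text \<open>This is p(L) x, written with iterates because \<open>L\<close> will be linear on a
  subspace only.\<close>

definition poly_op :: "('a::complex_vector \<Rightarrow> 'a) \<Rightarrow> complex poly \<Rightarrow> 'a \<Rightarrow> 'a" where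
  "poly_op L p x = (\<Sum>m\<le>degree p. coeff p m *\<^sub>C (L ^^ m) x)"

lemma poly_op_atMost: "degree p \<le> N \<Longrightarrow> poly_op L p x = (\<Sum>m\<le>N. coeff p m *\<^sub>C (L ^^ m) x)"
  unfolding poly_op_def
  by (rule sum.mono_neutral_left) (auto simp: coeff_eq_0)

text \<open>More iterates than \<open>B\<close> has elements are linearly dependent, and a
  dependence between iterates is a polynomial in \<open>L\<close>.\<close>

lemma exists_annihilating_poly:
  assumes B: "finite B" and L: "\<And>m. (L ^^ m) u \<in> complex_vector.span B"
  obtains p where "p \<noteq> 0" "poly_op L p u = 0"
proof (cases "inj_on (\<lambda>m. (L ^^ m) u) {..card B}")
  case True
  define f where "f m = (L ^^ m) u" for m
  let ?S = "f ` {..card B}"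
  have inj: "inj_on f {..card B}" using True unfolding f_def .
  have card: "card ?S = Suc (card B)" by (subst card_image[OF inj]) simp
  have "complex_vector.dependent ?S"
  proof (rule ccontr)
    assume "\<not> complex_vector.dependent ?S"
    then have "card ?S \<le> card B"
      using complex_vector.independent_span_bound[OF B, of ?S] L by (auto simp: f_def)
    then show False using card by simp
  qed
  then obtain w where w: "\<exists>v\<in>?S. w v \<noteq> 0" "(\<Sum>v\<in>?S. w v *\<^sub>C v) = 0"
    using complex_vector.dependent_finite[of ?S] by auto
  define p where "p = (\<Sum>m\<le>card B. monom (w (f m)) m)"
  have coeff: "coeff p m = (if m \<le> card B then w (f m) else 0)" for m
    by (simp add: p_def coeff_sum sum.delta)
  then have deg: "degree p \<le> card B" by (intro degree_le) auto
  have "p \<noteq> 0" using w(1) coeff by (metis atMost_iff coeff_0 imageE)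
  moreover have "poly_op L p u = (\<Sum>m\<le>card B. w (f m) *\<^sub>C f m)"
    unfolding poly_op_atMost[OF deg] by (intro sum.cong) (auto simp: coeff f_def)
  then have "poly_op L p u = 0" using w(2) by (simp add: sum.reindex[OF inj])
  ultimately show ?thesis using that by blast
next
  \<comment> \<open>Dependence is a notion for sets, in which repeated iterates collapse. A
    repetition is treated apart: X^m - X^n then annihilates \<open>u\<close>.\<close>
  case False
  then obtain m n where mn: "m \<noteq> n" "(L ^^ m) u = (L ^^ n) u" by (auto simp: inj_on_def)
  define p where "p = monom 1 m - monom (1::complex) n"
  have "coeff p m = 1" using mn by (simp add: p_def)
  then have "p \<noteq> 0" by auto
  moreover have deg: "degree p \<le> m + n"
    unfolding p_def by (intro degree_diff_le) (auto simp: degree_monom_eq)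
  have "poly_op L p u = (\<Sum>k\<le>m+n. (if k = m then (L ^^ m) u else 0) - (if k = n then (L ^^ n) u else 0))"
    unfolding poly_op_atMost[OF deg]
    by (intro sum.cong) (use mn in \<open>auto simp: p_def scaleC_one scaleC_minus_one\<close>)
  then have "poly_op L p u = 0" using mn by (simp add: sum_subtractf)
  ultimately show ?thesis using that by blast
qed

text \<open>Linear factors of \<open>p\<close> are peeled off one at a time; symmetry excludes
  Jordan blocks, so each factor can be removed inside the span of eigenvectors. \<open>J\<close>
  carries the Hilbert space inner product back to \<open>V\<close>.\<close>

lemma span_eigenvectors_of_symmetric:
  fixes J :: "'a::complex_vector \<Rightarrow> 'x::complex_hilbert"
  assumes V: "complex_vector.subspace V" and L: "clinear_on V L" "\<And>a. a \<in> V \<Longrightarrow> L a \<in> V"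
    and J: "clinear_on V J" "\<And>a. a \<in> V \<Longrightarrow> J a = 0 \<Longrightarrow> a = 0"
    and sym: "\<And>a b. a \<in> V \<Longrightarrow> b \<in> V \<Longrightarrow> cinner (J (L a)) (J b) = cinner (J a) (J (L b))"
    and u: "u \<in> V" and p: "p \<noteq> 0" "poly_op L p u = 0"
  shows "u \<in> complex_vector.span {a \<in> V. \<exists>\<beta>. L a = \<beta> *\<^sub>C a}"
proof -
  let ?E = "complex_vector.span {a \<in> V. \<exists>\<beta>. L a = \<beta> *\<^sub>C a}"
  have L_add: "L (a + b) = L a + L b" if "a \<in> V" "b \<in> V" for a b
    using L(1) that by (simp add: clinear_on_def)
  have L_scale: "L (c *\<^sub>C a) = c *\<^sub>C L a" if "a \<in> V" for a c
    using L(1) that by (simp add: clinear_on_def)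
  have J_scale: "J (c *\<^sub>C a) = c *\<^sub>C J a" if "a \<in> V" for a c
    using J(1) that by (simp add: clinear_on_def)
  have J_add: "J (a + b) = J a + J b" if "a \<in> V" "b \<in> V" for a b
    using J(1) that by (simp add: clinear_on_def)
  note VI = complex_vector.subspace_add[OF V] complex_vector.subspace_scale[OF V]
    complex_vector.subspace_diff[OF V] complex_vector.subspace_0[OF V]
  have EV: "?E \<subseteq> V" using V by (intro complex_vector.span_minimal) auto
  define M where "M \<alpha> a = L a - \<alpha> *\<^sub>C a" for \<alpha> a
  have MV: "M \<alpha> a \<in> V" if "a \<in> V" for \<alpha> a using that VI L(2) by (simp add: M_def)
  have M_add: "M \<alpha> (a + b) = M \<alpha> a + M \<alpha> b" if "a \<in> V" "b \<in> V" for \<alpha> a b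
    using that by (simp add: M_def L_add scaleC_add_right)
  have M_scale: "M \<alpha> (c *\<^sub>C a) = c *\<^sub>C M \<alpha> a" if "a \<in> V" for \<alpha> a c
    using that by (simp add: M_def L_scale complex_vector.scale_right_diff_distrib scaleC_scaleC mult.commute)
  have M_diff: "M \<alpha> (a - b) = M \<alpha> a - M \<alpha> b" if "a \<in> V" "b \<in> V" for \<alpha> a b
    using M_add[of "a - b" b \<alpha>] that VI by (simp add: algebra_simps)
  have M_zero: "M \<alpha> 0 = 0" for \<alpha> using M_scale[of 0 \<alpha> 0] VI by simp
  \<comment> \<open>An eigenvector for \<beta> \<noteq> \<alpha> is the image under
    \<open>M \<alpha>\<close> of its multiple by 1/(\<beta> - \<alpha>); one for \<beta> = \<alpha>
    goes into the part killed by \<open>M \<alpha>\<close>.\<close>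
  have split: "\<exists>e\<in>?E. \<exists>y\<in>V. v = M \<alpha> e + y \<and> M \<alpha> y = 0" if "v \<in> ?E" for \<alpha> v
    using that
  proof (induction rule: complex_vector.span_induct_alt)
    case base
    show ?case
      by (intro bexI[of _ 0]) (simp_all add: M_zero VI complex_vector.span_zero)
  next
    case (step c g v)
    then obtain \<beta> e y where g: "g \<in> V" "L g = \<beta> *\<^sub>C g"
      and ey: "e \<in> ?E" "y \<in> V" "v = M \<alpha> e + y" "M \<alpha> y = 0" by blast
    have Mg: "M \<alpha> g = (\<beta> - \<alpha>) *\<^sub>C g" by (simp add: M_def g complex_vector.scale_left_diff_distrib)
    have gE: "g \<in> ?E" using g by (intro complex_vector.span_base) blast
    have eV: "e \<in> V" using ey EV by blast
    show ?case
    proof (cases "\<beta> = \<alpha>")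
      case True
      have "c *\<^sub>C g + v = M \<alpha> e + (c *\<^sub>C g + y)" "M \<alpha> (c *\<^sub>C g + y) = 0"
        using ey g True Mg VI by (simp_all add: M_add M_scale)
      then show ?thesis using ey g VI by blast
    next
      case False
      let ?k = "(c / (\<beta> - \<alpha>)) *\<^sub>C g"
      have "M \<alpha> ?k = c *\<^sub>C g" using False g by (simp add: M_scale Mg scaleC_scaleC)
      then have "c *\<^sub>C g + v = M \<alpha> (?k + e) + y" using ey g eV VI by (simp add: M_add)
      moreover have "?k + e \<in> ?E" using gE ey by (intro complex_vector.span_add complex_vector.span_scale)
      ultimately show ?thesis using ey by blast
    qed
  qed
  \<comment> \<open>No Jordan block: y = \<open>M \<alpha> x\<close> would be an eigenvector, so
    \<alpha> is real, and moving \<open>M \<alpha>\<close> across the inner product gives \<langle>J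
    y, J y\<rangle> = 0.\<close>
  have square: "M \<alpha> x = 0" if x: "x \<in> V" and MM: "M \<alpha> (M \<alpha> x) = 0" for \<alpha> x
  proof (rule ccontr)
    define y where "y = M \<alpha> x"
    have yV: "y \<in> V" using MV x by (simp add: y_def)
    assume "M \<alpha> x \<noteq> 0"
    then have Jy: "J y \<noteq> 0" using J(2)[OF yV] by (auto simp: y_def)
    have Ly: "L y = \<alpha> *\<^sub>C y" using MM by (simp add: y_def M_def)
    have "cinner (J (L y)) (J y) = cinner (J y) (J (L y))" by (rule sym[OF yV yV])
    then have real: "cnj \<alpha> = \<alpha>" using Jy yV by (simp add: Ly J_scale cinner_scaleC_left cinner_scaleC_right)
    have "J (M \<alpha> x + \<alpha> *\<^sub>C x) = J (M \<alpha> x) + \<alpha> *\<^sub>C J x"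
      using J_add[OF MV[OF x] VI(2)[OF x]] x by (simp add: J_scale)
    then have "J (M \<alpha> x) = J (L x) - \<alpha> *\<^sub>C J x" by (simp add: M_def)
    then have "cinner (J y) (J y) = cinner (J (L x)) (J y) - cnj \<alpha> * cinner (J x) (J y)"
      by (simp add: y_def cinner_diff_left cinner_scaleC_left)
    also have "cinner (J (L x)) (J y) = \<alpha> * cinner (J x) (J y)"
      using sym[OF x yV] yV by (simp add: Ly J_scale cinner_scaleC_right)
    finally show False using Jy real by simp
  qed
  have step: "x \<in> ?E" if x: "x \<in> V" and Mx: "M \<alpha> x \<in> ?E" for \<alpha> x
  proof -
    obtain e y where ey: "e \<in> ?E" "y \<in> V" "M \<alpha> x = M \<alpha> e + y" "M \<alpha> y = 0" using split[OF Mx] by blast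
    have eV: "e \<in> V" using ey EV by blast
    have "M \<alpha> (x - e) = y" using ey x eV by (simp add: M_diff)
    then have "M \<alpha> (x - e) = 0" using square[of "x - e" \<alpha>] ey x eV VI by simp
    then have "L (x - e) = \<alpha> *\<^sub>C (x - e)" by (simp add: M_def)
    then have "x - e \<in> ?E" using x eV VI by (intro complex_vector.span_base) auto
    then show ?thesis using complex_vector.span_add[OF _ ey(1)] by fastforce
  qed
  have pow: "(L ^^ m) x \<in> V" "(L ^^ m) (M \<alpha> x) = (L ^^ Suc m) x - \<alpha> *\<^sub>C (L ^^ m) x"
    if x: "x \<in> V" for m \<alpha> x
  proof -
    show V': "(L ^^ m) x \<in> V" for m by (induction m) (use x L(2) in auto)
    show "(L ^^ m) (M \<alpha> x) = (L ^^ Suc m) x - \<alpha> *\<^sub>C (L ^^ m) x"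
    proof (induction m)
      case (Suc m)
      have "L (a - \<alpha> *\<^sub>C b) = L a - \<alpha> *\<^sub>C L b" if "a \<in> V" "b \<in> V" for a b
      proof -
        have "L (a - \<alpha> *\<^sub>C b + \<alpha> *\<^sub>C b) = L (a - \<alpha> *\<^sub>C b) + L (\<alpha> *\<^sub>C b)"
          by (intro L_add VI that)
        then show ?thesis by (simp add: L_scale[OF that(2)])
      qed
      then show ?case using Suc V'[of m] V'[of "Suc m"] by simp
    qed (simp add: M_def)
  qed
  \<comment> \<open>The hypothesis p(L) x = 0 is weakened to membership in the span of eigenvectors,
    which is what survives the induction on the degree.\<close>
  have main: "x \<in> ?E" if "p \<noteq> 0" "x \<in> V" "poly_op L p x \<in> ?E" for p x
    using that
  proof (induction "degree p" arbitrary: p x)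
    case 0
    then obtain c where c: "p = [:c:]" using degree_eq_zeroE by metis
    then have "c *\<^sub>C x \<in> ?E" using 0 by (simp add: poly_op_def)
    then have "inverse c *\<^sub>C c *\<^sub>C x \<in> ?E" by (rule complex_vector.span_scale)
    then show ?case using 0 c by (simp add: scaleC_scaleC scaleC_one)
  next
    case (Suc n)
    have "\<not> constant (poly p)" using Suc(2) by (simp add: constant_degree)
    then obtain \<alpha> where "poly p \<alpha> = 0" using fundamental_theorem_of_algebra by blast
    \<comment> \<open>With p = (X - \<alpha>) q, p(L) x becomes q(L) applied to
      \<open>M \<alpha> x\<close>, so the induction hypothesis concerns
      \<open>M \<alpha> x\<close>.\<close>
    then obtain q where q: "p = [:- \<alpha>, 1:] * q" by (metis dvdE poly_eq_0_iff_dvd)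
    have q0: "q \<noteq> 0" using q Suc.prems by auto
    have degq: "degree q = n"
      using Suc(2) q0 unfolding q by (subst (asm) degree_mult_eq) auto
    have coeff: "coeff p m = coeff (pCons 0 q) m - \<alpha> * coeff q m" for m
      by (simp add: q)
    have "poly_op L p x = (\<Sum>m\<le>Suc n. coeff p m *\<^sub>C (L ^^ m) x)"
      using Suc(2) by (intro poly_op_atMost) simp
    also have "\<dots> = (\<Sum>m\<le>Suc n. coeff (pCons 0 q) m *\<^sub>C (L ^^ m) x) - (\<Sum>m\<le>Suc n. (\<alpha> * coeff q m) *\<^sub>C (L ^^ m) x)"
      unfolding coeff complex_vector.scale_left_diff_distrib sum_subtractf ..
    also have "(\<Sum>m\<le>Suc n. coeff (pCons 0 q) m *\<^sub>C (L ^^ m) x) = (\<Sum>m\<le>n. coeff q m *\<^sub>C (L ^^ Suc m) x)"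
      by (subst sum.atMost_Suc_shift) simp
    also have "(\<Sum>m\<le>Suc n. (\<alpha> * coeff q m) *\<^sub>C (L ^^ m) x) = (\<Sum>m\<le>n. (\<alpha> * coeff q m) *\<^sub>C (L ^^ m) x)"
      using degq by (simp add: coeff_eq_0)
    finally have "poly_op L p x = (\<Sum>m\<le>n. coeff q m *\<^sub>C (L ^^ Suc m) x - (\<alpha> * coeff q m) *\<^sub>C (L ^^ m) x)"
      by (simp add: sum_subtractf)
    also have "\<dots> = poly_op L q (M \<alpha> x)"
      unfolding poly_op_atMost[OF eq_refl[OF degq]] pow(2)[OF Suc.prems(2)]
      by (simp add: complex_vector.scale_right_diff_distrib scaleC_scaleC mult.commute)
    finally have "poly_op L q (M \<alpha> x) \<in> ?E" using Suc.prems by simp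
    then have "M \<alpha> x \<in> ?E" by (rule Suc.hyps(1)[OF degq[symmetric] q0 MV[OF Suc.prems(2)]])
    then show ?case by (rule step[OF Suc.prems(2)])
  qed
  show ?thesis by (rule main[OF p(1) u]) (simp add: p(2) complex_vector.span_zero)
qed

subsection \<open>Evaluation of Sweedler sums\<close>

lemma clinear_onD:
  assumes "clinear_on V f"
  shows "x \<in> V \<Longrightarrow> y \<in> V \<Longrightarrow> f (x + y) = f x + f y" "x \<in> V \<Longrightarrow> f (c *\<^sub>C x) = c *\<^sub>C f x"
  using assms by (auto simp: clinear_on_def)

lemma clinear_on_subset: "clinear_on V f \<Longrightarrow> W \<subseteq> V \<Longrightarrow> clinear_on W f"
  unfolding clinear_on_def by blast

lemma clinear_on_zero: "clinear_on V f \<Longrightarrow> 0 \<in> V \<Longrightarrow> f 0 = 0"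
  using clinear_onD(2)[of V f 0 0] by simp

lemma clinear_on_sum:
  assumes f: "clinear_on V f" and V: "complex_vector.subspace V" and g: "\<And>i. i \<in> I \<Longrightarrow> g i \<in> V"
  shows "f (\<Sum>i\<in>I. g i) = (\<Sum>i\<in>I. f (g i))"
  using g
proof (induction I rule: infinite_finite_induct)
  case (insert i I)
  then have "(\<Sum>i\<in>I. g i) \<in> V" by (intro complex_vector.subspace_sum[OF V]) auto
  then show ?case using insert by (simp add: clinear_onD(1)[OF f])
qed (simp_all add: clinear_on_zero[OF f] complex_vector.subspace_0[OF V])

lemma clinear_on_diff:
  assumes f: "clinear_on V f" and V: "complex_vector.subspace V" and x: "x \<in> V" and y: "y \<in> V"
  shows "f (x - y) = f x - f y"
  using clinear_onD(1)[OF f complex_vector.subspace_diff[OF V x y] y] by simp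

text \<open>The setting in which the definite description in \<open>sweedler\<close> denotes:
  decompositions with entries in \<open>A\<close> exist, and bilinear evaluations do not depend on
  the decomposition.\<close>

locale algebraic_comult =
  fixes tens :: "'a::cstar_algebra \<Rightarrow> 'a \<Rightarrow> 'b::cstar_algebra" and \<Delta> :: "'a \<Rightarrow> 'b" and A :: "'a set"
  assumes min_tens: "min_tensor tens" and subA: "complex_vector.subspace A"
    and comult_span: "a \<in> A \<Longrightarrow> \<Delta> a \<in> complex_vector.span {tens x y | x y. x \<in> A \<and> y \<in> A}"
    and comult_linear: "clinear_on UNIV \<Delta>"
begin

definition bilinear_on :: "('a \<Rightarrow> 'a \<Rightarrow> 'v::complex_vector) \<Rightarrow> bool" where
  "bilinear_on \<beta> \<longleftrightarrow> (\<forall>x\<in>A. clinear_on A (\<beta> x)) \<and> (\<forall>y\<in>A. clinear_on A (\<lambda>x. \<beta> x y))"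

text \<open>Index sets are arbitrary finite sets here, so that disjoint sums and products of index
  sets can be used without renumbering.\<close>

definition decomp :: "'i set \<Rightarrow> ('i \<Rightarrow> 'a) \<Rightarrow> ('i \<Rightarrow> 'a) \<Rightarrow> 'a \<Rightarrow> bool" where
  "decomp I x y a \<longleftrightarrow> finite I \<and> (\<forall>i\<in>I. x i \<in> A \<and> y i \<in> A) \<and> \<Delta> a = (\<Sum>i\<in>I. tens (x i) (y i))"

lemma decompD:
  assumes "decomp I x y a"
  shows "finite I" "i \<in> I \<Longrightarrow> x i \<in> A" "i \<in> I \<Longrightarrow> y i \<in> A" "\<Delta> a = (\<Sum>i\<in>I. tens (x i) (y i))"
  using assms by (auto simp: decomp_def)

lemma bilinear_onI:
  assumes B: "cbilinear B" and f: "clinear_on A f" and g: "clinear_on A g"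
  shows "bilinear_on (\<lambda>x y. B (f x) (g y))"
  using B f g by (simp add: bilinear_on_def cbilinear_def clinear_on_def)

lemma tens_bilinear: "cbilinear tens"
  using min_tens by (simp add: min_tensor_def)

lemma tens_bilinear_on: "bilinear_on tens"
proof -
  have "clinear_on A (\<lambda>x. x)" by (simp add: clinear_on_def)
  from bilinear_onI[OF tens_bilinear this this] show ?thesis .
qed

text \<open>Rewriting the right factors in a basis leaves one term per basis vector; injectivity of
  the algebraic tensor product kills all left factors, and then any bilinear evaluation
  vanishes.\<close>

lemma bilinear_on_sum_zero:
  fixes \<beta> :: "'a \<Rightarrow> 'a \<Rightarrow> 'v::complex_vector"
  assumes \<beta>: "bilinear_on \<beta>" and I: "finite I" and A: "\<And>i. i \<in> I \<Longrightarrow> x i \<in> A" "\<And>i. i \<in> I \<Longrightarrow> y i \<in> A"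
    and zero: "(\<Sum>i\<in>I. tens (x i) (y i)) = 0"
  shows "(\<Sum>i\<in>I. \<beta> (x i) (y i)) = 0"
proof -
  obtain B where B: "B \<subseteq> y ` I" "complex_vector.independent B" "y ` I \<subseteq> complex_vector.span B"
    by (rule complex_vector.basis_exists[of "y ` I"])
  have finB: "finite B" using B(1) I finite_subset by blast
  have BA: "B \<subseteq> A" using B(1) A(2) by blast
  have "\<exists>c. y i = (\<Sum>b\<in>B. c b *\<^sub>C b)" if "i \<in> I" for i
  proof -
    have "y i \<in> complex_vector.span B" using B(3) that by blast
    then show ?thesis by (auto simp: complex_vector.span_finite[OF finB])
  qed
  then obtain c where c: "\<And>i. i \<in> I \<Longrightarrow> y i = (\<Sum>b\<in>B. c i b *\<^sub>C b)" by metis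
  define g where "g b = (\<Sum>i\<in>I. c i b *\<^sub>C x i)" for b
  have gA: "g b \<in> A" for b
    unfolding g_def using A(1) by (intro complex_vector.subspace_sum[OF subA] complex_vector.subspace_scale[OF subA])
  \<comment> \<open>The same rewriting serves twice: for \<open>tens\<close>, to show that every
    \<open>g b\<close> is zero, and for the given \<beta>.\<close>
  have expand: "(\<Sum>i\<in>I. \<gamma> (x i) (y i)) = (\<Sum>b\<in>B. \<gamma> (g b) b)"
    if \<gamma>: "bilinear_on \<gamma>" for \<gamma> :: "'a \<Rightarrow> 'a \<Rightarrow> 'w::complex_vector"
  proof -
    have "\<gamma> (x i) (y i) = (\<Sum>b\<in>B. c i b *\<^sub>C \<gamma> (x i) b)" if i: "i \<in> I" for i
    proof -
      have lin: "clinear_on A (\<gamma> (x i))" using \<gamma> A(1)[OF i] by (simp add: bilinear_on_def)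
      have "\<gamma> (x i) (\<Sum>b\<in>B. c i b *\<^sub>C b) = (\<Sum>b\<in>B. \<gamma> (x i) (c i b *\<^sub>C b))"
        using BA by (intro clinear_on_sum[OF lin subA] complex_vector.subspace_scale[OF subA]) auto
      also have "\<dots> = (\<Sum>b\<in>B. c i b *\<^sub>C \<gamma> (x i) b)"
        using BA by (intro sum.cong clinear_onD(2)[OF lin]) auto
      finally show ?thesis using c[OF i] by simp
    qed
    then have "(\<Sum>i\<in>I. \<gamma> (x i) (y i)) = (\<Sum>i\<in>I. \<Sum>b\<in>B. c i b *\<^sub>C \<gamma> (x i) b)" by simp
    also have "\<dots> = (\<Sum>b\<in>B. \<Sum>i\<in>I. c i b *\<^sub>C \<gamma> (x i) b)" by (rule sum.swap)
    also have "\<dots> = (\<Sum>b\<in>B. \<gamma> (g b) b)"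
    proof (rule sum.cong)
      fix b assume b: "b \<in> B"
      have lin: "clinear_on A (\<lambda>x. \<gamma> x b)" using \<gamma> b BA by (auto simp: bilinear_on_def)
      have "\<gamma> (g b) b = (\<Sum>i\<in>I. \<gamma> (c i b *\<^sub>C x i) b)"
        unfolding g_def using A(1)
        by (intro clinear_on_sum[OF lin subA] complex_vector.subspace_scale[OF subA])
      also have "\<dots> = (\<Sum>i\<in>I. c i b *\<^sub>C \<gamma> (x i) b)"
        using A(1) by (intro sum.cong clinear_onD(2)[OF lin]) auto
      finally show "(\<Sum>i\<in>I. c i b *\<^sub>C \<gamma> (x i) b) = \<gamma> (g b) b" by simp
    qed simp
    finally show ?thesis .
  qed
  have "(\<Sum>b\<in>B. tens (g b) b) = 0" using expand[OF tens_bilinear_on] zero by simp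
  then have "\<forall>b\<in>B. g b = 0"
    using min_tens finB B(2) unfolding min_tensor_def by blast
  moreover have "\<beta> 0 b = 0" if "b \<in> B" for b
    using \<beta> that BA clinear_on_zero[of A "\<lambda>x. \<beta> x b"] complex_vector.subspace_0[OF subA]
    by (auto simp: bilinear_on_def)
  ultimately show ?thesis unfolding expand[OF \<beta>] by simp
qed

lemma decomp_Plus:
  assumes a: "decomp I x y a" and b: "decomp J x' y' b"
  shows "decomp (I <+> J) (case_sum x (\<lambda>j. c *\<^sub>C x' j)) (case_sum y y') (a + c *\<^sub>C b)"
proof -
  have "tens (c *\<^sub>C u) v = c *\<^sub>C tens u v" for u v
    using tens_bilinear by (auto simp: cbilinear_def clinear_on_def)
  then show ?thesis
    using decompD[OF a] decompD[OF b] complex_vector.subspace_scale[OF subA]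
    by (auto simp: decomp_def sum.Plus clinear_onD[OF comult_linear]
        complex_vector.scale_sum_right)
qed

lemma decomp_sum_Plus:
  fixes \<beta> :: "'a \<Rightarrow> 'a \<Rightarrow> 'v::complex_vector"
  assumes \<beta>: "bilinear_on \<beta>" and a: "decomp I x y a" and b: "decomp J x' y' b"
  shows "(\<Sum>i\<in>I <+> J. \<beta> (case_sum x (\<lambda>j. c *\<^sub>C x' j) i) (case_sum y y' i)) =
    (\<Sum>i\<in>I. \<beta> (x i) (y i)) + c *\<^sub>C (\<Sum>j\<in>J. \<beta> (x' j) (y' j))"
proof -
  have "\<beta> (c *\<^sub>C x' j) (y' j) = c *\<^sub>C \<beta> (x' j) (y' j)" if "j \<in> J" for j
    using \<beta> decompD[OF b] that by (simp add: bilinear_on_def clinear_on_def)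
  then show ?thesis
    using decompD(1)[OF a] decompD(1)[OF b] by (simp add: sum.Plus complex_vector.scale_sum_right)
qed

text \<open>The formal difference of the two decompositions, with the second scaled by -1,
  decomposes the comultiplication of 0.\<close>

lemma decomp_unique:
  fixes \<beta> :: "'a \<Rightarrow> 'a \<Rightarrow> 'v::complex_vector"
  assumes \<beta>: "bilinear_on \<beta>" and a: "decomp I x y a" and b: "decomp J x' y' a"
  shows "(\<Sum>i\<in>I. \<beta> (x i) (y i)) = (\<Sum>j\<in>J. \<beta> (x' j) (y' j))"
proof -
  note P = decomp_Plus[OF a b, of "- 1"]
  have "\<Delta> (a + (- 1) *\<^sub>C a) = 0"
    using clinear_on_zero[OF comult_linear] by (simp add: scaleC_minus_one)
  then have "(\<Sum>i\<in>I <+> J. \<beta> (case_sum x (\<lambda>j. (- 1) *\<^sub>C x' j) i) (case_sum y y' i)) = 0"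
    using decompD[OF P] by (intro bilinear_on_sum_zero[OF \<beta>]) auto
  then show ?thesis unfolding decomp_sum_Plus[OF \<beta> a b] by (simp add: scaleC_minus_one)
qed

lemma sweedler_eq:
  fixes \<beta> :: "'a \<Rightarrow> 'a \<Rightarrow> 'v::complex_vector"
  assumes \<beta>: "bilinear_on \<beta>" and a: "decomp I x y a"
  shows "sweedler tens \<Delta> A \<beta> a = (\<Sum>i\<in>I. \<beta> (x i) (y i))"
  unfolding sweedler_def
proof (rule the_equality)
  obtain f where f: "bij_betw f {0..<card I} I"
    using ex_bij_betw_nat_finite[OF decompD(1)[OF a]] by blast
  then have f': "bij_betw f {..<card I} I" by (simp add: atLeast0LessThan)
  show "\<exists>(n::nat) x' y'. (\<forall>i<n. x' i \<in> A \<and> y' i \<in> A) \<and> \<Delta> a = (\<Sum>i<n. tens (x' i) (y' i)) \<and>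
      (\<Sum>i\<in>I. \<beta> (x i) (y i)) = (\<Sum>i<n. \<beta> (x' i) (y' i))"
  proof (rule exI[of _ "card I"], rule exI[of _ "x \<circ> f"], rule exI[of _ "y \<circ> f"], intro conjI allI impI)
    fix i assume "i < card I"
    then have "f i \<in> I" using f' bij_betwE by blast
    then show "(x \<circ> f) i \<in> A" "(y \<circ> f) i \<in> A" using decompD[OF a] by auto
  next
    show "\<Delta> a = (\<Sum>i<card I. tens ((x \<circ> f) i) ((y \<circ> f) i))"
      "(\<Sum>i\<in>I. \<beta> (x i) (y i)) = (\<Sum>i<card I. \<beta> ((x \<circ> f) i) ((y \<circ> f) i))"
      using decompD(4)[OF a] sum.reindex_bij_betw[OF f', of "\<lambda>i. tens (x i) (y i)"]
        sum.reindex_bij_betw[OF f', of "\<lambda>i. \<beta> (x i) (y i)"] by simp_all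
  qed
next
  fix v
  assume "\<exists>(n::nat) x' y'. (\<forall>i<n. x' i \<in> A \<and> y' i \<in> A) \<and> \<Delta> a = (\<Sum>i<n. tens (x' i) (y' i)) \<and>
      v = (\<Sum>i<n. \<beta> (x' i) (y' i))"
  then obtain n :: nat and x' y' where d: "decomp {..<n} x' y' a" and v: "v = (\<Sum>i<n. \<beta> (x' i) (y' i))"
    by (auto simp: decomp_def)
  show "v = (\<Sum>i\<in>I. \<beta> (x i) (y i))" using decomp_unique[OF \<beta> a d] v by simp
qed

lemma decomp_exists:
  assumes "a \<in> A"
  obtains n :: nat and x y where "decomp {..<n} x y a"
proof -
  have "\<exists>(n::nat) x y. (\<forall>i<n. x i \<in> A \<and> y i \<in> A) \<and> t = (\<Sum>i<n. tens (x i) (y i))"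
    if t: "t \<in> complex_vector.span {tens x y | x y. x \<in> A \<and> y \<in> A}" for t
    using t
  proof (induction rule: complex_vector.span_induct_alt)
    case base
    show ?case by (intro exI[of _ 0]) simp
  next
    case (step c g t)
    then obtain n :: nat and x y u v where *: "\<forall>i<n. x i \<in> A \<and> y i \<in> A" "t = (\<Sum>i<n. tens (x i) (y i))"
      and g: "g = tens u v" "u \<in> A" "v \<in> A" by blast
    have "tens (c *\<^sub>C u) v = c *\<^sub>C tens u v"
      using tens_bilinear by (auto simp: cbilinear_def clinear_on_def)
    then show ?case
      using * g complex_vector.subspace_scale[OF subA]
      by (rule_tac exI[of _ "Suc n"], rule_tac exI[of _ "x(n := c *\<^sub>C u)"], rule_tac exI[of _ "y(n := v)"])
        (auto simp: less_Suc_eq add.commute)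
  qed
  from this[OF comult_span[OF assms]] show ?thesis
    using that by (auto simp: decomp_def)
qed

lemma sweedler_linear:
  fixes \<beta> :: "'a \<Rightarrow> 'a \<Rightarrow> 'v::complex_vector"
  assumes \<beta>: "bilinear_on \<beta>"
  shows "clinear_on A (sweedler tens \<Delta> A \<beta>)"
proof -
  have *: "sweedler tens \<Delta> A \<beta> (a + c *\<^sub>C b) = sweedler tens \<Delta> A \<beta> a + c *\<^sub>C sweedler tens \<Delta> A \<beta> b"
    if ab: "a \<in> A" "b \<in> A" for a b c
  proof -
    obtain n :: nat and x y where a: "decomp {..<n} x y a" by (rule decomp_exists[OF ab(1)])
    obtain m :: nat and x' y' where b: "decomp {..<m} x' y' b" by (rule decomp_exists[OF ab(2)])
    show ?thesis
      by (simp add: sweedler_eq[OF \<beta> decomp_Plus[OF a b]] decomp_sum_Plus[OF \<beta> a b]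
          sweedler_eq[OF \<beta> a] sweedler_eq[OF \<beta> b])
  qed
  have zero: "sweedler tens \<Delta> A \<beta> 0 = 0"
    using *[of 0 0 "- 1"] complex_vector.subspace_0[OF subA] by (simp add: scaleC_minus_one)
  show ?thesis
    unfolding clinear_on_def
  proof (intro conjI ballI allI)
    show "sweedler tens \<Delta> A \<beta> (a + b) = sweedler tens \<Delta> A \<beta> a + sweedler tens \<Delta> A \<beta> b"
      if "a \<in> A" "b \<in> A" for a b
      using *[OF that, of 1] by (simp add: scaleC_one)
    show "sweedler tens \<Delta> A \<beta> (c *\<^sub>C a) = c *\<^sub>C sweedler tens \<Delta> A \<beta> a" if "a \<in> A" for a c
      using *[OF complex_vector.subspace_0[OF subA] that, of c] zero by simp
  qed
qed

end

subsection \<open>The generator and the derivation on the coefficient algebra\<close>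

locale levy_process =
  fixes tens :: "'a::cstar_algebra \<Rightarrow> 'a \<Rightarrow> 'b::cstar_algebra"
    and tensL :: "'b \<Rightarrow> 'a \<Rightarrow> 'c::cstar_algebra"
    and tensR :: "'a \<Rightarrow> 'b \<Rightarrow> 'c"
    and \<Delta> :: "'a \<Rightarrow> 'b"
    and h \<epsilon> \<phi> :: "'a \<Rightarrow> complex"
    and S :: "'a \<Rightarrow> 'a"
    and A :: "'a set"
    and \<Lambda> :: "'a \<Rightarrow> 'l::complex_hilbert \<Rightarrow> 'l" and \<xi> :: 'l
    and \<pi> :: "'a \<Rightarrow> 'h::complex_hilbert \<Rightarrow> 'h" and \<eta> :: "'a \<Rightarrow> 'h"
    and htens :: "'l \<Rightarrow> 'h \<Rightarrow> 't::complex_hilbert"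
  assumes cqg: "compact_quantum_group tens tensL tensR \<Delta>"
    and haar: "haar_state tens \<Delta> h" and faithful: "faithful h"
    and A_def: "A = coefficient_algebra tens \<Delta>" and A_dense: "closure A = UNIV"
    and hopf: "hopf_star_algebra tens \<Delta> A \<epsilon> S"
    and gns: "gns_triple h \<Lambda> \<xi>"
    and gen: "generating_functional A \<epsilon> \<phi>" and symm: "gns_symmetric A S \<phi>"
    and schuermann: "schuermann_triple A \<epsilon> \<pi> \<eta> \<phi>"
    and htens: "hilbert_tensor htens"
begin

lemma comult:
  "clinear_on UNIV \<Delta>" "\<Delta> 1 = 1" "\<Delta> (x * y) = \<Delta> x * \<Delta> y" "\<Delta> (star x) = star (\<Delta> x)"
  using cqg by (auto simp: compact_quantum_group_def unital_star_hom_def)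

lemma tens_props:
  "tens 1 1 = 1" "tens x y * tens z w = tens (x * z) (y * w)" "star (tens x y) = tens (star x) (star y)"
  using cqg by (auto simp: compact_quantum_group_def min_tensor_def)

lemma subalgebra:
  "complex_vector.subspace A" "1 \<in> A" "a \<in> A \<Longrightarrow> star a \<in> A" "a \<in> A \<Longrightarrow> b \<in> A \<Longrightarrow> a * b \<in> A"
  using hopf by (auto simp: hopf_star_algebra_def)

sublocale algebraic_comult tens \<Delta> A
proof
  show "min_tensor tens" using cqg by (simp add: compact_quantum_group_def)
  show "\<Delta> a \<in> complex_vector.span {tens x y |x y. x \<in> A \<and> y \<in> A}" if "a \<in> A" for a
    using hopf that unfolding hopf_star_algebra_def by blast
qed (rule subalgebra comult)+

lemma linear:
  "clinear_on A \<epsilon>" "clinear_on A \<phi>" "clinear_on A S" "clinear_on A \<eta>" "clinear_on UNIV h"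
  "clinear_on A (\<lambda>a. \<pi> a v)" "clinear_on UNIV (\<lambda>a. \<Lambda> a w)" "clinear_on V (\<lambda>x. x)"
  using hopf gen schuermann haar gns
  by (auto simp: hopf_star_algebra_def generating_functional_def schuermann_triple_def
      haar_state_def gns_triple_def star_representation_def clinear_on_def)

lemma linear_\<Lambda>: "clinear_on A (\<lambda>a. \<Lambda> a w)"
  using linear(7) by (rule clinear_on_subset) simp

lemma scale_bilinear:
  "cbilinear (\<lambda>x (y::'v::complex_vector). x *\<^sub>C y)" "cbilinear (\<lambda>(y::'v) x. x *\<^sub>C y)"
  by (auto simp: cbilinear_def clinear_on_def scaleC_add_left scaleC_add_right scaleC_scaleC
      scaleC_complex_def mult.commute)

lemma mult_bilinear: "cbilinear (\<lambda>x y::'a. x * y)"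
  by (auto simp: cbilinear_def clinear_on_def distrib_left distrib_right scaleC_mult_left scaleC_mult_right)

lemma htens_bilinear: "cbilinear htens"
  using htens by (simp add: hilbert_tensor_def)

lemmas bilinears =
  bilinear_onI[OF scale_bilinear(1) linear(1) linear(8)]
  bilinear_onI[OF scale_bilinear(2) linear(8) linear(1)]
  bilinear_onI[OF scale_bilinear(2) linear(8) linear(2)]
  bilinear_onI[OF mult_bilinear linear(3) linear(8)]
  bilinear_onI[OF htens_bilinear linear_\<Lambda> linear(4)]
  bilinear_onI[OF htens_bilinear linear_\<Lambda> linear(6)]

lemma decomp_one: "decomp {()} (\<lambda>_. 1) (\<lambda>_. 1) 1"
  by (simp add: decomp_def subalgebra comult tens_props)

lemma decomp_mult:
  assumes "decomp I x y a" "decomp J x' y' b"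
  shows "decomp (I \<times> J) (\<lambda>(i, j). x i * x' j) (\<lambda>(i, j). y i * y' j) (a * b)"
  using assms
  by (auto simp: decomp_def comult subalgebra sum_product sum.cartesian_product tens_props
      intro!: sum.cong)

lemma decomp_star:
  assumes "decomp I x y a"
  shows "decomp I (\<lambda>i. star (x i)) (\<lambda>i. star (y i)) (star a)"
  using assms by (auto simp: decomp_def comult subalgebra star_sum tens_props)

lemma haar_decomp:
  assumes "decomp I x y a"
  shows "(\<Sum>i\<in>I. h (x i) *\<^sub>C y i) = h a *\<^sub>C 1"
proof -
  obtain E where E: "bounded_clinear E" "\<And>x y. E (tens x y) = h x *\<^sub>C y" "\<And>a. E (\<Delta> a) = h a *\<^sub>C 1"
    using haar by (auto simp: haar_state_def tensor_extension_def)
  have lin: "clinear_on UNIV E" using E(1) by (simp add: bounded_clinear_def)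
  have "h a *\<^sub>C 1 = E (\<Sum>i\<in>I. tens (x i) (y i))" using E(3)[of a] decompD(4)[OF assms] by simp
  also have "\<dots> = (\<Sum>i\<in>I. E (tens (x i) (y i)))"
    using lin by (intro clinear_on_sum) auto
  finally show ?thesis by (simp add: E(2))
qed

lemma h_sum: "h (\<Sum>i\<in>I. c i *\<^sub>C x i) = (\<Sum>i\<in>I. c i * h (x i))"
proof -
  have "h (\<Sum>i\<in>I. c i *\<^sub>C x i) = (\<Sum>i\<in>I. h (c i *\<^sub>C x i))"
    using linear(5) by (intro clinear_on_sum) auto
  then show ?thesis by (simp add: clinear_onD(2)[OF linear(5)] scaleC_complex_def)
qed

lemma \<phi>_sum:
  assumes "\<And>i. i \<in> I \<Longrightarrow> x i \<in> A"
  shows "\<phi> (\<Sum>i\<in>I. c i *\<^sub>C x i) = (\<Sum>i\<in>I. c i * \<phi> (x i))"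
proof -
  have "\<phi> (\<Sum>i\<in>I. c i *\<^sub>C x i) = (\<Sum>i\<in>I. \<phi> (c i *\<^sub>C x i))"
    using assms linear(2) subA by (intro clinear_on_sum[of A] complex_vector.subspace_scale) auto
  then show ?thesis using assms by (simp add: clinear_onD(2)[OF linear(2)] scaleC_complex_def)
qed

lemma \<epsilon>_props:
  "\<epsilon> 1 = 1" "a \<in> A \<Longrightarrow> b \<in> A \<Longrightarrow> \<epsilon> (a * b) = \<epsilon> a * \<epsilon> b" "a \<in> A \<Longrightarrow> \<epsilon> (star a) = cnj (\<epsilon> a)"
  using hopf by (auto simp: hopf_star_algebra_def)

lemma counit_decomp:
  assumes "a \<in> A" "decomp I x y a"
  shows "(\<Sum>i\<in>I. \<epsilon> (x i) *\<^sub>C y i) = a" "(\<Sum>i\<in>I. \<epsilon> (y i) *\<^sub>C x i) = a"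
proof -
  have "sweedler tens \<Delta> A (\<lambda>x y. \<epsilon> x *\<^sub>C y) a = a" "sweedler tens \<Delta> A (\<lambda>x y. \<epsilon> y *\<^sub>C x) a = a"
    using hopf assms(1) by (auto simp: hopf_star_algebra_def)
  then show "(\<Sum>i\<in>I. \<epsilon> (x i) *\<^sub>C y i) = a" "(\<Sum>i\<in>I. \<epsilon> (y i) *\<^sub>C x i) = a"
    using sweedler_eq[OF bilinears(1) assms(2)] sweedler_eq[OF bilinears(2) assms(2)] by simp_all
qed

lemma antipode_decomp:
  assumes "a \<in> A" "decomp I x y a"
  shows "(\<Sum>i\<in>I. S (x i) * y i) = \<epsilon> a *\<^sub>C 1"
proof -
  have "sweedler tens \<Delta> A (\<lambda>x y. S x * y) a = \<epsilon> a *\<^sub>C 1"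
    using hopf assms(1) by (auto simp: hopf_star_algebra_def)
  then show ?thesis using sweedler_eq[OF bilinears(4) assms(2)] by simp
qed

definition corep :: "nat \<Rightarrow> (nat \<Rightarrow> nat \<Rightarrow> 'a) \<Rightarrow> bool" where
  "corep n u \<longleftrightarrow> unitary_corepresentation tens \<Delta> n u"

lemma corepD:
  assumes "corep n u" "i < n" "j < n"
  shows "u i j \<in> A" "decomp {..<n} (u i) (\<lambda>k. u k j) (u i j)"
    "(\<Sum>k<n. u i k * star (u j k)) = (if i = j then 1 else 0)"
proof -
  have A: "u i j \<in> A" if "i < n" "j < n" for i j
    unfolding A_def coefficient_algebra_def
    using assms(1) that by (intro complex_vector.span_base) (auto simp: corep_def)
  show "u i j \<in> A" using A assms by blast
  show "decomp {..<n} (u i) (\<lambda>k. u k j) (u i j)"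
    using assms A by (auto simp: corep_def unitary_corepresentation_def decomp_def)
  show "(\<Sum>k<n. u i k * star (u j k)) = (if i = j then 1 else 0)"
    using assms by (simp add: corep_def unitary_corepresentation_def)
qed

lemma A_induct [consumes 1, case_names subspace coefficient]:
  assumes "a \<in> A" and "complex_vector.subspace {a \<in> A. P a}"
    and "\<And>n u i j. corep n u \<Longrightarrow> i < n \<Longrightarrow> j < n \<Longrightarrow> P (u i j)"
  shows "P a"
proof -
  have "complex_vector.span {u i j | n u i j. unitary_corepresentation tens \<Delta> n u \<and> i < n \<and> j < n}
      \<subseteq> {a \<in> A. P a}"
    using assms(2,3) corepD(1) by (intro complex_vector.span_minimal) (auto simp: corep_def)
  then show ?thesis using assms(1) unfolding A_def coefficient_algebra_def by blast
qed

text \<open>The matrix \<open>u\<close> is unitary, so right multiplication by it is undone by its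
  adjoint. This determines the counit, the antipode and the partial Haar integrals on
  coefficients.\<close>

lemma corep_cancel:
  assumes u: "corep n u" and l: "l < n"
  shows "(\<Sum>j<n. (\<Sum>k<n. x k * u k j) * star (u l j)) = x l"
proof -
  have "(\<Sum>j<n. (\<Sum>k<n. x k * u k j) * star (u l j)) = (\<Sum>j<n. \<Sum>k<n. x k * (u k j * star (u l j)))"
    by (simp add: sum_distrib_right mult.assoc)
  also have "\<dots> = (\<Sum>k<n. \<Sum>j<n. x k * (u k j * star (u l j)))" by (rule sum.swap)
  also have "\<dots> = (\<Sum>k<n. x k * (if k = l then 1 else 0))"
    using corepD(3)[OF u _ l] by (intro sum.cong) (auto simp flip: sum_distrib_left)
  also have "\<dots> = (\<Sum>k<n. if k = l then x k else 0)" by (intro sum.cong) auto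
  also have "\<dots> = x l" using l by simp
  finally show ?thesis .
qed

lemma \<epsilon>_corep:
  assumes u: "corep n u" and il: "i < n" "l < n"
  shows "\<epsilon> (u i l) = (if i = l then 1 else 0)"
proof -
  have "(\<Sum>j<n. (\<Sum>k<n. (\<epsilon> (u i k) *\<^sub>C 1) * u k j) * star (u l j)) = \<epsilon> (u i l) *\<^sub>C 1"
    by (rule corep_cancel[OF u il(2)])
  moreover have "(\<Sum>k<n. (\<epsilon> (u i k) *\<^sub>C 1) * u k j) = u i j" if "j < n" for j
    using counit_decomp(1)[OF corepD(1,2)[OF u il(1) that]] by (simp add: scaleC_mult_left)
  ultimately have "\<epsilon> (u i l) *\<^sub>C (1::'a) = (if i = l then 1 else 0)"
    using corepD(3)[OF u il] by simp
  then have "(\<epsilon> (u i l) - (if i = l then 1 else 0)) *\<^sub>C (1::'a) = 0"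
    by (auto simp: complex_vector.scale_left_diff_distrib scaleC_one)
  then show ?thesis by simp
qed

text \<open>The antipode axiom says that the matrix of \<open>S (u i k)\<close> is a left inverse of
  \<open>u\<close>. This formula ties the symmetry condition on \<phi> to the involution.\<close>

lemma S_corep:
  assumes u: "corep n u" and il: "i < n" "l < n"
  shows "S (u i l) = star (u l i)"
proof -
  have "(\<Sum>j<n. (\<Sum>k<n. S (u i k) * u k j) * star (u l j)) = S (u i l)"
    by (rule corep_cancel[OF u il(2)])
  moreover have "(\<Sum>k<n. S (u i k) * u k j) = (if i = j then 1 else 0)" if "j < n" for j
    using antipode_decomp[OF corepD(1,2)[OF u il(1) that]] \<epsilon>_corep[OF u il(1) that]
    by (simp add: scaleC_one)
  ultimately have "S (u i l) = (\<Sum>j<n. (if i = j then 1 else 0) * star (u l j))" by simp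
  also have "\<dots> = (\<Sum>j<n. if i = j then star (u l j) else 0)" by (intro sum.cong) auto
  finally show ?thesis using il by simp
qed

abbreviation "L \<equiv> L_op tens \<Delta> A \<phi>"

lemma L_decomp: "decomp I x y a \<Longrightarrow> L a = (\<Sum>i\<in>I. \<phi> (y i) *\<^sub>C x i)"
  unfolding L_op_def by (rule sweedler_eq[OF bilinears(3)])

lemma L_linear: "clinear_on A L"
  unfolding L_op_def by (rule sweedler_linear[OF bilinears(3)])

lemma L_closed: "a \<in> A \<Longrightarrow> L a \<in> A"
proof -
  assume "a \<in> A"
  then obtain n :: nat and x y where a: "decomp {..<n} x y a" by (rule decomp_exists)
  then show "L a \<in> A"
    unfolding L_decomp[OF a] using decompD(2)[OF a] subA
    by (intro complex_vector.subspace_sum complex_vector.subspace_scale)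
qed

lemma L_star:
  assumes "a \<in> A"
  shows "L (star a) = star (L a)"
proof -
  obtain n :: nat and x y where a: "decomp {..<n} x y a" using assms by (rule decomp_exists)
  have "\<phi> (star (y i)) = cnj (\<phi> (y i))" if "i < n" for i
    using gen decompD(3)[OF a] that by (auto simp: generating_functional_def)
  then show ?thesis
    unfolding L_decomp[OF a] L_decomp[OF decomp_star[OF a]] by (simp add: star_sum star_scaleC)
qed

text \<open>For a coefficient b, invariance of \<open>h\<close> and cancellation of \<open>u\<close>
  give strong invariance: the sum of h(c_1 b) c_2 equals that of h(c b_1) S(b_2). Applying \<phi>,
  which is unchanged by \<open>S\<close>, yields the claim.\<close>

lemma h_L_symmetric:
  assumes c: "c \<in> A" and b: "b \<in> A"
  shows "h (L c * b) = h (c * L b)"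
  using b
proof (induction b rule: A_induct)
  case subspace
  have "0 \<in> A" using subA by (rule complex_vector.subspace_0)
  then show ?case
    unfolding complex_vector.subspace_def
    by (auto simp: clinear_onD[OF L_linear] clinear_on_zero[OF L_linear] distrib_left scaleC_mult_right
        clinear_onD[OF linear(5)] complex_vector.subspace_add[OF subA] complex_vector.subspace_scale[OF subA])
next
  case (coefficient n u k m)
  obtain r :: nat and x y where d: "decomp {..<r} x y c" using c by (rule decomp_exists)
  note u = corepD[OF coefficient(1)]
  have inv: "(\<Sum>l<n. (\<Sum>i<r. h (x i * u k l) *\<^sub>C y i) * u l j) = h (c * u k j) *\<^sub>C 1" if "j < n" for j
  proof -
    have "(\<Sum>l<n. (\<Sum>i<r. h (x i * u k l) *\<^sub>C y i) * u l j) = (\<Sum>l<n. \<Sum>i<r. h (x i * u k l) *\<^sub>C (y i * u l j))"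
      by (simp add: sum_distrib_right scaleC_mult_left)
    also have "\<dots> = (\<Sum>i<r. \<Sum>l<n. h (x i * u k l) *\<^sub>C (y i * u l j))" by (rule sum.swap)
    also have "\<dots> = h (c * u k j) *\<^sub>C 1"
      using haar_decomp[OF decomp_mult[OF d u(2)[OF coefficient(2) that]]]
      by (simp add: sum.cartesian_product split_def)
    finally show ?thesis .
  qed
  \<comment> \<open>Strong invariance: \<open>inv\<close> determines the partial integrals
    multiplied by \<open>u\<close>, and \<open>corep_cancel\<close> removes \<open>u\<close>. The
    adjoint coefficients on the right are antipodes.\<close>
  have "(\<Sum>i<r. h (x i * u k m) *\<^sub>C y i) = (\<Sum>j<n. h (c * u k j) *\<^sub>C star (u m j))"
    using corep_cancel[OF coefficient(1,3), of "\<lambda>l. \<Sum>i<r. h (x i * u k l) *\<^sub>C y i"]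
    by (simp add: inv scaleC_mult_left)
  then have "\<phi> (\<Sum>i<r. h (x i * u k m) *\<^sub>C y i) = \<phi> (\<Sum>j<n. h (c * u k j) *\<^sub>C star (u m j))" by simp
  then have *: "(\<Sum>i<r. h (x i * u k m) * \<phi> (y i)) = (\<Sum>j<n. h (c * u k j) * \<phi> (star (u m j)))"
    using decompD(3)[OF d] u(1)[OF coefficient(3)] subalgebra(3)
      \<phi>_sum[of "{..<r}" y "\<lambda>i. h (x i * u k m)"] \<phi>_sum[of "{..<n}" "\<lambda>j. star (u m j)" "\<lambda>j. h (c * u k j)"]
    by simp
  \<comment> \<open>This is the one place where GNS-symmetry enters.\<close>
  have "\<phi> (star (u m j)) = \<phi> (u j m)" if "j < n" for j
    using symm S_corep[OF coefficient(1) that coefficient(3)] u(1)[OF that coefficient(3)]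
    by (metis gns_symmetric_def)
  then have "(\<Sum>j<n. h (c * u k j) * \<phi> (star (u m j))) = (\<Sum>j<n. \<phi> (u j m) * h (c * u k j))"
    by (simp add: mult.commute)
  also have "\<dots> = h (c * L (u k m))"
    unfolding L_decomp[OF u(2)[OF coefficient(2,3)]]
    by (simp add: sum_distrib_left scaleC_mult_right h_sum)
  finally show ?case using *
    unfolding L_decomp[OF d] by (simp add: sum_distrib_right scaleC_mult_left h_sum mult.commute)
qed

lemma \<Lambda>_props:
  "bounded_clinear (\<Lambda> a)" "\<Lambda> 1 v = v" "\<Lambda> (a * b) v = \<Lambda> a (\<Lambda> b v)"
  "cinner v (\<Lambda> (star a) w) = cinner (\<Lambda> a v) w" "h a = cinner \<xi> (\<Lambda> a \<xi>)"
  using gns by (auto simp: gns_triple_def star_representation_def)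

lemma \<pi>_props:
  "a \<in> A \<Longrightarrow> bounded_clinear (\<pi> a)" "\<pi> 1 v = v" "a \<in> A \<Longrightarrow> b \<in> A \<Longrightarrow> \<pi> (a * b) v = \<pi> a (\<pi> b v)"
  "a \<in> A \<Longrightarrow> cinner v (\<pi> (star a) w) = cinner (\<pi> a v) w"
  using schuermann by (auto simp: schuermann_triple_def star_representation_def)

lemma cinner_\<Lambda>: "cinner (\<Lambda> a \<xi>) (\<Lambda> b \<xi>) = h (star a * b)"
  by (simp add: \<Lambda>_props(5,3)) (simp add: \<Lambda>_props(4))

lemma cocycle: "a \<in> A \<Longrightarrow> b \<in> A \<Longrightarrow> \<eta> (a * b) = \<pi> a (\<eta> b) + \<epsilon> b *\<^sub>C \<eta> a"
  using schuermann by (auto simp: schuermann_triple_def)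

text \<open>The Schuermann identity holds on the kernel of the counit only; subtracting multiples of
  1 moves \<open>a\<close> and \<open>b\<close> there without changing \<eta>, since \<eta>(1) =
  0.\<close>

lemma cinner_\<eta>:
  assumes a: "a \<in> A" and b: "b \<in> A"
  shows "cinner (\<eta> a) (\<eta> b) = \<phi> (star a * b) - cnj (\<epsilon> a) * \<phi> b - \<epsilon> b * cnj (\<phi> a)"
proof -
  note sub = complex_vector.subspace_diff[OF subA] complex_vector.subspace_scale[OF subA]
  have \<eta>1: "\<eta> 1 = 0" using cocycle[of 1 1] subalgebra(2) by (simp add: \<pi>_props \<epsilon>_props scaleC_one)
  have \<phi>1: "\<phi> 1 = 0" and \<phi>s: "\<phi> (star a) = cnj (\<phi> a)"
    using gen a by (auto simp: generating_functional_def)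
  define a' where "a' = a - \<epsilon> a *\<^sub>C 1"
  define b' where "b' = b - \<epsilon> b *\<^sub>C 1"
  have A': "a' \<in> A" "b' \<in> A" using a b subalgebra(2) sub by (auto simp: a'_def b'_def)
  have \<eta>': "\<eta> a' = \<eta> a" "\<eta> b' = \<eta> b" and \<epsilon>': "\<epsilon> a' = 0" "\<epsilon> b' = 0"
    using a b subalgebra(2) sub unfolding a'_def b'_def
    by (simp_all add: clinear_on_diff[OF linear(4) subA] clinear_on_diff[OF linear(1) subA]
        clinear_onD(2)[OF linear(4)] clinear_onD(2)[OF linear(1)] \<eta>1 \<epsilon>_props scaleC_complex_def)
  have "cinner (\<eta> a) (\<eta> b) = cinner (\<eta> (star (star a'))) (\<eta> b')" by (simp add: \<eta>' star_star)
  also have "\<dots> = \<phi> (star a' * b')"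
    using schuermann A' \<epsilon>' subalgebra(3) \<epsilon>_props(3)[OF A'(1)] by (simp add: schuermann_triple_def)
  also have "star a' * b' = star a * b - cnj (\<epsilon> a) *\<^sub>C b - \<epsilon> b *\<^sub>C (star a - cnj (\<epsilon> a) *\<^sub>C 1)"
    by (simp add: a'_def b'_def star_diff star_scaleC left_diff_distrib right_diff_distrib
        scaleC_mult_left scaleC_mult_right complex_vector.scale_right_diff_distrib scaleC_scaleC mult.commute)
  also have "\<phi> \<dots> = \<phi> (star a * b) - cnj (\<epsilon> a) * \<phi> b - \<epsilon> b * cnj (\<phi> a)"
    using a b subalgebra sub
    by (simp add: clinear_on_diff[OF linear(2) subA] clinear_onD(2)[OF linear(2)] \<phi>1 \<phi>s scaleC_complex_def)
  finally show ?thesis .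
qed

definition dmap :: "'a \<Rightarrow> 't" where
  "dmap = sweedler tens \<Delta> A (\<lambda>x y. htens (\<Lambda> x \<xi>) (\<eta> y))"

lemma dmap_decomp: "decomp I x y a \<Longrightarrow> dmap a = (\<Sum>i\<in>I. htens (\<Lambda> (x i) \<xi>) (\<eta> (y i)))"
  unfolding dmap_def by (rule sweedler_eq[OF bilinears(5)])

lemma dmap_linear: "clinear_on A dmap"
  unfolding dmap_def by (rule sweedler_linear[OF bilinears(5)])

text \<open>Of the three terms of \<open>cinner_\<eta>\<close>, the first collapses by Haar
  invariance to a multiple of \<phi>(1) = 0. The counit collapses the other two to h(star a L b) and
  h(star (L a) b), which agree by symmetry of \<open>L\<close>; hence the factor 2.\<close>

lemma cinner_dmap:
  assumes a: "a \<in> A" and b: "b \<in> A"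
  shows "cinner (dmap a) (dmap b) = - 2 * h (star a * L b)"
proof -
  obtain r :: nat and x y where da: "decomp {..<r} x y a" using a by (rule decomp_exists)
  obtain s :: nat and x' y' where db: "decomp {..<s} x' y' b" using b by (rule decomp_exists)
  note A = decompD(2,3)[OF da] decompD(2,3)[OF db]
  have "cinner (dmap a) (dmap b) =
      (\<Sum>i<r. \<Sum>j<s. h (star (x i) * x' j) * cinner (\<eta> (y i)) (\<eta> (y' j)))"
    by (simp add: dmap_decomp[OF da] dmap_decomp[OF db] cinner_sum_left cinner_sum_right
        cinner_htens[OF htens] cinner_\<Lambda>) (rule sum.swap)
  also have "\<dots> = (\<Sum>i<r. \<Sum>j<s. h (star (x i) * x' j) * \<phi> (star (y i) * y' j)
      - h (star (x i) * x' j) * cnj (\<epsilon> (y i)) * \<phi> (y' j)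
      - h (star (x i) * x' j) * \<epsilon> (y' j) * cnj (\<phi> (y i)))"
    using A by (intro sum.cong) (auto simp: cinner_\<eta> algebra_simps)
  also have "\<dots> = (\<Sum>i<r. \<Sum>j<s. h (star (x i) * x' j) * \<phi> (star (y i) * y' j))
      - (\<Sum>i<r. \<Sum>j<s. h (star (x i) * x' j) * cnj (\<epsilon> (y i)) * \<phi> (y' j))
      - (\<Sum>i<r. \<Sum>j<s. h (star (x i) * x' j) * \<epsilon> (y' j) * cnj (\<phi> (y i)))"
    by (simp add: sum_subtractf)
  also have "(\<Sum>i<r. \<Sum>j<s. h (star (x i) * x' j) * \<phi> (star (y i) * y' j)) = 0"
  proof -
    have "(\<Sum>i<r. \<Sum>j<s. h (star (x i) * x' j) * \<phi> (star (y i) * y' j)) =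
        \<phi> (\<Sum>p\<in>{..<r} \<times> {..<s}. h (star (x (fst p)) * x' (snd p)) *\<^sub>C (star (y (fst p)) * y' (snd p)))"
      using A subalgebra(3,4) by (subst \<phi>_sum) (auto simp: sum.cartesian_product split_def)
    also have "\<dots> = \<phi> (h (star a * b) *\<^sub>C 1)"
      using haar_decomp[OF decomp_mult[OF decomp_star[OF da] db]] by (simp add: split_def)
    also have "\<dots> = 0"
      using gen subalgebra(2) by (simp add: clinear_onD(2)[OF linear(2)] generating_functional_def scaleC_complex_def)
    finally show ?thesis .
  qed
  also have "(\<Sum>i<r. \<Sum>j<s. h (star (x i) * x' j) * cnj (\<epsilon> (y i)) * \<phi> (y' j)) = h (star a * L b)"
  proof -
    have "star a * L b = (\<Sum>i<r. cnj (\<epsilon> (y i)) *\<^sub>C star (x i)) * (\<Sum>j<s. \<phi> (y' j) *\<^sub>C x' j)"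
      by (subst counit_decomp(2)[OF a da, symmetric]) (simp add: star_sum star_scaleC L_decomp[OF db])
    also have "\<dots> = (\<Sum>i<r. cnj (\<epsilon> (y i)) *\<^sub>C (\<Sum>j<s. \<phi> (y' j) *\<^sub>C (star (x i) * x' j)))"
      by (simp add: sum_product scaleC_mult_left scaleC_mult_right scaleC_scaleC mult.commute[of _ "cnj _"]
          complex_vector.scale_sum_right)
    finally show ?thesis by (simp add: h_sum sum_distrib_left mult_ac)
  qed
  also have "(\<Sum>i<r. \<Sum>j<s. h (star (x i) * x' j) * \<epsilon> (y' j) * cnj (\<phi> (y i))) = h (star (L a) * b)"
  proof -
    have "star (L a) * b = (\<Sum>i<r. cnj (\<phi> (y i)) *\<^sub>C star (x i)) * (\<Sum>j<s. \<epsilon> (y' j) *\<^sub>C x' j)"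
      by (subst counit_decomp(2)[OF b db, symmetric]) (simp add: star_sum star_scaleC L_decomp[OF da])
    also have "\<dots> = (\<Sum>i<r. cnj (\<phi> (y i)) *\<^sub>C (\<Sum>j<s. \<epsilon> (y' j) *\<^sub>C (star (x i) * x' j)))"
      by (simp add: sum_product scaleC_mult_left scaleC_mult_right scaleC_scaleC mult.commute[of _ "cnj _"]
          complex_vector.scale_sum_right)
    finally show ?thesis by (simp add: h_sum sum_distrib_left mult_ac)
  qed
  also have "h (star (L a) * b) = h (star a * L b)"
    using h_L_symmetric[OF subalgebra(3)[OF a] b] L_star[OF a] by simp
  finally show ?thesis by simp
qed

end

section \<open>Density of the core and its eigenvectors\<close>

lemma clinear_on_graph_subspace:
  assumes V: "complex_vector.subspace V" and f: "clinear_on V f" and g: "clinear_on V g"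
  shows "complex_vector.subspace {(f a, g a) | a. a \<in> V}"
  unfolding complex_vector.subspace_def
proof (intro conjI ballI allI)
  show "0 \<in> {(f a, g a) | a. a \<in> V}"
    using complex_vector.subspace_0[OF V] clinear_on_zero[OF f] clinear_on_zero[OF g]
    by (force simp: zero_prod_def)
  fix p c assume p: "p \<in> {(f a, g a) | a. a \<in> V}"
  then obtain a where a: "a \<in> V" "p = (f a, g a)" by blast
  then have "c *\<^sub>C p = (f (c *\<^sub>C a), g (c *\<^sub>C a))"
    by (simp add: clinear_onD(2)[OF f] clinear_onD(2)[OF g] scaleC_prod_def)
  then show "c *\<^sub>C p \<in> {(f a, g a) | a. a \<in> V}"
    using complex_vector.subspace_scale[OF V a(1)] by blast
  fix q assume "q \<in> {(f a, g a) | a. a \<in> V}"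
  then obtain b where b: "b \<in> V" "q = (f b, g b)" by blast
  then have "p + q = (f (a + b), g (a + b))"
    using a by (simp add: clinear_onD(1)[OF f] clinear_onD(1)[OF g])
  then show "p + q \<in> {(f a, g a) | a. a \<in> V}"
    using complex_vector.subspace_add[OF V a(1) b(1)] by blast
qed

lemma bounded_clinear_image_sum:
  "bounded_clinear T \<Longrightarrow> T (\<Sum>i\<in>I. f i) = (\<Sum>i\<in>I. T (f i))"
  by (rule clinear_on_sum[of UNIV]) (auto simp: bounded_clinear_def)

lemma total_cinner_eq:
  fixes u v :: "'x::complex_hilbert"
  assumes "closure (complex_vector.span M) = UNIV" "\<And>m. m \<in> M \<Longrightarrow> cinner m u = cinner m v"
  shows "u = v"
proof -
  have "u - v \<in> orth_complement (closure (complex_vector.span M))"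
    unfolding orth_complement_closure_span using assms(2)
    by (simp add: orth_complement_def cinner_diff_right)
  then have "cinner (u - v) (u - v) = 0" unfolding assms(1) by (simp add: orth_complement_def)
  then show ?thesis by simp
qed

context levy_process
begin

text \<open>Density of \<open>A\<close> is in the norm of the algebra; it reaches the Hilbert space
  because \<open>positive_functional_bound\<close> makes the map from a to
  \<open>\<Lambda> a \<xi>\<close> continuous.\<close>

lemma cyclic_dense: "closure ((\<lambda>a. \<Lambda> a \<xi>) ` A) = UNIV"
proof -
  have "\<And>a. h (star a * a) \<in> \<real>\<^sub>\<ge>\<^sub>0" "h 1 = 1" using haar by (auto simp: haar_state_def)
  then have bound: "Re (h (star a * a)) \<le> 4 * (norm a)\<^sup>2" for a
    using positive_functional_bound[OF linear(5)] by blast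
  have "norm (\<Lambda> a \<xi>) \<le> 2 * norm a" for a
  proof -
    have "(norm (\<Lambda> a \<xi>))\<^sup>2 = Re (h (star a * a))"
      using cinner_self[of "\<Lambda> a \<xi>"] by (simp add: cinner_\<Lambda>)
    then have "(norm (\<Lambda> a \<xi>))\<^sup>2 \<le> (2 * norm a)\<^sup>2" using bound[of a] by (simp add: power_mult_distrib)
    then show ?thesis by (rule power2_le_imp_le) simp
  qed
  then have "bounded_clinear (\<lambda>a. \<Lambda> a \<xi>)"
    by (intro bounded_clinearI[where C = 2]) (simp_all add: clinear_onD[OF linear(7)])
  then have "continuous_on UNIV (\<lambda>a. \<Lambda> a \<xi>)"
    by (intro linear_continuous_on bounded_clinear_bounded_linear)
  then have "continuous_on (closure A) (\<lambda>a. \<Lambda> a \<xi>)" by (rule continuous_on_subset) simp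
  then have "(\<lambda>a. \<Lambda> a \<xi>) ` closure A \<subseteq> closure ((\<lambda>a. \<Lambda> a \<xi>) ` A)"
    by (rule image_closure_subset[OF _ closed_closure closure_subset])
  then have range: "{\<Lambda> a \<xi> | a. True} \<subseteq> closure ((\<lambda>a. \<Lambda> a \<xi>) ` A)" unfolding A_dense by fast
  have "closure {\<Lambda> a \<xi> | a. True} = UNIV" using gns unfolding gns_triple_def by blast
  then show ?thesis using closure_minimal[OF range closed_closure] by (simp add: top_le)
qed

text \<open>Faithfulness of \<open>h\<close> is what makes \<open>d\<close> and \<open>H\<close>
  well defined as operators on the core.\<close>

lemma cyclic_injective: "\<Lambda> a \<xi> = 0 \<Longrightarrow> a = 0"
  using cinner_\<Lambda>[of a a] faithful by (simp add: faithful_def)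

lemma L_symmetric:
  assumes "a \<in> A" "b \<in> A"
  shows "cinner (\<Lambda> (L a) \<xi>) (\<Lambda> b \<xi>) = cinner (\<Lambda> a \<xi>) (\<Lambda> (L b) \<xi>)"
  unfolding cinner_\<Lambda> using h_L_symmetric[OF subalgebra(3)[OF assms(1)] assms(2)] L_star[OF assms(1)] by simp

text \<open>Every coefficient lies in a finite-dimensional \<open>L\<close>-invariant subspace, spanned by its row.\<close>

lemma L_diagonal:
  assumes "a \<in> A"
  shows "a \<in> complex_vector.span {a \<in> A. \<exists>\<beta>. L a = \<beta> *\<^sub>C a}"
  using assms
proof (induction a rule: A_induct)
  case subspace
  show ?case
    using complex_vector.subspace_inter[OF subA complex_vector.subspace_span]
    unfolding Int_def .
next
  case (coefficient n u i j)
  note u = corepD[OF coefficient(1)]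
  let ?B = "u i ` {..<n}"
  have BA: "complex_vector.span ?B \<subseteq> A"
    using u(1)[OF coefficient(2)] by (intro complex_vector.span_minimal subA) auto
  have inv: "L x \<in> complex_vector.span ?B" if x: "x \<in> complex_vector.span ?B" for x
  proof -
    obtain c where c: "x = (\<Sum>g\<in>?B. c g *\<^sub>C g)"
      using x by (auto simp: complex_vector.span_finite)
    have B: "g \<in> A" "L g \<in> complex_vector.span ?B" if g: "g \<in> ?B" for g
    proof -
      obtain k where k: "g = u i k" "k < n" using g by blast
      show "g \<in> A" using k u(1)[OF coefficient(2)] by simp
      show "L g \<in> complex_vector.span ?B"
        unfolding k(1) L_decomp[OF u(2)[OF coefficient(2) k(2)]]
        by (intro complex_vector.span_sum complex_vector.span_scale complex_vector.span_base) simp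
    qed
    have "L x = (\<Sum>g\<in>?B. L (c g *\<^sub>C g))"
      unfolding c by (intro clinear_on_sum[OF L_linear subA] complex_vector.subspace_scale[OF subA] B(1))
    also have "\<dots> = (\<Sum>g\<in>?B. c g *\<^sub>C L g)"
      by (intro sum.cong refl clinear_onD(2)[OF L_linear] B(1))
    finally show ?thesis
      by (simp only:) (intro complex_vector.span_sum complex_vector.span_scale B(2))
  qed
  have orbit: "(L ^^ m) (u i j) \<in> complex_vector.span ?B" for m
  proof (induction m)
    case 0
    show ?case using coefficient(3) by (auto intro: complex_vector.span_base)
  next
    case (Suc m)
    from inv[OF this] show ?case by simp
  qed
  have fin: "finite ?B" by simp
  obtain p where p: "p \<noteq> 0" "poly_op L p (u i j) = 0"
    by (rule exists_annihilating_poly[OF fin orbit])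
  show ?case
    by (rule span_eigenvectors_of_symmetric[where J = "\<lambda>a. \<Lambda> a \<xi>", OF subA L_linear L_closed
          linear_\<Lambda> cyclic_injective L_symmetric u(1)[OF coefficient(2,3)] p])
qed

abbreviation "d_core \<equiv> {(\<Lambda> a \<xi>, dmap a) | a. a \<in> A}"
abbreviation "h_core \<equiv> {(\<Lambda> a \<xi>, - \<Lambda> (L a) \<xi>) | a. a \<in> A}"

lemma h_core_linear: "clinear_on A (\<lambda>a. - \<Lambda> (L a) \<xi>)"
  using L_linear L_closed
  by (auto simp: clinear_on_def clinear_onD[OF linear_\<Lambda>])

sublocale form: diagonal_form d_core h_core
proof
  show "complex_vector.subspace d_core"
    by (rule clinear_on_graph_subspace[OF subA linear_\<Lambda> dmap_linear])
  show subH: "complex_vector.subspace h_core"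
    by (rule clinear_on_graph_subspace[OF subA linear_\<Lambda> h_core_linear])
  show "Domain h_core = Domain d_core" by auto
  have dom: "Domain d_core = (\<lambda>a. \<Lambda> a \<xi>) ` A" by auto
  show "closure (Domain d_core) = UNIV" unfolding dom by (rule cyclic_dense)
  show "cinner f g = 2 * cinner x k"
    if x: "(x, f) \<in> d_core" and y: "(y, g) \<in> d_core" and k: "(y, k) \<in> h_core" for x f y g k
  proof -
    obtain a b b' where a: "a \<in> A" "x = \<Lambda> a \<xi>" "f = dmap a" and b: "b \<in> A" "y = \<Lambda> b \<xi>" "g = dmap b"
      and b': "b' \<in> A" "y = \<Lambda> b' \<xi>" "k = - \<Lambda> (L b') \<xi>" using x y k by blast
    \<comment> \<open>The two graphs may present \<open>y\<close> by different elements of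
      \<open>A\<close>; injectivity identifies these.\<close>
    have "\<Lambda> (b - b') \<xi> = 0" using clinear_on_diff[OF linear(7), of b b'] b b' by simp
    from cyclic_injective[OF this] have "b' = b" by simp
    then show ?thesis using a b b' by (simp add: cinner_dmap cinner_minus_right cinner_\<Lambda>)
  qed
  show "Domain d_core \<subseteq> complex_vector.span (\<Union>\<beta>. eigspace h_core \<beta>)"
  proof -
    let ?E = "complex_vector.span (\<Union>\<beta>. eigspace h_core \<beta>)"
    have "complex_vector.span {a \<in> A. \<exists>\<beta>. L a = \<beta> *\<^sub>C a} \<subseteq> {a \<in> A. \<Lambda> a \<xi> \<in> ?E}"
    proof (rule complex_vector.span_minimal)
      show "{a \<in> A. \<exists>\<beta>. L a = \<beta> *\<^sub>C a} \<subseteq> {a \<in> A. \<Lambda> a \<xi> \<in> ?E}"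
      proof clarify
        fix a \<beta> assume a: "a \<in> A" "L a = \<beta> *\<^sub>C a"
        have "(\<Lambda> a \<xi>, - \<Lambda> (L a) \<xi>) \<in> h_core" using a by blast
        then have "\<Lambda> a \<xi> \<in> eigspace h_core (- \<beta>)"
          using a by (simp add: eigspace_def clinear_onD(2)[OF linear_\<Lambda>])
        then show "\<Lambda> a \<xi> \<in> ?E" by (intro complex_vector.span_base) blast
      qed
      show "complex_vector.subspace {a \<in> A. \<Lambda> a \<xi> \<in> ?E}"
        unfolding complex_vector.subspace_def
      proof (intro conjI ballI allI)
        show "0 \<in> {a \<in> A. \<Lambda> a \<xi> \<in> ?E}"
          using clinear_on_zero[OF linear_\<Lambda>] complex_vector.subspace_0[OF subA]
          by (simp add: complex_vector.span_zero)
        fix a c assume a: "a \<in> {a \<in> A. \<Lambda> a \<xi> \<in> ?E}"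
        then show "c *\<^sub>C a \<in> {a \<in> A. \<Lambda> a \<xi> \<in> ?E}"
          by (simp add: clinear_onD[OF linear_\<Lambda>] complex_vector.span_scale complex_vector.subspace_scale[OF subA])
        fix b assume "b \<in> {a \<in> A. \<Lambda> a \<xi> \<in> ?E}"
        with a show "a + b \<in> {a \<in> A. \<Lambda> a \<xi> \<in> ?E}"
          by (simp add: clinear_onD[OF linear_\<Lambda>] complex_vector.span_add complex_vector.subspace_add[OF subA])
      qed
    qed
    then show ?thesis using L_diagonal unfolding dom by blast
  qed
qed

subsection \<open>The representation and the commutators\<close>

lemma d_op_eq: "d_op tens \<Delta> A htens \<eta> \<Lambda> \<xi> = form.d"
  by (simp add: d_op_def dmap_def)

lemma H_op_eq: "H_op tens \<Delta> A \<phi> \<Lambda> \<xi> = form.H"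
  by (simp add: H_op_def)

abbreviation "rho \<equiv> rho_L tens \<Delta> A htens \<pi> \<Lambda> \<xi>"

text \<open>This makes an operator prescribed only on tensors with a cyclic left factor unique, as
  the description in \<open>rho_L\<close> requires.\<close>

lemma htens_cyclic_total:
  "closure (complex_vector.span {htens (\<Lambda> b \<xi>) v | b v. b \<in> A}) = UNIV"
proof -
  let ?C = "closure (complex_vector.span {htens (\<Lambda> b \<xi>) v | b v. b \<in> A})"
  have "htens l v \<in> ?C" for l v
  proof -
    have "closed ((\<lambda>l. htens l v) -` ?C)"
      by (intro closed_vimage closed_closure linear_continuous_on bounded_clinear_bounded_linear
          bounded_clinear_htens_left[OF htens])
    moreover have "(\<lambda>a. \<Lambda> a \<xi>) ` A \<subseteq> (\<lambda>l. htens l v) -` ?C"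
    proof clarify
      fix b assume "b \<in> A"
      then have "htens (\<Lambda> b \<xi>) v \<in> complex_vector.span {htens (\<Lambda> b \<xi>) v | b v. b \<in> A}"
        by (intro complex_vector.span_base) blast
      then show "\<Lambda> b \<xi> \<in> (\<lambda>l. htens l v) -` ?C"
        using closure_subset by blast
    qed
    ultimately have "closure ((\<lambda>a. \<Lambda> a \<xi>) ` A) \<subseteq> (\<lambda>l. htens l v) -` ?C"
      by (intro closure_minimal)
    then show ?thesis unfolding cyclic_dense by auto
  qed
  then have "complex_vector.span {htens l v | l v. True} \<subseteq> ?C"
    by (intro complex_vector.span_minimal closure_csubspace complex_vector.subspace_span) auto
  from closure_mono[OF this] show ?thesis unfolding htens_total[OF htens] by auto
qed

text \<open>The operator is a finite sum of tensor products of \<open>\<Lambda> (x i)\<close> and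
  \<open>\<pi> (y i)\<close> over one decomposition of \<open>a\<close>, hence bounded.\<close>

lemma rho_exists:
  assumes a: "a \<in> A"
  obtains T where "bounded_clinear T"
    "\<And>l v. T (htens l v) = sweedler tens \<Delta> A (\<lambda>x y. htens (\<Lambda> x l) (\<pi> y v)) a"
proof -
  obtain n :: nat and x y where d: "decomp {..<n} x y a" using a by (rule decomp_exists)
  have "\<exists>T. bounded_clinear T \<and> (\<forall>l v. T (htens l v) = htens (\<Lambda> (x i) l) (\<pi> (y i) v))" if i: "i < n" for i
  proof -
    have "y i \<in> A" using decompD(3)[OF d] i by simp
    then show ?thesis by (rule_tac htens_operator[OF htens \<Lambda>_props(1)[of "x i"] \<pi>_props(1)[of "y i"]]) blast+
  qed
  then obtain T where T: "\<And>i. i < n \<Longrightarrow> bounded_clinear (T i)"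
    "\<And>i l v. i < n \<Longrightarrow> T i (htens l v) = htens (\<Lambda> (x i) l) (\<pi> (y i) v)" by metis
  show ?thesis
  proof (rule that[of "\<lambda>z. \<Sum>i<n. T i z"])
    show "bounded_clinear (\<lambda>z. \<Sum>i<n. T i z)" using T(1) by (intro bounded_clinear_sum) auto
    show "(\<Sum>i<n. T i (htens l v)) = sweedler tens \<Delta> A (\<lambda>x y. htens (\<Lambda> x l) (\<pi> y v)) a" for l v
      using T(2) by (simp add: sweedler_eq[OF bilinears(6) d])
  qed
qed

lemma rho:
  assumes a: "a \<in> A"
  shows "bounded_clinear (rho a)"
    "rho a (htens l v) = sweedler tens \<Delta> A (\<lambda>x y. htens (\<Lambda> x l) (\<pi> y v)) a"
proof -
  obtain T where T: "bounded_clinear T"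
    "\<And>l v. T (htens l v) = sweedler tens \<Delta> A (\<lambda>x y. htens (\<Lambda> x l) (\<pi> y v)) a"
    by (rule rho_exists[OF a]) metis
  have "rho a = T"
    unfolding rho_L_def
  proof (rule the_equality)
    show "bounded_clinear T \<and> (\<forall>b\<in>A. \<forall>v. T (htens (\<Lambda> b \<xi>) v) =
        sweedler tens \<Delta> A (\<lambda>x y. htens (\<Lambda> (x * b) \<xi>) (\<pi> y v)) a)"
      using T by (simp add: \<Lambda>_props(3))
    fix T' assume T': "bounded_clinear T' \<and> (\<forall>b\<in>A. \<forall>v. T' (htens (\<Lambda> b \<xi>) v) =
        sweedler tens \<Delta> A (\<lambda>x y. htens (\<Lambda> (x * b) \<xi>) (\<pi> y v)) a)"
    show "T' = T"
      using T' T by (intro bounded_clinear_eq_on_total[OF _ _ htens_cyclic_total]) (auto simp: \<Lambda>_props(3))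
  qed
  then show "bounded_clinear (rho a)"
    "rho a (htens l v) = sweedler tens \<Delta> A (\<lambda>x y. htens (\<Lambda> x l) (\<pi> y v)) a"
    using T by auto
qed

lemma rho_decomp:
  assumes a: "a \<in> A" and d: "decomp I x y a"
  shows "rho a (htens l v) = (\<Sum>i\<in>I. htens (\<Lambda> (x i) l) (\<pi> (y i) v))"
  by (simp add: rho(2)[OF a] sweedler_eq[OF bilinears(6) d])

lemma bounded_clinear_eq_htens:
  assumes "bounded_clinear f" "bounded_clinear g" "\<And>l v. f (htens l v) = g (htens l v)"
  shows "f = g"
  using assms by (intro bounded_clinear_eq_on_total[OF _ _ htens_total[OF htens]]) auto

lemma rho_linear: "clinear_on A (\<lambda>a. rho a z)"
proof -
  have lin: "clinear_on A (\<lambda>a. rho a (htens l v))" for l v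
    using sweedler_linear[OF bilinears(6)[of l v]] subA
    by (auto simp: clinear_on_def rho(2) complex_vector.subspace_add complex_vector.subspace_scale)
  show ?thesis
    unfolding clinear_on_def
  proof (intro conjI ballI allI)
    fix a b assume ab: "a \<in> A" "b \<in> A"
    then have "a + b \<in> A" by (intro complex_vector.subspace_add[OF subA])
    have "bounded_clinear (\<lambda>z. rho a z + rho b z)"
      \<comment> \<open>The sum of two operators is read as a sum over the two truth values.\<close>
      using bounded_clinear_sum[of "{True, False}" "\<lambda>i. if i then rho a else rho b"] rho(1) ab by simp
    then have "rho (a + b) = (\<lambda>z. rho a z + rho b z)"
      using clinear_onD(1)[OF lin ab] by (intro bounded_clinear_eq_htens rho(1) \<open>a + b \<in> A\<close>) auto
    then show "rho (a + b) z = rho a z + rho b z" by (rule fun_cong)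
  next
    fix a c assume a: "a \<in> A"
    then have "c *\<^sub>C a \<in> A" by (intro complex_vector.subspace_scale[OF subA])
    \<comment> \<open>The scalar is put inside the argument so that the operator is a composition of
      bounded ones.\<close>
    have "bounded_clinear (\<lambda>z. rho a (c *\<^sub>C z))"
      by (intro bounded_clinear_compose[OF rho(1)[OF a]] bounded_clinearI[where C = "cmod c"])
        (simp_all add: scaleC_add_right scaleC_scaleC mult.commute norm_scaleC)
    then have "rho (c *\<^sub>C a) = (\<lambda>z. rho a (c *\<^sub>C z))"
      using clinear_onD(2)[OF lin a]
      by (intro bounded_clinear_eq_htens rho(1) \<open>c *\<^sub>C a \<in> A\<close>)
        (auto simp: bounded_clinear_scaleC[OF rho(1)[OF a]])
    then show "rho (c *\<^sub>C a) z = c *\<^sub>C rho a z"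
      by (simp add: bounded_clinear_scaleC[OF rho(1)[OF a]])
  qed
qed

lemma rho_one: "rho 1 z = z"
proof -
  have "rho 1 = (\<lambda>z. z)"
    by (intro bounded_clinear_eq_htens rho(1) subalgebra bounded_clinearI[where C = 1])
      (simp_all add: rho_decomp[OF subalgebra(2) decomp_one] \<Lambda>_props \<pi>_props)
  then show ?thesis by simp
qed

lemma rho_mult:
  assumes a: "a \<in> A" and b: "b \<in> A"
  shows "rho (a * b) z = rho a (rho b z)"
proof -
  obtain n :: nat and x y where da: "decomp {..<n} x y a" using a by (rule decomp_exists)
  obtain m :: nat and x' y' where db: "decomp {..<m} x' y' b" using b by (rule decomp_exists)
  have "rho (a * b) (htens l v) = rho a (rho b (htens l v))" for l v
  proof -
    have "rho a (rho b (htens l v)) = (\<Sum>j<m. rho a (htens (\<Lambda> (x' j) l) (\<pi> (y' j) v)))"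
      unfolding rho_decomp[OF b db] by (rule bounded_clinear_image_sum[OF rho(1)[OF a]])
    also have "\<dots> = (\<Sum>j<m. \<Sum>i<n. htens (\<Lambda> (x i * x' j) l) (\<pi> (y i * y' j) v))"
      using decompD(3)[OF da] decompD(3)[OF db]
      by (simp add: rho_decomp[OF a da] \<Lambda>_props(3) \<pi>_props(3))
    also have "\<dots> = (\<Sum>i<n. \<Sum>j<m. htens (\<Lambda> (x i * x' j) l) (\<pi> (y i * y' j) v))" by (rule sum.swap)
    also have "\<dots> = rho (a * b) (htens l v)"
      by (simp add: rho_decomp[OF subalgebra(4)[OF a b] decomp_mult[OF da db]] sum.cartesian_product split_def)
    finally show ?thesis by simp
  qed
  then have "rho (a * b) = (\<lambda>z. rho a (rho b z))"
    by (intro bounded_clinear_eq_htens bounded_clinear_compose[OF rho(1)[OF a] rho(1)[OF b]]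
        rho(1)[OF subalgebra(4)[OF a b]])
  then show ?thesis by simp
qed

text \<open>The operator of \<open>star a\<close> and the adjoint of the operator of
  \<open>a\<close> are both bounded, so comparing them on elementary tensors, where the inner
  product factors, is enough.\<close>

lemma rho_star:
  assumes a: "a \<in> A"
  shows "cinner z (rho (star a) w) = cinner (rho a z) w"
proof -
  obtain n :: nat and x y where d: "decomp {..<n} x y a" using a by (rule decomp_exists)
  obtain N where N: "bounded_clinear N" "\<And>z w. cinner w (rho a z) = cinner (N w) z"
    by (rule bounded_adjoint[OF rho(1)[OF a]]) metis
  have "rho (star a) (htens l v) = N (htens l v)" for l v
  proof (rule total_cinner_eq[OF htens_total[OF htens]], clarify)
    fix l' v'
    have "cinner (htens l' v') (rho (star a) (htens l v)) = cinner (rho a (htens l' v')) (htens l v)"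
      using decompD(3)[OF d]
      by (simp add: rho_decomp[OF a d] rho_decomp[OF subalgebra(3)[OF a] decomp_star[OF d]]
          cinner_sum_right cinner_sum_left cinner_htens[OF htens] \<Lambda>_props(4) \<pi>_props(4))
    also have "\<dots> = cnj (cinner (htens l v) (rho a (htens l' v')))" by (rule cinner_cnj)
    also have "\<dots> = cinner (htens l' v') (N (htens l v))" by (simp add: N(2) flip: cinner_cnj)
    finally show "cinner (htens l' v') (rho (star a) (htens l v)) = cinner (htens l' v') (N (htens l v))" .
  qed
  then have eq: "rho (star a) = N"
    by (intro bounded_clinear_eq_htens rho(1) subalgebra a N(1))
  have "cinner (rho a z) w = cnj (cinner w (rho a z))" by (rule cinner_cnj)
  also have "\<dots> = cinner z (N w)" by (simp add: N(2) flip: cinner_cnj)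
  finally show ?thesis by (simp add: eq)
qed

text \<open>The cocycle identity splits \<eta>(a_2 b_2); in the part with \<epsilon>(b_2) the counit
  contracts b_1 back to b. The remainder \<open>M\<close> depends on \<open>a\<close> alone and is a
  finite sum of bounded operators.\<close>

lemma dmap_mult:
  assumes a: "a \<in> A"
  obtains M where "bounded_clinear M"
    "\<And>b. b \<in> A \<Longrightarrow> dmap (a * b) = rho a (dmap b) + M (\<Lambda> b \<xi>)"
proof -
  obtain n :: nat and x y where da: "decomp {..<n} x y a" using a by (rule decomp_exists)
  note A = decompD(2,3)[OF da]
  define M where "M l = (\<Sum>i<n. htens (\<Lambda> (x i) l) (\<eta> (y i)))" for l
  have "bounded_clinear M"
    unfolding M_def
    by (rule bounded_clinear_sum)
      (rule bounded_clinear_compose[OF bounded_clinear_htens_left[OF htens] \<Lambda>_props(1)])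
  moreover have "dmap (a * b) = rho a (dmap b) + M (\<Lambda> b \<xi>)" if b: "b \<in> A" for b
  proof -
    obtain m :: nat and x' y' where db: "decomp {..<m} x' y' b" using b by (rule decomp_exists)
    note B = decompD(2,3)[OF db]
    have "dmap (a * b) = (\<Sum>i<n. \<Sum>j<m. htens (\<Lambda> (x i * x' j) \<xi>) (\<eta> (y i * y' j)))"
      by (simp add: dmap_decomp[OF decomp_mult[OF da db]] sum.cartesian_product split_def)
    also have "\<dots> = (\<Sum>i<n. \<Sum>j<m. htens (\<Lambda> (x i) (\<Lambda> (x' j) \<xi>)) (\<pi> (y i) (\<eta> (y' j)))
        + htens (\<Lambda> (x i) (\<epsilon> (y' j) *\<^sub>C \<Lambda> (x' j) \<xi>)) (\<eta> (y i)))"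
      using A B
      by (intro sum.cong refl)
        (simp add: cocycle \<Lambda>_props(3) htens_linear[OF htens] bounded_clinear_scaleC[OF \<Lambda>_props(1)])
    also have "\<dots> = (\<Sum>i<n. \<Sum>j<m. htens (\<Lambda> (x i) (\<Lambda> (x' j) \<xi>)) (\<pi> (y i) (\<eta> (y' j))))
        + (\<Sum>i<n. \<Sum>j<m. htens (\<Lambda> (x i) (\<epsilon> (y' j) *\<^sub>C \<Lambda> (x' j) \<xi>)) (\<eta> (y i)))"
      by (simp add: sum.distrib)
    also have "(\<Sum>i<n. \<Sum>j<m. htens (\<Lambda> (x i) (\<Lambda> (x' j) \<xi>)) (\<pi> (y i) (\<eta> (y' j)))) = rho a (dmap b)"
    proof -
      have "rho a (dmap b) = (\<Sum>j<m. rho a (htens (\<Lambda> (x' j) \<xi>) (\<eta> (y' j))))"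
        unfolding dmap_decomp[OF db] by (rule bounded_clinear_image_sum[OF rho(1)[OF a]])
      also have "\<dots> = (\<Sum>j<m. \<Sum>i<n. htens (\<Lambda> (x i) (\<Lambda> (x' j) \<xi>)) (\<pi> (y i) (\<eta> (y' j))))"
        by (simp add: rho_decomp[OF a da])
      also have "\<dots> = (\<Sum>i<n. \<Sum>j<m. htens (\<Lambda> (x i) (\<Lambda> (x' j) \<xi>)) (\<pi> (y i) (\<eta> (y' j))))"
        by (rule sum.swap)
      finally show ?thesis by simp
    qed
    also have "(\<Sum>i<n. \<Sum>j<m. htens (\<Lambda> (x i) (\<epsilon> (y' j) *\<^sub>C \<Lambda> (x' j) \<xi>)) (\<eta> (y i))) = M (\<Lambda> b \<xi>)"
    proof -
      have "\<Lambda> b \<xi> = \<Lambda> (\<Sum>j<m. \<epsilon> (y' j) *\<^sub>C x' j) \<xi>" by (simp add: counit_decomp(2)[OF b db])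
      also have "\<dots> = (\<Sum>j<m. \<Lambda> (\<epsilon> (y' j) *\<^sub>C x' j) \<xi>)"
        by (rule clinear_on_sum[OF linear(7)]) auto
      finally have "\<Lambda> b \<xi> = (\<Sum>j<m. \<epsilon> (y' j) *\<^sub>C \<Lambda> (x' j) \<xi>)" by (simp add: clinear_onD(2)[OF linear(7)])
      moreover have "\<Lambda> (x i) (\<Sum>j<m. \<epsilon> (y' j) *\<^sub>C \<Lambda> (x' j) \<xi>) = (\<Sum>j<m. \<Lambda> (x i) (\<epsilon> (y' j) *\<^sub>C \<Lambda> (x' j) \<xi>))" for i
        by (rule bounded_clinear_image_sum[OF \<Lambda>_props(1)])
      ultimately show ?thesis by (simp add: M_def htens_sum[OF htens])
    qed
    finally show ?thesis .
  qed
  ultimately show ?thesis using that by blast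
qed

text \<open>The rule on the core says that a bounded map on pairs sends the core into the graph of
  \<open>d\<close>; the preimage of a closed graph is closed, so the rule holds on the
  closure.\<close>

lemma d_leibniz:
  assumes a: "a \<in> A"
  shows "\<exists>M. bounded_clinear M \<and>
    (\<forall>w f. (w, f) \<in> form.d \<longrightarrow> (\<Lambda> a w, rho a f + M w) \<in> form.d)"
proof -
  obtain M where M: "bounded_clinear M" "\<And>b. b \<in> A \<Longrightarrow> dmap (a * b) = rho a (dmap b) + M (\<Lambda> b \<xi>)"
    by (rule dmap_mult[OF a]) metis
  let ?G = "\<lambda>q. (\<Lambda> a (fst q), rho a (snd q) + M (fst q))"
  note bl = bounded_linear_compose[OF bounded_clinear_bounded_linear]
  have "bounded_linear ?G"
    by (intro bounded_linear_Pair bounded_linear_add bl[OF \<Lambda>_props(1) bounded_linear_fst]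
        bl[OF rho(1)[OF a] bounded_linear_snd] bl[OF M(1) bounded_linear_fst])
  then have "closed (?G -` form.d)" by (intro closed_vimage closed_closure linear_continuous_on)
  moreover have "d_core \<subseteq> ?G -` form.d"
  proof clarify
    fix b assume b: "b \<in> A"
    have "(\<Lambda> (a * b) \<xi>, dmap (a * b)) \<in> d_core" using subalgebra(4)[OF a b] by blast
    from subsetD[OF closure_subset this] show "(\<Lambda> b \<xi>, dmap b) \<in> ?G -` form.d"
      unfolding M(2)[OF b] \<Lambda>_props(3) by (intro vimageI2) simp
  qed
  ultimately have sub: "form.d \<subseteq> ?G -` form.d" by (intro closure_minimal)
  have "(\<Lambda> a w, rho a f + M w) \<in> form.d" if "(w, f) \<in> form.d" for w f
    using vimageD[OF subsetD[OF sub that]] unfolding fst_conv snd_conv .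
  then show ?thesis using M(1) by (intro exI[of _ M]) simp
qed

text \<open>The entry with \<open>d\<close> is the Leibniz rule itself. For its adjoint, the rule
  for \<open>star a\<close> is paired with a vector of the adjoint's domain and moved across the
  inner product, which also shows that \<open>rho a\<close> preserves this domain.\<close>

lemma commutator_bounded:
  assumes a: "a \<in> A"
  shows "bounded_commutator form.D (pi_L tens \<Delta> A htens \<pi> \<Lambda> \<xi> a)"
proof -
  from d_leibniz[OF a] obtain M where "bounded_clinear M \<and>
    (\<forall>w f. (w, f) \<in> form.d \<longrightarrow> (\<Lambda> a w, rho a f + M w) \<in> form.d)" ..
  note M = conjunct1[OF this] conjunct2[OF this, rule_format]
  from d_leibniz[OF subalgebra(3)[OF a]] obtain M' where "bounded_clinear M' \<and>
    (\<forall>w f. (w, f) \<in> form.d \<longrightarrow> (\<Lambda> (star a) w, rho (star a) f + M' w) \<in> form.d)" ..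
  note M' = conjunct1[OF this] conjunct2[OF this, rule_format]
  obtain N where N: "bounded_clinear N" "\<And>w v. cinner v (M' w) = cinner (N v) w"
    by (rule bounded_adjoint[OF M'(1)]) metis
  have adj: "(rho a v, \<Lambda> a g - N v) \<in> op_adjoint form.d" if vg: "(v, g) \<in> op_adjoint form.d" for v g
    unfolding op_adjoint_iff
  proof (intro allI impI)
    fix w f assume wf: "(w, f) \<in> form.d"
    have "cinner v (rho (star a) f + M' w) = cinner g (\<Lambda> (star a) w)"
      by (rule op_adjointD[OF vg M'(2)[OF wf]])
    then show "cinner (rho a v) f = cinner (\<Lambda> a g - N v) w"
      by (simp only: cinner_add_right cinner_diff_left rho_star[OF a] \<Lambda>_props(4) N(2) eq_diff_eq)
  qed
  \<comment> \<open>The components are crossed because \<open>D\<close> is off-diagonal: the first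
    output depends on the second input, and conversely.\<close>
  define C where "C q = (M (snd q), - N (fst q))" for q
  have "bounded_clinear C"
  proof -
    have "bounded_linear C"
      unfolding C_def
      by (intro bounded_linear_Pair bounded_linear_minus
          bounded_linear_compose[OF bounded_clinear_bounded_linear[OF M(1)] bounded_linear_snd]
          bounded_linear_compose[OF bounded_clinear_bounded_linear[OF N(1)] bounded_linear_fst])
    then show ?thesis
      by (simp add: bounded_clinear_def clinear_on_def C_def bounded_clinear_add[OF M(1)]
          bounded_clinear_add[OF N(1)] scaleC_prod_def bounded_clinear_scaleC[OF M(1)]
          bounded_clinear_scaleC[OF N(1)])
  qed
  moreover have "\<forall>(x, y)\<in>form.D. (pi_L tens \<Delta> A htens \<pi> \<Lambda> \<xi> a x, pi_L tens \<Delta> A htens \<pi> \<Lambda> \<xi> a y + C x) \<in> form.D"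
    proof clarify
      fix v w v' w' assume "((v, w), (v', w')) \<in> form.D"
      then have "(w, v') \<in> form.d" "(v, w') \<in> op_adjoint form.d" unfolding dirac_op_def by blast+
      from M(2)[OF this(1)] adj[OF this(2)]
      show "(pi_L tens \<Delta> A htens \<pi> \<Lambda> \<xi> a (v, w), pi_L tens \<Delta> A htens \<pi> \<Lambda> \<xi> a (v', w') + C (v, w)) \<in> form.D"
        unfolding dirac_op_def pi_L_def C_def map_prod_simp add_Pair fst_conv snd_conv
          mem_Collect_eq prod.case by simp
    qed
  ultimately show ?thesis unfolding bounded_commutator_def by blast
qed

lemma pi_L_star_representation: "star_representation A (pi_L tens \<Delta> A htens \<pi> \<Lambda> \<xi>)"
  unfolding star_representation_def
proof (intro conjI ballI allI)
  fix a assume a: "a \<in> A"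
  have "bounded_linear (\<lambda>q. (rho a (fst q), \<Lambda> a (snd q)))"
    by (intro bounded_linear_Pair
        bounded_linear_compose[OF bounded_clinear_bounded_linear[OF rho(1)[OF a]] bounded_linear_fst]
        bounded_linear_compose[OF bounded_clinear_bounded_linear[OF \<Lambda>_props(1)] bounded_linear_snd])
  then show "bounded_clinear (pi_L tens \<Delta> A htens \<pi> \<Lambda> \<xi> a)"
    by (simp add: bounded_clinear_def clinear_on_def pi_L_def map_prod_def split_def scaleC_prod_def
        bounded_clinear_add[OF rho(1)[OF a]] bounded_clinear_scaleC[OF rho(1)[OF a]]
        bounded_clinear_add[OF \<Lambda>_props(1)] bounded_clinear_scaleC[OF \<Lambda>_props(1)])
  fix v w
  show "cinner v (pi_L tens \<Delta> A htens \<pi> \<Lambda> \<xi> (star a) w) = cinner (pi_L tens \<Delta> A htens \<pi> \<Lambda> \<xi> a v) w"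
    by (simp add: pi_L_def map_prod_def split_def cinner_prod_def rho_star[OF a] \<Lambda>_props(4))
  fix b assume b: "b \<in> A"
  show "pi_L tens \<Delta> A htens \<pi> \<Lambda> \<xi> (a * b) v = pi_L tens \<Delta> A htens \<pi> \<Lambda> \<xi> a (pi_L tens \<Delta> A htens \<pi> \<Lambda> \<xi> b v)"
    by (simp add: pi_L_def map_prod_def split_def rho_mult[OF a b] \<Lambda>_props(3))
next
  fix v
  show "pi_L tens \<Delta> A htens \<pi> \<Lambda> \<xi> 1 v = v"
    by (simp add: pi_L_def map_prod_def split_def rho_one \<Lambda>_props(2))
  show "clinear_on A (\<lambda>a. pi_L tens \<Delta> A htens \<pi> \<Lambda> \<xi> a v)"
    using rho_linear[of "fst v"] linear_\<Lambda>[of "snd v"]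
    by (simp add: clinear_on_def pi_L_def map_prod_def split_def scaleC_prod_def)
qed

theorem spectral_triple:
  assumes disc: "discrete_spectrum_on UNIV (H_op tens \<Delta> A \<phi> \<Lambda> \<xi>)"
  shows "kernel_degenerate_spectral_triple A
    (dirac_op (d_op tens \<Delta> A htens \<eta> \<Lambda> \<xi>)) (pi_L tens \<Delta> A htens \<pi> \<Lambda> \<xi>)"
  unfolding kernel_degenerate_spectral_triple_def d_op_eq Let_def
  using pi_L_star_representation form.self_adjoint_D commutator_bounded
    form.discrete_spectrum_dirac[OF disc[unfolded H_op_eq]]
  by blast

end

theorem theorem8p4:
  fixes tens :: "'a::cstar_algebra \<Rightarrow> 'a \<Rightarrow> 'b::cstar_algebra"
    and tensL :: "'b \<Rightarrow> 'a \<Rightarrow> 'c::cstar_algebra"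
    and tensR :: "'a \<Rightarrow> 'b \<Rightarrow> 'c"
    and \<Delta> :: "'a \<Rightarrow> 'b"
    and h \<epsilon> \<phi> :: "'a \<Rightarrow> complex"
    and S :: "'a \<Rightarrow> 'a"
    and A :: "'a set"
    and \<Lambda> :: "'a \<Rightarrow> 'l::complex_hilbert \<Rightarrow> 'l" and \<xi> :: 'l
    and \<pi> :: "'a \<Rightarrow> 'h::complex_hilbert \<Rightarrow> 'h" and \<eta> :: "'a \<Rightarrow> 'h"
    and htens :: "'l \<Rightarrow> 'h \<Rightarrow> 't::complex_hilbert"
  assumes "compact_quantum_group tens tensL tensR \<Delta>"
    and "haar_state tens \<Delta> h" and "faithful h"
    and "A = coefficient_algebra tens \<Delta>" and "closure A = UNIV"
    and "hopf_star_algebra tens \<Delta> A \<epsilon> S"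
    and "gns_triple h \<Lambda> \<xi>"
    and "generating_functional A \<epsilon> \<phi>" and "gns_symmetric A S \<phi>"
    and "schuermann_triple A \<epsilon> \<pi> \<eta> \<phi>"
    and "hilbert_tensor htens"
    and "discrete_spectrum_on UNIV (H_op tens \<Delta> A \<phi> \<Lambda> \<xi>)"
  shows "kernel_degenerate_spectral_triple A
           (dirac_op (d_op tens \<Delta> A htens \<eta> \<Lambda> \<xi>))
           (pi_L tens \<Delta> A htens \<pi> \<Lambda> \<xi>)"
proof -
  interpret levy_process tens tensL tensR \<Delta> h \<epsilon> \<phi> S A \<Lambda> \<xi> \<pi> \<eta> htens
    by (rule levy_process.intro[OF assms(1-11)])
  show ?thesis using assms(12) by (rule spectral_triple)
qed

end
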